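(* Assume $d\ge 7$. There exists a constant $c_d>0$ such that, almost surely, $$\lim_{n\to\infty}\frac{\mathrm{BCap}(\mathcal R_n)}{n}=c_d .$$
   Context: Offspring law: $\mu$ is a fixed probability measure on $\mathbb N=\{0,1,2,\dots\}$ with $\sum_i i\mu(i)=1$ (critical) and finite positive variance $\sigma^2$. Its size-biased version is $\mu_{\rm sb}(i)=i\mu(i)$. Infinite tree: $\mathcal T$ is the random infinite plane tree built as follows. The root $\emptyset$ has $i$ offspring with probability $\mu(i-1)$ for $i\ge 1$; its first (leftmost) offspring is special and the others (if any) are normal. Independently, special vertices have offspring number distributed as $\mu_{\rm sb}$ and normal vertices have offspring number distributed as $\mu$. One of the offspring of each special vertex, chosen uniformly at random, is special and the others are normal; all offspring of normal vertices are normal. The unique infinite path from the root is the spine. The root has label $0$; the vertices to the right of the spine get positive labels (depth-first search from the root); the spine vertices other than the root and the vertices to the left of the spine get negative labels (depth-first search from infinity). The past $\mathcal T_-$ is the set of vertices with negative label (so it contains all spine vertices except the root, and not the root). Tree-indexed walk: for $x\in\mathbb Z^d$, $(S^x_u)_{u\in\mathcal T}$ is the random walk indexed by $\mathcal T$ with $S^x_\emptyset=x$, whose increments along edges are i.i.d. uniform on the $2d$ neighbors of the origin, independent of $\mathcal T$. Set $\mathcal T^x_-=\{S^x_u:u\in\mathcal T_-\}$. Branching capacity: for finite $A\subset\mathbb Z^d$, $d\ge5$, $\mathrm{BCap}(A)=\sum_{x\in A}\mathbb P(\mathcal T^x_-\cap A=\emptyset)$. $(X_n)_{n\ge0}$ is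 a simple random walk on $\mathbb Z^d$ started at the origin (increments uniform on the neighbors of the origin), and $\mathcal R_n=\{X_0,\dots,X_n\}$ is its range. *)

theory Defs
  imports "HOL-Probability.Probability"
begin

definition critical_offspring_law :: "nat pmf \<Rightarrow> bool" where
  "critical_offspring_law \<mu> \<longleftrightarrow>
     (\<lambda>i. real i * pmf \<mu> i) sums 1 \<and>
     integrable (measure_pmf \<mu>) (\<lambda>i. (real i)\<^sup>2) \<and>
     measure_pmf.variance \<mu> real > 0"

(* Meaningful only when the mean of \<mu> is 1, see pmf_size_biased. *)
definition size_biased :: "nat pmf \<Rightarrow> nat pmf" where
  "size_biased \<mu> = embed_pmf (\<lambda>i. real i * pmf \<mu> i)"

lemma pmf_size_biased:
  assumes "critical_offspring_law \<mu>"
  shows "pmf (size_biased \<mu>) i = real i * pmf \<mu> i"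
  unfolding size_biased_def
proof (rule pmf_embed_pmf)
  have s: "(\<lambda>i. real i * pmf \<mu> i) sums 1"
    using assms by (simp add: critical_offspring_law_def)
  have "(\<integral>\<^sup>+ i. ennreal (real i * pmf \<mu> i) \<partial>count_space UNIV)
      = (\<Sum>i. ennreal (real i * pmf \<mu> i))"
    by (simp add: nn_integral_count_space_nat)
  also have "\<dots> = ennreal (\<Sum>i. real i * pmf \<mu> i)"
    using s by (intro suminf_ennreal2) (auto simp: sums_iff)
  finally show "(\<integral>\<^sup>+ i. ennreal (real i * pmf \<mu> i) \<partial>count_space UNIV) = 1"
    using s by (simp add: sums_iff)
qed auto

definition lattice_neighbors :: "(int ^ 'n) set" where
  "lattice_neighbors = {axis k s | k s. s = 1 \<or> s = - 1}"

lemma finite_lattice_neighbors: "finite (lattice_neighbors :: (int ^ 'n) set)"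
proof -
  have "lattice_neighbors = (\<lambda>(k, s). axis k s :: int ^ 'n) ` (UNIV \<times> {1, - 1})"
    by (auto simp: lattice_neighbors_def)
  then show ?thesis by (metis finite_imageI finite_cartesian_product finite_class.finite_UNIV
    finite.emptyI finite.insertI)
qed

lemma lattice_neighbors_nonempty: "lattice_neighbors \<noteq> {}"
  by (auto simp: lattice_neighbors_def)

definition step_pmf :: "(int ^ 'n) pmf" where
  "step_pmf = pmf_of_set lattice_neighbors"


(* Vertices are Ulam-Harris words: the children of u are u @ [0], u @ [1], ..., from left to
   right. Every word carries a mark (N, K, J). If u turns out to be a normal vertex, N is its number
   of offspring; if u turns out to be special, K is its number of offspring and J < K is the rank
   of its special child. The root has N + 1 offspring. *)

type_synonym marks = "nat list \<Rightarrow> nat \<times> nat \<times> nat"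

definition special_mark_pmf :: "nat pmf \<Rightarrow> (nat \<times> nat) pmf" where
  "special_mark_pmf \<mu> =
     bind_pmf (size_biased \<mu>) (\<lambda>k. map_pmf (\<lambda>j. (k, j)) (pmf_of_set {..<k}))"

definition tree_measure :: "nat pmf \<Rightarrow> marks measure" where
  "tree_measure \<mu> =
     (\<Pi>\<^sub>M u\<in>UNIV. measure_pmf (pair_pmf \<mu> (special_mark_pmf \<mu>)))"

primrec spine :: "marks \<Rightarrow> nat \<Rightarrow> nat list" where
  "spine t 0 = []"
| "spine t (Suc n) =
     spine t n @ [if n = 0 then 0 else snd (snd (t (spine t n)))]"

definition special :: "marks \<Rightarrow> nat list \<Rightarrow> bool" where
  "special t u \<longleftrightarrow> (\<exists>n\<ge>1. u = spine t n)"

definition num_offspring :: "marks \<Rightarrow> nat list \<Rightarrow> nat" where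
  "num_offspring t u =
     (if u = [] then fst (t u) + 1
      else if special t u then fst (snd (t u))
      else fst (t u))"

inductive_set tree :: "marks \<Rightarrow> nat list set" for t :: marks where
  root: "[] \<in> tree t"
| child: "u \<in> tree t \<Longrightarrow> i < num_offspring t u \<Longrightarrow> u @ [i] \<in> tree t"

definition left_of_spine :: "marks \<Rightarrow> nat list \<Rightarrow> bool" where
  "left_of_spine t u \<longleftrightarrow>
     (\<exists>n i j w. spine t (Suc n) = spine t n @ [j] \<and> i < j \<and> u = spine t n @ [i] @ w)"

(* The vertices with negative label; only the sign of the labels matters. *)
definition past :: "marks \<Rightarrow> nat list set" where
  "past t = {u \<in> tree t. special t u \<or> left_of_spine t u}"


(* y u is the increment along the edge from the parent of u to u (y [] is not used). *)

definition increment_measure :: "(nat list \<Rightarrow> int ^ 'n) measure" where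
  "increment_measure = (\<Pi>\<^sub>M u\<in>UNIV. measure_pmf step_pmf)"

definition tree_walk ::
    "int ^ 'n \<Rightarrow> (nat list \<Rightarrow> int ^ 'n) \<Rightarrow> nat list \<Rightarrow> int ^ 'n" where
  "tree_walk x y u = x + (\<Sum>k = 1..length u. y (take k u))"

definition past_range ::
    "int ^ 'n \<Rightarrow> marks \<Rightarrow> (nat list \<Rightarrow> int ^ 'n) \<Rightarrow> (int ^ 'n) set" where
  "past_range x t y = tree_walk x y ` past t"

(* Intended for finite A and dimension at least 5. *)
definition BCap :: "nat pmf \<Rightarrow> (int ^ 'n) set \<Rightarrow> real" where
  "BCap \<mu> A =
     (\<Sum>x\<in>A. \<P>((t, y) in tree_measure \<mu> \<Otimes>\<^sub>M increment_measure. past_range x t y \<inter> A = {}))"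


locale simple_random_walk = prob_space M
  for M :: "'a measure" and X :: "nat \<Rightarrow> 'a \<Rightarrow> int ^ 'n" +
  assumes measurable_walk: "\<And>n. random_variable (count_space UNIV) (X n)"
    and start: "AE \<omega> in M. X 0 \<omega> = 0"
    and indep_increments:
      "indep_vars (\<lambda>_. count_space UNIV) (\<lambda>n \<omega>. X (Suc n) \<omega> - X n \<omega>) UNIV"
    and distr_increments:
      "\<And>n. distr M (count_space UNIV) (\<lambda>\<omega>. X (Suc n) \<omega> - X n \<omega>) = measure_pmf step_pmf"

definition walk_range :: "(nat \<Rightarrow> 'a \<Rightarrow> int ^ 'n) \<Rightarrow> nat \<Rightarrow> 'a \<Rightarrow> (int ^ 'n) set" where
  "walk_range X n \<omega> = (\<lambda>k. X k \<omega>) ` {0..n}"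

end

theory Submission
  imports Defs
begin

text \<open>Summing the escape probabilities over the points of the range is the same as summing over the
times \<open>k \<le> n\<close> at which the walk visits its current point for the last time. So the capacity of
\<open>{X 0, \<dots>, X n}\<close> is a sum over \<open>k \<le> n\<close> of the quantities \<open>window_escape\<close>, the
probabilities, given the walk, of the following events: the walk does not return to \<open>X k\<close> after time \<open>k\<close> within a window of times, and the branching walk started at \<open>X k\<close> avoids, with
its past, all positions of the walk in that window. By translation invariance the mean of a term
depends only on how far the window reaches to the left and to the right of \<open>k\<close>.

Enlarging the window decreases a term, and by no more than the expected number of new collisions
between the past and the walk. This is where \<open>d \<ge> 7\<close> enters. A vertex of generation \<open>l\<close> and a time
at distance \<open>g\<close> from \<open>k\<close> are joined by \<open>l + g\<close> independent steps, so that they collide with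
probability at most of order \<open>(l + g + 1)\<^bsup>-7/2\<^esup>\<close> (\<open>walk_kernel_le\<close>). The past has on average
\<open>O(l + 1)\<close> vertices in generation \<open>l\<close>, because each spine vertex has a bounded mean number of
children to the left of the spine and these start critical trees (\<open>past_generation_le\<close>).
Hence the collisions at distance \<open>g \<ge> m\<close> have total mean \<open>O(m\<^bsup>-1/4\<^esup>)\<close>, which is
\<open>collision_estimate\<close> with \<open>L = 0\<close>. In particular the means for the window \<open>[k - m, k + m]\<close> decrease to a
limit \<open>c\<close>, at a polynomial rate.

The limit is positive. Ask that for \<open>L\<close> steps the spine runs straight in one direction and has
no children on its left, and that the walk runs straight in the opposite direction, both forwards
and backwards in time. This has positive probability, and a collision under this condition
needs at least \<open>L\<close> further steps, so the conditional mean number of all collisions is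
\<open>O(L\<^bsup>-1/4\<^esup>)\<close>: this is \<open>collision_estimate\<close> again, now with \<open>L > 0\<close>. For large \<open>L\<close> it is below \<open>1/2\<close>.

For the law of large numbers, replace each term by its truncation to the window
\<open>[k - m, k + m]\<close>. Truncated terms are independent when their windows are disjoint, so their sum has
variance \<open>O(n m)\<close>, and the truncation costs \<open>O(n m\<^bsup>-1/4\<^esup>)\<close> in mean. With \<open>n = j\<^bsup>16\<^esup>\<close> and
\<open>m = j\<^bsup>8\<^esup>\<close> the resulting bound on the mean of \<open>\<bar>BCap / n - c\<bar>\<close> is summable in \<open>j\<close>, which gives almost sure
convergence along the sixteenth powers. The gaps between these are filled in because the capacity
grows by at most \<open>1\<close> in each step.\<close>

section \<open>A uniform bound on transition probabilities of the walk\<close>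

primrec line_kernel :: "nat \<Rightarrow> int \<Rightarrow> real" where
  "line_kernel 0 z = (if z = 0 then 1 else 0)"
| "line_kernel (Suc n) z = (line_kernel n (z - 1) + line_kernel n (z + 1)) / 2"

lemma line_kernel_nonneg: "0 \<le> line_kernel n z"
  by (induction n arbitrary: z) auto

lemma line_kernel_below: "z < - int n \<Longrightarrow> line_kernel n z = 0"
  by (induction n arbitrary: z) auto

lemma line_kernel_parity: "odd (z + int n) \<Longrightarrow> line_kernel n z = 0"
  by (induction n arbitrary: z) auto

lemma line_kernel_eq_binomial:
  "line_kernel n (2 * int k - int n) = real (n choose k) / 2 ^ n"
proof (induction n arbitrary: k)
  case 0
  then show ?case by (cases k) simp_all
next
  case (Suc n)
  show ?case
  proof (cases k)
    case 0
    have "line_kernel n (- int n - 2) = 0" by (rule line_kernel_below) simp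
    moreover have "line_kernel n (- int n) = 1 / 2 ^ n" using Suc.IH[of 0] by simp
    moreover have "2 * int k - int (Suc n) - 1 = - int n - 2" "2 * int k - int (Suc n) + 1 = - int n"
      using 0 by simp_all
    ultimately show ?thesis using 0 by (simp only: line_kernel.simps) simp
  next
    case (Suc j)
    have e: "2 * int k - int (Suc n) - 1 = 2 * int j - int n"
      "2 * int k - int (Suc n) + 1 = 2 * int (Suc j) - int n"
      using Suc by simp_all
    have "line_kernel (Suc n) (2 * int k - int (Suc n))
        = (real (n choose j) / 2 ^ n + real (n choose Suc j) / 2 ^ n) / 2"
      by (simp only: line_kernel.simps e Suc.IH)
    then show ?thesis by (simp only: Suc binomial_Suc_Suc) (simp add: add_divide_distrib)
  qed
qed

lemma central_binomial_step:
  "(k + 1) * ((2 * k + 2) choose (k + 1)) = 2 * (2 * k + 1) * ((2 * k) choose k)"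
proof -
  have "(k + 1) * ((2 * k + 2) choose (k + 1)) = (2 * k + 2) * ((2 * k + 1) choose k)"
    using Suc_times_binomial[of k "2 * k + 1"] by (simp only: Suc_eq_plus1) simp
  also have "(2 * k + 1) choose k = (2 * k + 1) choose (k + 1)"
    using central_binomial_odd[of "2 * k + 1"] by (simp only: Suc_eq_plus1) simp
  also have "(2 * k + 2) * ((2 * k + 1) choose (k + 1)) = 2 * ((k + 1) * ((2 * k + 1) choose (k + 1)))"
    by simp
  also have "(k + 1) * ((2 * k + 1) choose (k + 1)) = (2 * k + 1) * ((2 * k) choose k)"
    using Suc_times_binomial[of k "2 * k"] by (simp only: Suc_eq_plus1)
  finally show ?thesis by (simp only: mult.assoc)
qed

text \<open>The square is what makes the induction close: the squared ratio of consecutive terms is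
\<open>((2k + 1) / (2k + 2))\<^sup>2\<close>, which is at most \<open>(2k + 1) / (2k + 3)\<close>.\<close>

lemma central_binomial_square_le:
  "(real ((2 * k) choose k) / 4 ^ k)\<^sup>2 \<le> 1 / (2 * real k + 1)"
proof (induction k)
  case 0
  then show ?case by simp
next
  case (Suc k)
  let ?B = "real ((2 * k) choose k) / 4 ^ k"
  have "real ((k + 1) * ((2 * k + 2) choose (k + 1))) = real (2 * (2 * k + 1) * ((2 * k) choose k))"
    by (simp only: central_binomial_step)
  then have "(real k + 1) * real ((2 * k + 2) choose (k + 1)) = 2 * (2 * real k + 1) * real ((2 * k) choose k)"
    by (simp only: of_nat_mult of_nat_add of_nat_1 of_nat_numeral)
  then have "real ((2 * k + 2) choose (k + 1)) = 2 * (2 * real k + 1) * real ((2 * k) choose k) / (real k + 1)"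
    by (simp add: eq_divide_eq mult.commute del: binomial_Suc_Suc)
  moreover have "2 * Suc k = 2 * k + 2" "Suc k = k + 1" by simp_all
  ultimately have R: "real ((2 * Suc k) choose Suc k) = 2 * (2 * real k + 1) * real ((2 * k) choose k) / (real k + 1)"
    by metis
  have eq: "real ((2 * Suc k) choose Suc k) / 4 ^ Suc k = (2 * real k + 1) / (2 * real k + 2) * ?B"
    unfolding R by (simp add: divide_simps del: binomial_Suc_Suc) (simp add: algebra_simps)
  have "(real ((2 * Suc k) choose Suc k) / 4 ^ Suc k)\<^sup>2
      = ((2 * real k + 1) / (2 * real k + 2))\<^sup>2 * ?B\<^sup>2"
    unfolding eq by (simp only: power_mult_distrib)
  also have "\<dots> \<le> ((2 * real k + 1) / (2 * real k + 2))\<^sup>2 * (1 / (2 * real k + 1))"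
    by (intro mult_left_mono Suc.IH) auto
  also have "\<dots> \<le> 1 / (2 * real (Suc k) + 1)"
    by (simp add: divide_simps power2_eq_square) (simp add: algebra_simps)
  finally show ?case .
qed

lemma binomial_le_inverse_sqrt: "real (n choose k) / 2 ^ n \<le> 1 / sqrt (real n + 1)"
proof -
  have B: "real ((2 * j) choose j) / 4 ^ j \<le> 1 / sqrt (2 * real j + 1)" for j
  proof -
    have "real ((2 * j) choose j) / 4 ^ j \<le> sqrt (1 / (2 * real j + 1))"
      by (rule real_le_rsqrt) (rule central_binomial_square_le)
    then show ?thesis by (simp add: real_sqrt_divide)
  qed
  have "real (n choose k) / 2 ^ n \<le> real (n choose (n div 2)) / 2 ^ n"
    by (intro divide_right_mono) (auto simp: binomial_maximum)
  also have "\<dots> \<le> 1 / sqrt (real n + 1)"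
  proof (cases "even n")
    case True
    then obtain j where "n = 2 * j" by (auto elim: evenE)
    then show ?thesis using B[of j] by (simp add: power_mult)
  next
    case False
    then obtain j where j: "n = 2 * j + 1" by (auto elim: oddE)
    have "(2 * j + 1) choose j = (2 * j + 1) choose (Suc j)"
      using central_binomial_odd[of "2 * j + 1"] by simp
    then have "(2 * Suc j) choose (Suc j) = 2 * ((2 * j + 1) choose j)" by simp
    then have "real (n choose (n div 2)) / 2 ^ n = real ((2 * Suc j) choose Suc j) / 4 ^ Suc j"
      using j by (simp add: power_mult)
    also have "\<dots> \<le> 1 / sqrt (2 * real (Suc j) + 1)" by (rule B)
    also have "\<dots> \<le> 1 / sqrt (real n + 1)" using j by (intro divide_left_mono) auto
    finally show ?thesis .
  qed
  finally show ?thesis .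
qed

lemma line_kernel_le: "line_kernel n z \<le> 1 / sqrt (real n + 1)"
proof (cases "z < - int n \<or> odd (z + int n)")
  case True
  then have "line_kernel n z = 0" using line_kernel_below line_kernel_parity by blast
  then show ?thesis by simp
next
  case False
  then have "even (z + int n)" by simp
  then obtain j where j: "z + int n = 2 * j" by (rule evenE)
  with False have "z = 2 * int (nat j) - int n" by auto
  then show ?thesis
    using line_kernel_eq_binomial[of n "nat j"] binomial_le_inverse_sqrt[of n "nat j"] by simp
qed

lemma lattice_neighbors_eq:
  "(lattice_neighbors :: (int ^ 'n) set) = (\<lambda>(k, s). axis k s) ` (UNIV \<times> {1, - 1})"
  by (auto simp: lattice_neighbors_def)

lemma inj_on_axis_units: "inj_on (\<lambda>(k, s). axis k s :: int ^ 'n) (UNIV \<times> {1, - 1})"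
  by (auto simp: inj_on_def axis_eq_axis)

lemma sum_lattice_neighbors:
  fixes f :: "int ^ 'n \<Rightarrow> 'b::comm_monoid_add"
  shows "(\<Sum>s\<in>lattice_neighbors. f s) = (\<Sum>k\<in>UNIV. f (axis k 1) + f (axis k (- 1)))"
proof -
  have "(\<Sum>s\<in>lattice_neighbors. f s) = (\<Sum>(k, s)\<in>UNIV \<times> {1, - 1}. f (axis k s))"
    unfolding lattice_neighbors_eq
    by (subst sum.reindex[OF inj_on_axis_units]) (simp add: case_prod_unfold)
  also have "\<dots> = (\<Sum>k\<in>UNIV. \<Sum>s\<in>{1, - 1}. f (axis k s))"
    by (simp only: sum.cartesian_product)
  finally show ?thesis by simp
qed

lemma card_lattice_neighbors: "card (lattice_neighbors :: (int ^ 'n) set) = 2 * CARD('n)"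
proof -
  have "card (lattice_neighbors :: (int ^ 'n) set) = (\<Sum>s\<in>(lattice_neighbors :: (int ^ 'n) set). 1)"
    by simp
  also have "\<dots> = 2 * CARD('n)" by (subst sum_lattice_neighbors) simp
  finally show ?thesis .
qed

primrec walk_kernel :: "nat \<Rightarrow> int ^ 'n \<Rightarrow> real" where
  "walk_kernel 0 z = (if z = 0 then 1 else 0)"
| "walk_kernel (Suc n) z =
     (\<Sum>s\<in>lattice_neighbors. walk_kernel n (z - s)) / (2 * real CARD('n))"

lemma neighbor_component: "s \<in> lattice_neighbors \<Longrightarrow> \<bar>s $ i\<bar> \<le> 1"
  by (auto simp: lattice_neighbors_def axis_def)

lemma walk_kernel_eq_0: "int n < \<bar>z $ i\<bar> \<Longrightarrow> walk_kernel n z = 0"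
proof (induction n arbitrary: z)
  case 0
  then show ?case by auto
next
  case (Suc n)
  have "walk_kernel n (z - s) = 0" if "s \<in> lattice_neighbors" for s
    using neighbor_component[OF that, of i] Suc.prems by (intro Suc.IH) auto
  then show ?case by simp
qed

text \<open>Choosing first the coordinate of each of the \<open>m\<close> steps makes the coordinates of the walk
independent: given that coordinate \<open>j\<close> was chosen \<open>c j\<close> times, they are one-dimensional walks of
\<open>c j\<close> steps. The kernel below averages the resulting product over \<open>m\<close> uniform choices of
coordinates made on top of the counts \<open>c\<close>.\<close>

primrec count_kernel :: "nat \<Rightarrow> ('n::finite \<Rightarrow> nat) \<Rightarrow> int ^ 'n \<Rightarrow> real" where
  "count_kernel 0 c z = (\<Prod>j\<in>UNIV. line_kernel (c j) (z $ j))"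
| "count_kernel (Suc m) c z = (\<Sum>i\<in>UNIV. count_kernel m (c(i := Suc (c i))) z) / real CARD('n)"

lemma count_kernel_step:
  "(\<Sum>s\<in>lattice_neighbors. count_kernel m c (z - s)) / (2 * real CARD('n)) = count_kernel (Suc m) c z"
  for z :: "int ^ 'n"
proof (induction m arbitrary: c z)
  case 0
  have shift: "(\<Prod>j\<in>UNIV. line_kernel (c j) ((z - axis k s) $ j))
      = line_kernel (c k) (z $ k - s) * (\<Prod>j\<in>UNIV - {k}. line_kernel (c j) (z $ j))" for k s
    by (subst prod.remove[of _ k]) (auto intro!: prod.cong simp: axis_def)
  have "(\<Prod>j\<in>UNIV. line_kernel ((c(k := Suc (c k))) j) (z $ j))
      = line_kernel (Suc (c k)) (z $ k) * (\<Prod>j\<in>UNIV - {k}. line_kernel (c j) (z $ j))" for k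
    by (subst prod.remove[of _ k]) (auto intro!: prod.cong)
  then have "(\<Prod>j\<in>UNIV. line_kernel ((c(k := Suc (c k))) j) (z $ j))
      = ((\<Prod>j\<in>UNIV. line_kernel (c j) ((z - axis k 1) $ j))
       + (\<Prod>j\<in>UNIV. line_kernel (c j) ((z - axis k (- 1)) $ j))) / 2" for k
    unfolding shift by (simp add: algebra_simps)
  then have "count_kernel (Suc 0) c z = (\<Sum>k\<in>UNIV. ((\<Prod>j\<in>UNIV. line_kernel (c j) ((z - axis k 1) $ j))
       + (\<Prod>j\<in>UNIV. line_kernel (c j) ((z - axis k (- 1)) $ j))) / 2) / real CARD('n)"
    by (simp only: count_kernel.simps)
  also have "\<dots> = (\<Sum>s\<in>lattice_neighbors. count_kernel 0 c (z - s)) / (2 * real CARD('n))"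
    by (simp only: sum_lattice_neighbors sum_divide_distrib[symmetric] count_kernel.simps divide_divide_eq_left)
  finally show ?case by (rule sym)
next
  case (Suc m)
  have "(\<Sum>s\<in>lattice_neighbors. count_kernel (Suc m) c (z - s))
     = (\<Sum>i\<in>UNIV. \<Sum>s\<in>lattice_neighbors. count_kernel m (c(i := Suc (c i))) (z - s)) / real CARD('n)"
    unfolding count_kernel.simps sum_divide_distrib[symmetric] by (subst sum.swap) (rule refl)
  then have "(\<Sum>s\<in>lattice_neighbors. count_kernel (Suc m) c (z - s)) / (2 * real CARD('n))
     = (\<Sum>i\<in>UNIV. (\<Sum>s\<in>lattice_neighbors. count_kernel m (c(i := Suc (c i))) (z - s))
          / (2 * real CARD('n))) / real CARD('n)"
    unfolding sum_divide_distrib[symmetric] by (simp del: fun_upd_apply count_kernel.simps)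
  then show ?case by (simp only: Suc.IH count_kernel.simps)
qed

lemma walk_kernel_eq_count_kernel: "walk_kernel m z = count_kernel m (\<lambda>_. 0) z"
proof (induction m arbitrary: z)
  case 0
  show ?case by (auto simp: vec_eq_iff intro!: prod_zero)
next
  case (Suc m)
  then show ?case by (simp only: walk_kernel.simps count_kernel_step)
qed

lemma sqrt_ratio_le:
  fixes x :: real assumes "0 \<le> x"
  shows "1 / sqrt (x + 2) \<le> (1 - 1 / (2 * (x + 2))) * (1 / sqrt (x + 1))"
proof -
  have "(x + 1) / (x + 2) \<le> (1 - 1 / (2 * (x + 2)))\<^sup>2"
    using assms by (simp add: divide_simps power2_eq_square) (simp add: algebra_simps)
  then have "sqrt ((x + 1) / (x + 2)) \<le> 1 - 1 / (2 * (x + 2))"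
    using assms by (intro real_le_lsqrt) (auto simp: field_simps)
  then have "sqrt (x + 1) / sqrt (x + 2) \<le> 1 - 1 / (2 * (x + 2))"
    by (simp add: real_sqrt_divide)
  then have "sqrt (x + 1) / sqrt (x + 2) * (1 / sqrt (x + 1))
      \<le> (1 - 1 / (2 * (x + 2))) * (1 / sqrt (x + 1))"
    using assms by (intro mult_right_mono) auto
  then show ?thesis using assms by simp
qed

text \<open>The inequality between the arithmetic and the harmonic mean. Each \<open>1 / a i\<close> lies above the
tangent of \<open>x \<mapsto> 1 / x\<close> at the arithmetic mean.\<close>

lemma sum_inverse_ge:
  fixes a :: "'n::finite \<Rightarrow> real"
  assumes "\<And>i. a i > 0"
  shows "(real CARD('n))\<^sup>2 / (\<Sum>i\<in>UNIV. a i) \<le> (\<Sum>i\<in>UNIV. 1 / a i)"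
proof -
  have S: "(\<Sum>i\<in>UNIV. a i) > 0" using assms by (intro sum_pos) auto
  let ?t = "real CARD('n) / (\<Sum>i\<in>UNIV. a i)"
  have "2 * ?t - ?t\<^sup>2 * a i \<le> 1 / a i" for i
  proof -
    have "0 \<le> (1 / a i) * (1 - ?t * a i)\<^sup>2" using assms[of i] by simp
    also have "\<dots> = 1 / a i - (2 * ?t - ?t\<^sup>2 * a i)"
      using assms[of i] by (simp add: power2_eq_square algebra_simps)
    finally show ?thesis by simp
  qed
  then have "(\<Sum>i\<in>UNIV. 2 * ?t - ?t\<^sup>2 * a i) \<le> (\<Sum>i\<in>UNIV. 1 / a i)" by (intro sum_mono)
  also have "(\<Sum>i\<in>UNIV. 2 * ?t - ?t\<^sup>2 * a i) = 2 * ?t * real CARD('n) - ?t\<^sup>2 * (\<Sum>i\<in>UNIV. a i)"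
    by (simp add: sum_subtractf sum_distrib_left)
  also have "\<dots> = (real CARD('n))\<^sup>2 / (\<Sum>i\<in>UNIV. a i)"
    using S by (simp add: power2_eq_square field_simps)
  finally show ?thesis .
qed

text \<open>The weight \<open>\<Prod>j. (c j + 1)\<^bsup>-1/2\<^esup>\<close>, which bounds the product of the one-dimensional kernels, is
contracted by one uniform choice of a coordinate: raising \<open>c i\<close> multiplies it by at most
\<open>1 - 1 / (2 (c i + 2))\<close>, and the average of this factor over \<open>i\<close> is largest for equal counts.
This replaces any control of the fluctuations of the counts.\<close>

lemma count_kernel_le:
  fixes z :: "int ^ 'n" and c :: "'n::finite \<Rightarrow> nat"
  defines "d \<equiv> real CARD('n)"
  shows "count_kernel m c z \<le> (\<Prod>j\<in>UNIV. 1 / sqrt (real (c j) + 1))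
    * (\<Prod>k<m. 1 - (d / 2) / (real (\<Sum>j\<in>UNIV. c j) + real k + 2 * d))"
proof (induction m arbitrary: c)
  case 0
  then show ?case by (auto intro!: prod_mono line_kernel_nonneg line_kernel_le)
next
  case (Suc m)
  have d: "d \<ge> 1" unfolding d_def by (simp add: Suc_leI)
  let ?S = "real (\<Sum>j\<in>UNIV. c j)"
  let ?f = "\<Prod>j\<in>UNIV. 1 / sqrt (real (c j) + 1)"
  let ?R = "\<Prod>k<m. 1 - (d / 2) / (?S + real (Suc k) + 2 * d)"
  have R0: "0 \<le> ?R"
  proof (intro prod_nonneg ballI)
    fix k assume "k \<in> {..<m}"
    have "0 \<le> ?S" by (rule of_nat_0_le_iff)
    then have "d / 2 \<le> ?S + real (Suc k) + 2 * d" using d by linarith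
    then show "0 \<le> 1 - (d / 2) / (?S + real (Suc k) + 2 * d)"
      using d by (auto simp: divide_le_eq_1)
  qed
  have f0: "0 \<le> ?f" by (intro prod_nonneg) auto
  have fi: "(\<Prod>j\<in>UNIV. 1 / sqrt (real ((c(i := Suc (c i))) j) + 1))
      \<le> (1 - 1 / (2 * (real (c i) + 2))) * ?f" for i
  proof -
    have "(\<Prod>j\<in>UNIV. 1 / sqrt (real ((c(i := Suc (c i))) j) + 1))
      = 1 / sqrt (real (c i) + 2) * (\<Prod>j\<in>UNIV - {i}. 1 / sqrt (real (c j) + 1))"
      by (subst prod.remove[of _ i]) (auto intro!: prod.cong simp: add.commute)
    also have "\<dots> \<le> ((1 - 1 / (2 * (real (c i) + 2))) * (1 / sqrt (real (c i) + 1)))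
        * (\<Prod>j\<in>UNIV - {i}. 1 / sqrt (real (c j) + 1))"
      by (intro mult_right_mono sqrt_ratio_le prod_nonneg) auto
    also have "\<dots> = (1 - 1 / (2 * (real (c i) + 2))) * ?f"
      by (subst (2) prod.remove[of _ i]) (auto simp: mult_ac)
    finally show ?thesis .
  qed
  have Si: "real (\<Sum>j\<in>UNIV. (c(i := Suc (c i))) j) = ?S + 1" for i
  proof -
    have "(\<Sum>j\<in>UNIV. (c(i := Suc (c i))) j) = (\<Sum>j\<in>UNIV. c j) + 1"
      by (subst (1 2) sum.remove[of _ i]) (auto intro!: sum.cong)
    then show ?thesis by (metis of_nat_1 of_nat_add)
  qed
  define G where "G = ?f * ?R"
  have G0: "0 \<le> G" unfolding G_def using f0 R0 by (rule mult_nonneg_nonneg)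
  have step: "count_kernel m (c(i := Suc (c i))) z \<le> (1 - 1 / (2 * (real (c i) + 2))) * G" for i
  proof -
    have "count_kernel m (c(i := Suc (c i))) z
      \<le> (\<Prod>j\<in>UNIV. 1 / sqrt (real ((c(i := Suc (c i))) j) + 1)) * ?R"
      using Suc.IH[of "c(i := Suc (c i))"] unfolding Si by (simp only: of_nat_Suc add_ac)
    also have "\<dots> \<le> (1 - 1 / (2 * (real (c i) + 2))) * ?f * ?R"
      by (intro mult_right_mono fi R0)
    finally show ?thesis unfolding G_def by (simp only: mult.assoc)
  qed
  have "count_kernel (Suc m) c z
      \<le> (\<Sum>i\<in>UNIV. (1 - 1 / (2 * (real (c i) + 2))) * G) / d"
    unfolding count_kernel.simps d_def[symmetric]
    using d by (intro divide_right_mono sum_mono step) simp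
  also have "\<dots> = (1 - (\<Sum>i\<in>UNIV. 1 / (real (c i) + 2)) / (2 * d)) * G"
  proof -
    have "(\<Sum>i\<in>UNIV. (1 - 1 / (2 * (real (c i) + 2))) * G)
        = (\<Sum>i\<in>UNIV. 1 - (1 / (real (c i) + 2)) / 2) * G"
      unfolding sum_distrib_right[symmetric] by (simp add: mult.commute)
    also have "(\<Sum>i\<in>UNIV. 1 - (1 / (real (c i) + 2)) / 2) = d - (\<Sum>i\<in>UNIV. 1 / (real (c i) + 2)) / 2"
      by (simp only: sum_subtractf sum_divide_distrib[symmetric]) (simp add: d_def)
    finally show ?thesis using d by (simp add: diff_divide_distrib left_diff_distrib)
  qed
  also have "\<dots> \<le> (1 - (d / 2) / (?S + 2 * d)) * G"
  proof (intro mult_right_mono)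
    have "d\<^sup>2 / (\<Sum>i\<in>(UNIV::'n set). real (c i) + 2) \<le> (\<Sum>i\<in>UNIV. 1 / (real (c i) + 2))"
      unfolding d_def by (rule sum_inverse_ge) auto
    moreover have "(\<Sum>i\<in>(UNIV::'n set). real (c i) + 2) = ?S + 2 * d"
      by (simp add: sum.distrib d_def)
    ultimately have "d\<^sup>2 / (?S + 2 * d) / (2 * d) \<le> (\<Sum>i\<in>UNIV. 1 / (real (c i) + 2)) / (2 * d)"
      using d by (intro divide_right_mono) auto
    moreover have "d\<^sup>2 / (?S + 2 * d) / (2 * d) = (d / 2) / (?S + 2 * d)"
      using d by (simp add: power2_eq_square)
    ultimately show "1 - (\<Sum>i\<in>UNIV. 1 / (real (c i) + 2)) / (2 * d) \<le> 1 - (d / 2) / (?S + 2 * d)"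
      by simp
  qed (rule G0)
  also have "(1 - (d / 2) / (?S + 2 * d)) * G
     = ?f * (\<Prod>k<Suc m. 1 - (d / 2) / (?S + real k + 2 * d))"
    unfolding G_def prod.lessThan_Suc_shift by simp
  finally show ?case .
qed

lemma one_minus_le_powr:
  fixes x a :: real assumes "0 \<le> a" "0 < x"
  shows "1 - a / x \<le> ((x + 1) / x) powr (- a)"
proof -
  have "ln ((x + 1) / x) \<le> 1 / x"
    using ln_add_one_self_le_self[of "1 / x"] assms by (simp add: field_simps)
  then have "- a * (1 / x) \<le> - a * ln ((x + 1) / x)" using assms by (intro mult_left_mono_neg) auto
  moreover have "1 + (- a * ln ((x + 1) / x)) \<le> exp (- a * ln ((x + 1) / x))" by (rule exp_ge_add_one_self)
  ultimately show ?thesis using assms by (simp add: powr_def)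
qed

text \<open>The product of the contraction factors is of order \<open>m\<^bsup>-d/2\<^esup>\<close>; only the exponent for \<open>d = 7\<close> is
kept.\<close>

lemma walk_kernel_le:
  fixes z :: "int ^ 'n"
  assumes "CARD('n::finite) \<ge> 7"
  shows "walk_kernel m z \<le> (2 * real CARD('n)) powr (7/2) * (real m + 1) powr (- 7/2)"
proof -
  define d where "d = real CARD('n)"
  have d: "d \<ge> 7" using assms by (simp add: d_def)
  have "walk_kernel m z \<le> (\<Prod>k<m. 1 - (d / 2) / (real k + 2 * d))"
    using count_kernel_le[of m "\<lambda>_. 0" z] by (simp add: walk_kernel_eq_count_kernel d_def)
  also have "\<dots> \<le> ((real m + 2 * d) / (2 * d)) powr (- (d / 2))"
  proof (induction m)
    case 0
    then show ?case using d by simp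
  next
    case (Suc m)
    have "(\<Prod>k<Suc m. 1 - (d / 2) / (real k + 2 * d))
       \<le> ((real m + 2 * d) / (2 * d)) powr (- (d / 2)) *
         (((real m + 2 * d) + 1) / (real m + 2 * d)) powr (- (d / 2))"
      unfolding prod.lessThan_Suc
    proof (rule mult_mono)
      show "0 \<le> 1 - (d / 2) / (real m + 2 * d)" using d by (auto simp: divide_le_eq_1)
      show "(\<Prod>k<m. 1 - (d / 2) / (real k + 2 * d)) \<le> ((real m + 2 * d) / (2 * d)) powr - (d / 2)"
        by (rule Suc)
      have "1 - (d / 2) / (real m + 2 * d) \<le> ((real m + 2 * d + 1) / (real m + 2 * d)) powr - (d / 2)"
        using d by (intro one_minus_le_powr) auto
      then show "1 - (d / 2) / (real m + 2 * d) \<le> ((real m + 2 * d + 1) / (real m + 2 * d)) powr - (d / 2)" .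
    qed auto
    also have "\<dots> = ((real (Suc m) + 2 * d) / (2 * d)) powr (- (d / 2))"
      using d by (subst powr_mult[symmetric]) (auto simp: add_ac)
    finally show ?case .
  qed
  also have "\<dots> \<le> ((real m + 2 * d) / (2 * d)) powr (- 7 / 2)"
    using d by (intro powr_mono) (auto simp: field_simps)
  also have "\<dots> \<le> ((real m + 1) / (2 * d)) powr (- 7 / 2)"
    using d by (intro powr_mono2') (auto intro!: divide_right_mono divide_pos_pos)
  also have "\<dots> = (2 * d) powr (7/2) * (real m + 1) powr (- 7/2)"
    using d by (subst powr_divide) (auto simp: powr_minus field_simps)
  finally show ?thesis by (simp add: d_def)
qed

section \<open>Families of independent uniform lattice steps\<close>

text \<open>Independence and uniformity of the steps are encoded by the probabilities of finite cylinders.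
This form is stable under products of measures and under reindexing, and it makes the sum over
the free steps below an elementary induction.\<close>

locale iid_steps = prob_space N
  for N :: "'b measure" and Y :: "'i \<Rightarrow> 'b \<Rightarrow> int ^ 'n" +
  assumes measurable_step [measurable]: "\<And>i. Y i \<in> measurable N (count_space UNIV)"
    and prob_cylinder:
      "\<And>E e. finite E \<Longrightarrow> e \<in> E \<rightarrow> lattice_neighbors \<Longrightarrow>
         prob {\<omega>\<in>space N. \<forall>i\<in>E. Y i \<omega> = e i} = (1 / (2 * real CARD('n))) ^ card E"
begin

lemma prob_step: "s \<in> lattice_neighbors \<Longrightarrow> prob {\<omega>\<in>space N. Y i \<omega> = s} = 1 / (2 * real CARD('n))"
  using prob_cylinder[of "{i}" "\<lambda>_. s"] by simp

lemma AE_step: "AE \<omega> in N. Y i \<omega> \<in> lattice_neighbors"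
proof -
  have "prob (\<Union>s\<in>lattice_neighbors. {\<omega>\<in>space N. Y i \<omega> = s})
      = (\<Sum>s\<in>(lattice_neighbors :: (int ^ 'n) set). prob {\<omega>\<in>space N. Y i \<omega> = s})"
    by (intro finite_measure_finite_Union finite_lattice_neighbors) (auto simp: disjoint_family_on_def)
  also have "\<dots> = 1" by (simp add: prob_step card_lattice_neighbors)
  finally show ?thesis
    by (subst (asm) prob_eq_1) (auto elim!: eventually_mono)
qed

lemma AE_all_steps: "finite W \<Longrightarrow> AE \<omega> in N. \<forall>i\<in>W. Y i \<omega> \<in> lattice_neighbors"
  by (intro AE_finite_allI AE_step)

lemma prob_split_step:
  assumes A: "{\<omega>\<in>space N. A \<omega>} \<in> events"
  shows "prob {\<omega>\<in>space N. A \<omega>}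
    = (\<Sum>s\<in>lattice_neighbors. prob {\<omega>\<in>space N. A \<omega> \<and> Y i \<omega> = s})"
proof -
  have E: "{\<omega>\<in>space N. A \<omega> \<and> Y i \<omega> = s} \<in> events" for s
    using A by measurable
  have "prob {\<omega>\<in>space N. A \<omega>} = prob (\<Union>s\<in>lattice_neighbors. {\<omega>\<in>space N. A \<omega> \<and> Y i \<omega> = s})"
  proof (rule measure_eq_AE)
    show "AE x in N. (x \<in> {\<omega> \<in> space N. A \<omega>}) = (x \<in> (\<Union>s\<in>lattice_neighbors. {\<omega> \<in> space N. A \<omega> \<and> Y i \<omega> = s}))"
      using AE_step[of i] by eventually_elim auto
    show "(\<Union>s\<in>lattice_neighbors. {\<omega> \<in> space N. A \<omega> \<and> Y i \<omega> = s}) \<in> events"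
      using finite_lattice_neighbors E by (intro sets.finite_UN) auto
  qed (use A in auto)
  also have "\<dots> = (\<Sum>s\<in>lattice_neighbors. prob {\<omega>\<in>space N. A \<omega> \<and> Y i \<omega> = s})"
    using E by (intro finite_measure_finite_Union finite_lattice_neighbors) (auto simp: disjoint_family_on_def)
  finally show ?thesis .
qed

lemma measurable_signed_sum [measurable]:
  "(\<lambda>\<omega>. \<Sum>i\<in>D. if i \<in> P then Y i \<omega> else - Y i \<omega>) \<in> measurable N (count_space UNIV)"
proof (induction D rule: infinite_finite_induct)
  case (insert d D)
  have [measurable]: "(\<lambda>\<omega>. \<Sum>i\<in>D. if i \<in> P then Y i \<omega> else - Y i \<omega>) \<in> measurable N (count_space UNIV)"
    by (rule insert)
  have "(\<lambda>\<omega>. (if d \<in> P then Y d \<omega> else - Y d \<omega>) + (\<Sum>i\<in>D. if i \<in> P then Y i \<omega> else - Y i \<omega>))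
      \<in> measurable N (count_space UNIV)"
    by measurable
  then show ?case using insert by simp
qed auto

text \<open>Prescribing the steps in \<open>E\<close> and the signed sum of the disjoint steps in \<open>D\<close>: revealing one
step of \<open>D\<close> moves it to \<open>E\<close> and shortens the walk by one, and the signs are harmless because a
step is as likely as its negative. A collision of two walks that are partly prescribed is of this form.\<close>

lemma prob_cylinder_signed_sum:
  assumes "finite D" "finite E" "E \<inter> D = {}" "e \<in> E \<rightarrow> lattice_neighbors"
  shows "prob {\<omega>\<in>space N. (\<forall>i\<in>E. Y i \<omega> = e i) \<and> (\<Sum>i\<in>D. if i \<in> P then Y i \<omega> else - Y i \<omega>) = z}
    = (1 / (2 * real CARD('n))) ^ card E * walk_kernel (card D) z"
  using assms
proof (induction D arbitrary: E e z rule: finite_induct)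
  case empty
  show ?case
  proof (cases "z = 0")
    case True
    then show ?thesis using empty prob_cylinder[of E e] by simp
  next
    case False
    then have "0 \<noteq> z" by simp
    then show ?thesis by simp
  qed
next
  case (insert d D)
  let ?q = "1 / (2 * real CARD('n))"
  let ?S = "\<lambda>D \<omega>. \<Sum>i\<in>D. if i \<in> P then Y i \<omega> else - Y i \<omega>"
  let ?A = "\<lambda>\<omega>. (\<forall>i\<in>E. Y i \<omega> = e i) \<and> ?S (insert d D) \<omega> = z"
  have [measurable]: "Measurable.pred N (\<lambda>\<omega>. \<forall>i\<in>E. Y i \<omega> = e i)"
    using insert.prems by (intro pred_intros_finite) auto
  have m: "{\<omega>\<in>space N. ?A \<omega>} \<in> events" by measurable
  have card: "card (insert d E) = Suc (card E)"
    using insert by (subst card_insert_disjoint) auto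
  have one: "prob {\<omega>\<in>space N. ?A \<omega> \<and> Y d \<omega> = s}
      = ?q ^ card E * (walk_kernel (card D) (z - (if d \<in> P then s else - s)) * ?q)"
    if s: "s \<in> lattice_neighbors" for s
  proof -
    have "{\<omega>\<in>space N. ?A \<omega> \<and> Y d \<omega> = s} =
       {\<omega>\<in>space N. (\<forall>i\<in>insert d E. Y i \<omega> = (e(d := s)) i) \<and> ?S D \<omega> = z - (if d \<in> P then s else - s)}"
      using insert by (auto simp: algebra_simps)
    also have "prob \<dots> = ?q ^ card (insert d E) * walk_kernel (card D) (z - (if d \<in> P then s else - s))"
      using insert s by (intro insert.IH) auto
    finally show ?thesis by (simp add: card)
  qed
  have "prob {\<omega>\<in>space N. ?A \<omega>} = (\<Sum>s\<in>lattice_neighbors. prob {\<omega>\<in>space N. ?A \<omega> \<and> Y d \<omega> = s})"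
    by (rule prob_split_step[OF m])
  also have "\<dots> = (\<Sum>s\<in>lattice_neighbors.
      ?q ^ card E * (walk_kernel (card D) (z - (if d \<in> P then s else - s)) * ?q))"
    by (rule sum.cong[OF refl one])
  also have "\<dots> = ?q ^ card E * (\<Sum>s\<in>lattice_neighbors. walk_kernel (card D) (z - (if d \<in> P then s else - s))) * ?q"
    by (simp only: sum_distrib_left[symmetric] sum_distrib_right[symmetric] mult.assoc)
  also have "(\<Sum>s\<in>lattice_neighbors. walk_kernel (card D) (z - (if d \<in> P then s else - s)))
      = (\<Sum>s\<in>lattice_neighbors. walk_kernel (card D) (z - s))"
  proof (cases "d \<in> P")
    case False
    have axis_minus: "axis k (- x) = - axis k x" for k and x :: int
      by (auto simp: axis_def vec_eq_iff)
    show ?thesis using False by (simp add: sum_lattice_neighbors axis_minus add.commute)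
  qed simp
  finally show ?case using insert by simp
qed

lemma prob_cylinder_eq:
  assumes "finite W" "g \<in> PiE W (\<lambda>_. lattice_neighbors)"
  shows "prob {\<omega>\<in>space N. \<forall>i\<in>W. Y i \<omega> = g i} = (1 / (2 * real CARD('n))) ^ card W"
  using assms by (intro prob_cylinder) (auto simp: PiE_iff)

lemma measurable_finitely_determined:
  fixes F :: "('i \<Rightarrow> int ^ 'n) \<Rightarrow> real"
  assumes "finite W" "\<And>g h. (\<And>i. i \<in> W \<Longrightarrow> g i = h i) \<Longrightarrow> F g = F h"
  shows "(\<lambda>\<omega>. F (\<lambda>i. Y i \<omega>)) \<in> borel_measurable N"
  using assms
proof (induction W arbitrary: F rule: finite_induct)
  case empty
  have "(\<lambda>\<omega>. F (\<lambda>i. Y i \<omega>)) = (\<lambda>\<omega>. F (\<lambda>i. 0))"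
    by (rule ext) (rule empty.prems, simp)
  then show ?case by (simp only: borel_measurable_const)
next
  case (insert w W)
  have "(\<lambda>\<omega>. F ((\<lambda>i. Y i \<omega>)(w := v))) \<in> borel_measurable N" for v
  proof (rule insert.IH)
    fix g h :: "'i \<Rightarrow> int ^ 'n" assume "\<And>i. i \<in> W \<Longrightarrow> g i = h i"
    then show "F (g(w := v)) = F (h(w := v))" by (intro insert.prems) auto
  qed
  then have "(\<lambda>\<omega>. F ((\<lambda>i. Y i \<omega>)(w := Y w \<omega>))) \<in> borel_measurable N"
    by (rule measurable_compose_countable'[where I = UNIV]) auto
  moreover have "(\<lambda>i. Y i \<omega>)(w := Y w \<omega>) = (\<lambda>i. Y i \<omega>)" for \<omega> by auto
  ultimately show ?case by simp
qed

text \<open>The right-hand side depends on the probability space and on the family of steps only through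
\<open>W\<close>. Therefore the means computed below are the same for every simple random walk.\<close>

lemma expectation_finitely_determined:
  fixes F :: "('i \<Rightarrow> int ^ 'n) \<Rightarrow> real"
  assumes W: "finite W" and F: "\<And>g h. (\<And>i. i \<in> W \<Longrightarrow> g i = h i) \<Longrightarrow> F g = F h"
  shows "expectation (\<lambda>\<omega>. F (\<lambda>i. Y i \<omega>))
    = (1 / (2 * real CARD('n))) ^ card W * (\<Sum>g\<in>PiE W (\<lambda>_. lattice_neighbors). F g)"
proof -
  let ?G = "PiE W (\<lambda>_. lattice_neighbors :: (int ^ 'n) set)"
  have fin: "finite ?G" using W finite_lattice_neighbors by (rule finite_PiE)
  have m: "{\<omega>\<in>space N. \<forall>i\<in>W. Y i \<omega> = g i} \<in> events" for g
    using W by (intro sets.sets_Collect_finite_All) measurable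
  have "expectation (\<lambda>\<omega>. F (\<lambda>i. Y i \<omega>))
      = expectation (\<lambda>\<omega>. \<Sum>g\<in>?G. F g * indicator {\<omega>\<in>space N. \<forall>i\<in>W. Y i \<omega> = g i} \<omega>)"
  proof (rule integral_cong_AE)
    show "AE \<omega> in N. F (\<lambda>i. Y i \<omega>) = (\<Sum>g\<in>?G. F g * indicator {\<omega>\<in>space N. \<forall>i\<in>W. Y i \<omega> = g i} \<omega>)"
      using AE_all_steps[OF W] AE_space
    proof eventually_elim
      case (elim \<omega>)
      define h where "h = restrict (\<lambda>i. Y i \<omega>) W"
      have h: "h \<in> ?G" using elim by (auto simp: h_def)
      have "(\<Sum>g\<in>?G. F g * indicator {\<omega>\<in>space N. \<forall>i\<in>W. Y i \<omega> = g i} \<omega>)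
          = (\<Sum>g\<in>?G. if g = h then F g else 0)"
      proof (rule sum.cong[OF refl])
        fix g assume g: "g \<in> ?G"
        have "(\<forall>i\<in>W. Y i \<omega> = g i) \<longleftrightarrow> g = h"
          using g by (auto simp: h_def PiE_iff extensional_def fun_eq_iff)
        then show "F g * indicator {\<omega>\<in>space N. \<forall>i\<in>W. Y i \<omega> = g i} \<omega> = (if g = h then F g else 0)"
          using elim by (auto simp: indicator_def)
      qed
      also have "\<dots> = F h" using h fin by (simp add: sum.delta')
      also have "\<dots> = F (\<lambda>i. Y i \<omega>)" by (rule F) (simp add: h_def)
      finally show ?case ..
    qed
    show "(\<lambda>\<omega>. F (\<lambda>i. Y i \<omega>)) \<in> borel_measurable N"
      by (rule measurable_finitely_determined[OF W]) (rule F)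
    show "(\<lambda>\<omega>. \<Sum>g\<in>?G. F g * indicator {\<omega>\<in>space N. \<forall>i\<in>W. Y i \<omega> = g i} \<omega>) \<in> borel_measurable N"
      by (intro borel_measurable_sum borel_measurable_times borel_measurable_indicator m) simp
  qed
  also have "\<dots> = (\<Sum>g\<in>?G. F g * prob {\<omega>\<in>space N. \<forall>i\<in>W. Y i \<omega> = g i})"
    using m by (subst Bochner_Integration.integral_sum) (auto simp: emeasure_eq_measure)
  also have "\<dots> = (\<Sum>g\<in>?G. F g * (1 / (2 * real CARD('n))) ^ card W)"
    by (intro sum.cong) (auto simp: prob_cylinder_eq[OF W])
  finally show ?thesis by (simp only: sum_distrib_right[symmetric] mult.commute)
qed

lemma expectation_mult_disjoint:
  fixes F G :: "('i \<Rightarrow> int ^ 'n) \<Rightarrow> real"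
  assumes V: "finite V" and W: "finite W" and VW: "V \<inter> W = {}"
    and F: "\<And>g h. (\<And>i. i \<in> V \<Longrightarrow> g i = h i) \<Longrightarrow> F g = F h"
    and G: "\<And>g h. (\<And>i. i \<in> W \<Longrightarrow> g i = h i) \<Longrightarrow> G g = G h"
  shows "expectation (\<lambda>\<omega>. F (\<lambda>i. Y i \<omega>) * G (\<lambda>i. Y i \<omega>))
    = expectation (\<lambda>\<omega>. F (\<lambda>i. Y i \<omega>)) * expectation (\<lambda>\<omega>. G (\<lambda>i. Y i \<omega>))"
proof -
  let ?q = "1 / (2 * real CARD('n))"
  let ?P = "\<lambda>W. PiE W (\<lambda>_. lattice_neighbors :: (int ^ 'n) set)"
  have "expectation (\<lambda>\<omega>. F (\<lambda>i. Y i \<omega>) * G (\<lambda>i. Y i \<omega>)) = ?q ^ card (V \<union> W) * (\<Sum>g\<in>?P (V \<union> W). F g * G g)"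
  proof (rule expectation_finitely_determined)
    fix g h :: "'i \<Rightarrow> int ^ 'n" assume "\<And>i. i \<in> V \<union> W \<Longrightarrow> g i = h i"
    then show "F g * G g = F h * G h" using F[of g h] G[of g h] by simp
  qed (use V W in auto)
  also have "(\<Sum>g\<in>?P (V \<union> W). F g * G g) = (\<Sum>(f, g)\<in>?P V \<times> ?P W. F f * G g)"
  proof (rule sum.reindex_bij_witness[where i = "\<lambda>(f, g). restrict (\<lambda>i. if i \<in> V then f i else g i) (V \<union> W)"
        and j = "\<lambda>g. (restrict g V, restrict g W)"])
    fix g assume "g \<in> ?P (V \<union> W)"
    then show "(case (restrict g V, restrict g W) of (f, g) \<Rightarrow>
        restrict (\<lambda>i. if i \<in> V then f i else g i) (V \<union> W)) = g"
      by (auto simp: fun_eq_iff PiE_iff extensional_def)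
    show "(case (restrict g V, restrict g W) of (f, g) \<Rightarrow> F f * G g) = F g * G g"
      using F[of "restrict g V" g] G[of "restrict g W" g] by simp
    show "(restrict g V, restrict g W) \<in> ?P V \<times> ?P W" using \<open>g \<in> ?P (V \<union> W)\<close> by auto
  next
    fix fg assume fg: "fg \<in> ?P V \<times> ?P W"
    obtain f g where e: "fg = (f, g)" by (cases fg)
    then have f: "f \<in> ?P V" and g: "g \<in> ?P W" using fg by auto
    have "i \<notin> V" if "i \<in> W" for i using VW that by auto
    then have "restrict (restrict (\<lambda>i. if i \<in> V then f i else g i) (V \<union> W)) V = f"
      "restrict (restrict (\<lambda>i. if i \<in> V then f i else g i) (V \<union> W)) W = g"
      using f g by (auto simp: fun_eq_iff PiE_iff extensional_def)
    then show "(restrict (case fg of (f, g) \<Rightarrow> restrict (\<lambda>i. if i \<in> V then f i else g i) (V \<union> W)) V,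
      restrict (case fg of (f, g) \<Rightarrow> restrict (\<lambda>i. if i \<in> V then f i else g i) (V \<union> W)) W) = fg"
      by (simp add: e)
    show "(case fg of (f, g) \<Rightarrow> restrict (\<lambda>i. if i \<in> V then f i else g i) (V \<union> W)) \<in> ?P (V \<union> W)"
      using f g by (auto simp: e PiE_iff)
  qed
  also have "\<dots> = (\<Sum>f\<in>?P V. F f) * (\<Sum>g\<in>?P W. G g)"
    by (simp only: sum_product sum.cartesian_product)
  also have "?q ^ card (V \<union> W) = ?q ^ card V * ?q ^ card W"
    using V W VW by (simp add: card_Un_disjoint power_add)
  finally have "expectation (\<lambda>\<omega>. F (\<lambda>i. Y i \<omega>) * G (\<lambda>i. Y i \<omega>))
      = (?q ^ card V * (\<Sum>f\<in>?P V. F f)) * (?q ^ card W * (\<Sum>g\<in>?P W. G g))"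
    by (simp only: mult_ac)
  moreover have "expectation (\<lambda>\<omega>. F (\<lambda>i. Y i \<omega>)) = ?q ^ card V * (\<Sum>f\<in>?P V. F f)"
    by (rule expectation_finitely_determined[OF V]) (rule F)
  moreover have "expectation (\<lambda>\<omega>. G (\<lambda>i. Y i \<omega>)) = ?q ^ card W * (\<Sum>g\<in>?P W. G g)"
    by (rule expectation_finitely_determined[OF W]) (rule G)
  ultimately show ?thesis by (simp only:)
qed

end

lemma pmf_step: "s \<in> lattice_neighbors \<Longrightarrow> pmf (step_pmf :: (int ^ 'n) pmf) s = 1 / (2 * real CARD('n))"
  unfolding step_pmf_def
  by (subst pmf_of_set) (auto simp: finite_lattice_neighbors lattice_neighbors_nonempty card_lattice_neighbors)

lemma iid_steps_PiM:
  "iid_steps (\<Pi>\<^sub>M i\<in>(UNIV::'i set). measure_pmf (step_pmf :: (int ^ 'n) pmf)) (\<lambda>i \<omega>. \<omega> i)"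
proof -
  let ?N = "\<Pi>\<^sub>M i\<in>(UNIV::'i set). measure_pmf (step_pmf :: (int ^ 'n) pmf)"
  interpret product_prob_space "\<lambda>_::'i. measure_pmf (step_pmf :: (int ^ 'n) pmf)" UNIV
    by unfold_locales
  show ?thesis
  proof
    fix i :: 'i
    show "(\<lambda>\<omega>. \<omega> i) \<in> measurable ?N (count_space UNIV)"
      using measurable_component_singleton[of i UNIV "\<lambda>_. measure_pmf (step_pmf :: (int ^ 'n) pmf)"] by simp
  next
    fix E :: "'i set" and e :: "'i \<Rightarrow> int ^ 'n"
    assume E: "finite E" and e: "e \<in> E \<rightarrow> lattice_neighbors"
    have "emeasure ?N {\<omega>\<in>space ?N. \<forall>i\<in>E. \<omega> i \<in> {e i}} = (\<Prod>i\<in>E. emeasure (measure_pmf step_pmf) {e i})"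
      using E by (intro emeasure_PiM_Collect) auto
    also have "\<dots> = (\<Prod>i\<in>E. ennreal (1 / (2 * real CARD('n))))"
    proof (rule prod.cong[OF refl])
      fix i assume "i \<in> E"
      then have "e i \<in> lattice_neighbors" using e by (rule funcset_mem[rotated])
      then show "emeasure (measure_pmf step_pmf) {e i} = ennreal (1 / (2 * real CARD('n)))"
        by (simp only: emeasure_pmf_single pmf_step)
    qed
    also have "\<dots> = ennreal ((1 / (2 * real CARD('n))) ^ card E)"
      by (simp only: prod_constant) (simp add: ennreal_power)
    finally show "P.prob {\<omega>\<in>space ?N. \<forall>i\<in>E. \<omega> i = e i} = (1 / (2 * real CARD('n))) ^ card E"
      by (simp add: P.emeasure_eq_measure)
  qed
qed

lemma iid_steps_pair:
  fixes Y :: "'i \<Rightarrow> 'b \<Rightarrow> int ^ 'n" and Z :: "'j \<Rightarrow> 'c \<Rightarrow> int ^ 'n"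
  assumes "iid_steps N Y" "iid_steps K Z"
  shows "iid_steps (N \<Otimes>\<^sub>M K) (\<lambda>i (\<omega>, \<xi>). case i of Inl a \<Rightarrow> Y a \<omega> | Inr b \<Rightarrow> Z b \<xi>)"
proof -
  interpret N: iid_steps N Y by fact
  interpret K: iid_steps K Z by fact
  interpret P: pair_prob_space N K ..
  show ?thesis
  proof
    fix i :: "'i + 'j"
    show "(\<lambda>(\<omega>, \<xi>). case i of Inl a \<Rightarrow> Y a \<omega> | Inr b \<Rightarrow> Z b \<xi>) \<in> measurable (N \<Otimes>\<^sub>M K) (count_space UNIV)"
      by (cases i) (auto simp: case_prod_beta)
  next
    fix E :: "('i + 'j) set" and e :: "'i + 'j \<Rightarrow> int ^ 'n"
    assume E: "finite E" and e: "e \<in> E \<rightarrow> lattice_neighbors"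
    define A where "A = Inl -` E"
    define B where "B = Inr -` E"
    have fin: "finite A" "finite B" unfolding A_def B_def using E by (auto intro: finite_vimageI)
    have EAB: "E = Inl ` A \<union> Inr ` B"
      unfolding A_def B_def by (auto simp: image_iff) (metis sum.exhaust)
    have card: "card E = card A + card B"
      unfolding EAB using fin by (subst card_Un_disjoint) (auto simp: card_image)
    have mA: "{\<omega>\<in>space N. \<forall>i\<in>A. Y i \<omega> = e (Inl i)} \<in> sets N" using fin by measurable
    have mB: "{\<omega>\<in>space K. \<forall>i\<in>B. Z i \<omega> = e (Inr i)} \<in> sets K" using fin by measurable
    have "{x\<in>space (N \<Otimes>\<^sub>M K). \<forall>i\<in>E. (case x of (\<omega>, \<xi>) \<Rightarrow> (case i of Inl a \<Rightarrow> Y a \<omega> | Inr b \<Rightarrow> Z b \<xi>)) = e i}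
        = {\<omega>\<in>space N. \<forall>i\<in>A. Y i \<omega> = e (Inl i)} \<times> {\<omega>\<in>space K. \<forall>i\<in>B. Z i \<omega> = e (Inr i)}"
      unfolding EAB by (auto simp: space_pair_measure ball_Un)
    also have "measure (N \<Otimes>\<^sub>M K) \<dots> = N.prob {\<omega>\<in>space N. \<forall>i\<in>A. Y i \<omega> = e (Inl i)}
        * K.prob {\<omega>\<in>space K. \<forall>i\<in>B. Z i \<omega> = e (Inr i)}"
      using mA mB by (simp add: measure_def K.emeasure_pair_measure_Times enn2real_mult)
    also have "N.prob {\<omega>\<in>space N. \<forall>i\<in>A. Y i \<omega> = e (Inl i)} = (1 / (2 * real CARD('n))) ^ card A"
      using fin e by (intro N.prob_cylinder) (auto simp: A_def)
    also have "K.prob {\<omega>\<in>space K. \<forall>i\<in>B. Z i \<omega> = e (Inr i)} = (1 / (2 * real CARD('n))) ^ card B"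
      using fin e by (intro K.prob_cylinder) (auto simp: B_def)
    finally show "P.prob {x\<in>space (N \<Otimes>\<^sub>M K). \<forall>i\<in>E. (case x of (\<omega>, \<xi>) \<Rightarrow>
        (case i of Inl a \<Rightarrow> Y a \<omega> | Inr b \<Rightarrow> Z b \<xi>)) = e i} = (1 / (2 * real CARD('n))) ^ card E"
      by (simp add: card power_add)
  qed
qed

lemma iid_steps_simple_random_walk:
  fixes X :: "nat \<Rightarrow> 'a \<Rightarrow> int ^ 'n"
  assumes "simple_random_walk M X"
  shows "iid_steps M (\<lambda>n \<omega>. X (Suc n) \<omega> - X n \<omega>)"
proof -
  interpret simple_random_walk M X by fact
  show ?thesis
  proof
    fix i
    show m: "(\<lambda>\<omega>. X (Suc i) \<omega> - X i \<omega>) \<in> measurable M (count_space UNIV)" for i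
      using measurable_walk[of i] measurable_walk[of "Suc i"] by measurable
    fix E and e :: "nat \<Rightarrow> int ^ 'n"
    assume E: "finite E" and e: "e \<in> E \<rightarrow> lattice_neighbors"
    let ?A = "\<lambda>i. (\<lambda>\<omega>. X (Suc i) \<omega> - X i \<omega>) -` {e i} \<inter> space M"
    have one: "prob (?A i) = 1 / (2 * real CARD('n))" if "i \<in> E" for i
    proof -
      have "prob (?A i) = measure (distr M (count_space UNIV) (\<lambda>\<omega>. X (Suc i) \<omega> - X i \<omega>)) {e i}"
        by (rule measure_distr[symmetric, OF m]) simp
      also have "\<dots> = pmf step_pmf (e i)" by (simp add: distr_increments pmf.rep_eq)
      also have "\<dots> = 1 / (2 * real CARD('n))"
        by (rule pmf_step) (rule funcset_mem[OF e that])
      finally show ?thesis .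
    qed
    show "prob {\<omega>\<in>space M. \<forall>i\<in>E. X (Suc i) \<omega> - X i \<omega> = e i} = (1 / (2 * real CARD('n))) ^ card E"
    proof (cases "E = {}")
      case True
      then show ?thesis by (simp add: prob_space)
    next
      case False
      have "{\<omega>\<in>space M. \<forall>i\<in>E. X (Suc i) \<omega> - X i \<omega> = e i} = (\<Inter>i\<in>E. ?A i)"
        using False by auto
      also have "prob \<dots> = (\<Prod>i\<in>E. prob (?A i))"
        using False E by (intro indep_varsD[OF indep_increments]) auto
      finally show ?thesis by (simp add: one)
    qed
  qed
qed

section \<open>Cylinder structure of the past of the tree\<close>

abbreviation mark_pmf :: "nat pmf \<Rightarrow> (nat \<times> nat \<times> nat) pmf" where
  "mark_pmf \<mu> \<equiv> pair_pmf \<mu> (special_mark_pmf \<mu>)"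

abbreviation special_rank :: "nat \<times> nat \<times> nat \<Rightarrow> nat" where
  "special_rank m \<equiv> snd (snd m)"

lemma space_tree_measure [simp]: "space (tree_measure \<mu>) = UNIV"
  by (simp add: tree_measure_def space_PiM)

lemma prob_space_tree_measure: "prob_space (tree_measure \<mu>)"
  unfolding tree_measure_def by (intro prob_space_PiM prob_space_measure_pmf)

lemma measurable_mark [measurable]: "(\<lambda>t. t u) \<in> measurable (tree_measure \<mu>) (count_space UNIV)"
  unfolding tree_measure_def
  using measurable_component_singleton[of u UNIV "\<lambda>_. measure_pmf (mark_pmf \<mu>)"] by simp

lemma measurable_spine [measurable]: "(\<lambda>t. spine t n) \<in> measurable (tree_measure \<mu>) (count_space UNIV)"
proof (induction n)
  case (Suc n)
  have "(\<lambda>t. v @ [if n = 0 then 0 else special_rank (t v)]) \<in> measurable (tree_measure \<mu>) (count_space UNIV)" for v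
    by measurable
  from measurable_compose_countable[OF this Suc] show ?case by simp
qed simp

lemma pred_special [measurable]: "Measurable.pred (tree_measure \<mu>) (\<lambda>t. special t u)"
  unfolding special_def by measurable

lemma measurable_num_offspring [measurable]:
  "(\<lambda>t. num_offspring t u) \<in> measurable (tree_measure \<mu>) (count_space UNIV)"
proof -
  have [measurable]: "(\<lambda>t. g (t u)) \<in> measurable (tree_measure \<mu>) (count_space UNIV)"
    for g :: "nat \<times> nat \<times> nat \<Rightarrow> nat"
    by (rule measurable_compose[OF measurable_mark]) simp
  show ?thesis
  proof (cases "u = []")
    case True
    have "(\<lambda>t. (\<lambda>m. fst m + 1) (t u)) \<in> measurable (tree_measure \<mu>) (count_space UNIV)"
      by (rule measurable_compose[OF measurable_mark]) simp
    then show ?thesis using True by (simp add: num_offspring_def)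
  next
    case False
    then show ?thesis by (simp add: num_offspring_def)
  qed
qed

lemma Nil_in_tree [simp]: "[] \<in> tree t"
  by (rule tree.root)

lemma snoc_in_tree_iff: "u @ [i] \<in> tree t \<longleftrightarrow> u \<in> tree t \<and> i < num_offspring t u"
  by (auto intro: tree.child elim: tree.cases)

lemma pred_tree [measurable]: "Measurable.pred (tree_measure \<mu>) (\<lambda>t. u \<in> tree t)"
  by (induction u rule: rev_induct) (simp_all add: snoc_in_tree_iff)

lemma pred_left_of_spine [measurable]: "Measurable.pred (tree_measure \<mu>) (\<lambda>t. left_of_spine t u)"
proof -
  have eq: "Measurable.pred (tree_measure \<mu>) (\<lambda>t. spine t n = v)" for n v
    by (rule measurable_compose[OF measurable_spine]) simp
  have "Measurable.pred (tree_measure \<mu>)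
      (\<lambda>t. spine t (Suc n) = v @ [j] \<and> i < j \<and> u = v @ [i] @ w)" for n i j w v
    by (intro pred_intros_logic eq) simp_all
  then have "Measurable.pred (tree_measure \<mu>)
      (\<lambda>t. spine t (Suc n) = spine t n @ [j] \<and> i < j \<and> u = spine t n @ [i] @ w)" for n i j w
    by (rule measurable_compose_countable) (rule measurable_spine)
  then show ?thesis unfolding left_of_spine_def by (intro pred_intros_countable)
qed

lemma pred_past [measurable]: "Measurable.pred (tree_measure \<mu>) (\<lambda>t. u \<in> past t)"
  unfolding past_def by measurable

lemma length_spine [simp]: "length (spine t n) = n"
  by (induction n) auto

lemma take_spine: "k \<le> n \<Longrightarrow> take k (spine t n) = spine t k"
proof (induction n)
  case (Suc n)
  then show ?case by (cases "k = Suc n") auto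
qed simp

lemma nth_spine: "k < n \<Longrightarrow> spine t n ! k = (if k = 0 then 0 else special_rank (t (spine t k)))"
proof (induction n)
  case (Suc n)
  then show ?case by (cases "k = n") (auto simp: nth_append)
qed simp

lemma nth_less_num_offspring: "u \<in> tree t \<Longrightarrow> k < length u \<Longrightarrow> u ! k < num_offspring t (take k u)"
proof (induction u rule: rev_induct)
  case (snoc i u)
  then show ?case by (cases "k = length u") (auto simp: snoc_in_tree_iff nth_append)
qed simp

text \<open>The condition on the mark \<open>m\<close> of the prefix of length \<open>k\<close> under which the next letter \<open>i\<close> keeps
to a path that follows the spine up to generation \<open>n\<close>, turns left there, and then stays in the
tree.\<close>

definition level_rule :: "nat \<Rightarrow> nat \<Rightarrow> nat \<times> nat \<times> nat \<Rightarrow> nat \<Rightarrow> bool" where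
  "level_rule n k m i \<longleftrightarrow>
     (if k = 0 then i = 0
      else if k < n then i = special_rank m
      else if k = n then i < special_rank m
      else i < fst m)"

definition branches_at :: "marks \<Rightarrow> nat \<Rightarrow> nat list \<Rightarrow> bool" where
  "branches_at t n u \<longleftrightarrow> (\<forall>k<length u. level_rule n k (t (take k u)) (u ! k))"

text \<open>Membership in the past is not a product event, since it depends on where the spine is. Fixing the
generation \<open>n\<close> at which the path to \<open>u\<close> leaves the spine turns it into conditions on the marks
of the prefixes of \<open>u\<close>, one for each prefix. The choice \<open>n = length u\<close> is the case that \<open>u\<close>
lies on the spine.\<close>

lemma past_branches:
  assumes u: "u \<in> past t"
  shows "\<exists>n\<in>{1..length u}. branches_at t n u"
proof -
  have "special t u \<or> left_of_spine t u" using u by (auto simp: past_def)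
  then show ?thesis
  proof
    assume "special t u"
    then obtain n where n: "n \<ge> 1" "u = spine t n" by (auto simp: special_def)
    have "branches_at t n u"
      unfolding branches_at_def level_rule_def n(2)
      by (auto simp: nth_spine take_spine)
    then show ?thesis using n by (intro bexI[of _ n]) auto
  next
    assume "left_of_spine t u"
    then obtain n i j w where sp: "spine t (Suc n) = spine t n @ [j]" and ij: "i < j"
      and uw: "u = spine t n @ [i] @ w"
      by (auto simp: left_of_spine_def)
    have n: "n \<noteq> 0" using sp ij by (cases "n = 0") auto
    then have j: "j = special_rank (t (spine t n))" using sp by simp
    have "level_rule n k (t (take k u)) (u ! k)" if k: "k < length u" for k
    proof -
      consider "k < n" | "k = n" | "k > n" by linarith
      then show ?thesis
      proof cases
        case 1
        then have "take k u = spine t k" "u ! k = spine t n ! k"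
          by (simp_all add: uw take_spine nth_append)
        then show ?thesis using 1 by (auto simp: level_rule_def nth_spine)
      next
        case 2
        then have "take k u = spine t n" "u ! k = i"
          by (simp_all add: uw nth_append)
        then show ?thesis using 2 n ij j by (auto simp: level_rule_def)
      next
        case 3
        have "\<not> special t (take k u)"
        proof
          assume "special t (take k u)"
          then obtain m where m: "take k u = spine t m" by (auto simp: special_def)
          then have "length (take k u) = m" by simp
          then have "m = k" using k by simp
          then have "take (Suc n) (take k u) = spine t (Suc n)"
            using m 3 by (simp only: take_spine) 
          moreover have "take (Suc n) (take k u) = spine t n @ [i]"
            using 3 by (simp add: uw min_def)
          ultimately show False using sp ij by auto
        qed
        moreover have "u ! k < num_offspring t (take k u)"
          using u k by (intro nth_less_num_offspring) (auto simp: past_def)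
        moreover have "take k u \<noteq> []" using 3 k by auto
        ultimately show ?thesis using 3 n by (simp add: level_rule_def num_offspring_def)
      qed
    qed
    then have "branches_at t n u" by (simp add: branches_at_def)
    then show ?thesis using n uw by (intro bexI[of _ n]) auto
  qed
qed

text \<open>The special vertices of generation below \<open>L\<close>, provided that each of them has its special child
on the far left; their own marks decide whether this holds. Then nothing lies to the left of the spine
up to generation \<open>L\<close>.\<close>

definition straight_words :: "nat \<Rightarrow> nat list set" where
  "straight_words L = (\<lambda>k. replicate k 0) ` {1..<L}"

definition straight_spine :: "nat \<Rightarrow> marks \<Rightarrow> bool" where
  "straight_spine L t \<longleftrightarrow> (\<forall>w\<in>straight_words L. special_rank (t w) = 0)"

lemma finite_straight_words [simp]: "finite (straight_words L)"
  by (simp add: straight_words_def)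

lemma pred_straight_spine [measurable]: "Measurable.pred (tree_measure \<mu>) (straight_spine L)"
  unfolding straight_spine_def by (intro pred_intros_finite) auto

text \<open>Leaving the spine to the left is impossible as long as the special child is the leftmost one.\<close>

lemma straight_spine_prefix:
  assumes t: "straight_spine L t" and b: "branches_at t n u" and n: "n \<ge> 1"
    and k: "k \<le> L" "k \<le> length u"
  shows "take k u = replicate k 0"
  using k
proof (induction k)
  case (Suc k)
  then have IH: "take k u = replicate k 0" by simp
  have rule: "level_rule n i (t (take i u)) (u ! i)" if "i \<le> k" for i
    using b Suc.prems that by (auto simp: branches_at_def)
  have z: "special_rank (t (take i u)) = 0" if "1 \<le> i" "i \<le> k" for i
  proof -
    have "take i u = take i (take k u)" using that by (simp add: min_def)
    also have "\<dots> = replicate i 0" using that by (simp add: IH min_def)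
    finally show ?thesis using t that Suc.prems by (auto simp: straight_spine_def straight_words_def)
  qed
  have "u ! k = 0"
  proof (cases "k = 0")
    case True
    then show ?thesis using rule[of k] by (auto simp: level_rule_def)
  next
    case False
    have "\<not> n \<le> k" using rule[of n] z[of n] n by (auto simp: level_rule_def)
    then show ?thesis using rule[of k] z[of k] False by (auto simp: level_rule_def)
  qed
  then show ?case using IH Suc.prems by (simp add: take_Suc_conv_app_nth replicate_append_same)
qed simp

definition straight_marks :: "nat \<Rightarrow> nat list \<Rightarrow> (nat \<times> nat \<times> nat) set" where
  "straight_marks L w = (if w \<in> straight_words L then {m. special_rank m = 0} else UNIV)"

abbreviation mark_prob :: "nat pmf \<Rightarrow> (nat \<times> nat \<times> nat) set \<Rightarrow> real" where
  "mark_prob \<mu> \<equiv> measure_pmf.prob (mark_pmf \<mu>)"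

text \<open>The conditional law of the mark of \<open>w\<close>, given that it does not bend the spine away from the
leftmost path below generation \<open>L\<close>.\<close>

definition straight_prob :: "nat pmf \<Rightarrow> nat \<Rightarrow> nat list \<Rightarrow> (nat \<times> nat \<times> nat) set \<Rightarrow> real" where
  "straight_prob \<mu> L w B =
     mark_prob \<mu> (B \<inter> straight_marks L w)
     / mark_prob \<mu> (straight_marks L w)"

lemma prob_tree_cylinder:
  assumes "finite W"
  shows "measure (tree_measure \<mu>) {t. \<forall>w\<in>W. t w \<in> B w} = (\<Prod>w\<in>W. mark_prob \<mu> (B w))"
proof -
  interpret product_prob_space "\<lambda>_::nat list. measure_pmf (mark_pmf \<mu>)" UNIV
    by unfold_locales
  have "measure (PiM UNIV (\<lambda>_::nat list. measure_pmf (mark_pmf \<mu>))) (prod_emb UNIV (\<lambda>_. measure_pmf (mark_pmf \<mu>)) W (Pi\<^sub>E W B))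
      = (\<Prod>w\<in>W. mark_prob \<mu> (B w))"
    using assms by (intro measure_PiM_emb) auto
  moreover have "prod_emb UNIV (\<lambda>_. measure_pmf (mark_pmf \<mu>)) W (Pi\<^sub>E W B) = {t. \<forall>w\<in>W. t w \<in> B w}"
    by (auto simp: prod_emb_def Pi_iff)
  ultimately show ?thesis by (simp add: tree_measure_def)
qed

abbreviation straight_spine_prob :: "nat pmf \<Rightarrow> nat \<Rightarrow> real" where
  "straight_spine_prob \<mu> L \<equiv> measure (tree_measure \<mu>) {t. straight_spine L t}"

abbreviation straight_past_prob :: "nat pmf \<Rightarrow> nat \<Rightarrow> nat list \<Rightarrow> real" where
  "straight_past_prob \<mu> L u \<equiv>
     measure (tree_measure \<mu>) {t. straight_spine L t \<and> u \<in> insert [] (past t)}"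

context
  fixes \<mu> :: "nat pmf"
  assumes crit: "critical_offspring_law \<mu>"
begin

lemma exists_positive_offspring: "\<exists>k>0. pmf \<mu> k > 0"
proof (rule ccontr)
  assume "\<not> (\<exists>k>0. pmf \<mu> k > 0)"
  then have "i = 0 \<or> pmf \<mu> i = 0" for i
    using pmf_nonneg[of \<mu> i] by (meson antisym not_less zero_less_iff_neq_zero)
  then have "(\<lambda>i. real i * pmf \<mu> i) = (\<lambda>_. 0)"
    by (intro ext) (metis mult_zero_left mult_zero_right of_nat_0)
  then have "(\<lambda>i. real i * pmf \<mu> i) sums 0" by simp
  moreover have "(\<lambda>i. real i * pmf \<mu> i) sums 1" using crit by (simp add: critical_offspring_law_def)
  ultimately show False using sums_unique2 by fastforce
qed

lemma set_size_biased: "k \<in> set_pmf (size_biased \<mu>) \<Longrightarrow> k > 0"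
  by (auto simp: set_pmf_iff pmf_size_biased[OF crit])

lemma prob_straight_marks_pos: "mark_prob \<mu> (straight_marks L w) > 0"
proof -
  obtain k where k: "k > 0" "pmf \<mu> k > 0" using exists_positive_offspring by blast
  then have "k \<in> set_pmf (size_biased \<mu>)" by (auto simp: set_pmf_iff pmf_size_biased[OF crit])
  moreover have "0 \<in> set_pmf (pmf_of_set {..<k})" using k by (subst set_pmf_of_set) auto
  ultimately have "(k, 0) \<in> set_pmf (special_mark_pmf \<mu>)"
    unfolding special_mark_pmf_def by (auto simp: set_bind_pmf)
  moreover have "k \<in> set_pmf \<mu>" using k by (auto simp: set_pmf_iff)
  ultimately have "(k, (k, 0)) \<in> set_pmf (mark_pmf \<mu>)" by auto
  moreover have "(k, (k, 0)) \<in> straight_marks L w" by (auto simp: straight_marks_def)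
  ultimately show ?thesis by (rule measure_pmf_posI)
qed

lemma prob_straight_spine:
  "straight_spine_prob \<mu> L
    = (\<Prod>w\<in>straight_words L. mark_prob \<mu> (straight_marks L w))"
proof -
  have "{t. straight_spine L t} = {t. \<forall>w\<in>straight_words L. t w \<in> straight_marks L w}"
    by (auto simp: straight_spine_def straight_marks_def)
  then show ?thesis by (simp add: prob_tree_cylinder)
qed

lemma prob_straight_spine_pos: "straight_spine_prob \<mu> L > 0"
  unfolding prob_straight_spine by (intro prod_pos prob_straight_marks_pos)

text \<open>Both events restrict each mark separately, so that the conditional probability given a straight
spine is again a product over the prefixes of \<open>u\<close>. The factor \<open>straight_spine_prob\<close>, which is
exponentially small in \<open>L\<close>, has to be split off exactly: the collision bounds gain only a power of \<open>L\<close>.\<close>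

lemma prob_straight_branches:
  "measure (tree_measure \<mu>) {t. straight_spine L t \<and> branches_at t n u}
    = straight_spine_prob \<mu> L
      * (\<Prod>k<length u. straight_prob \<mu> L (take k u) {m. level_rule n k m (u ! k)})"
proof -
  let ?p = "\<lambda>B. mark_prob \<mu> B"
  define P where "P = (\<lambda>k. take k u) ` {..<length u}"
  define B where "B = (\<lambda>w. if w \<in> P then {m. level_rule n (length w) m (u ! length w)} else UNIV)"
  have finP: "finite P" by (simp add: P_def)
  have inj: "inj_on (\<lambda>k. take k u) {..<length u}"
    by (rule inj_onI) (metis length_take lessThan_iff min.absorb4 min.commute)
  have len: "length (take k u) = k" if "k < length u" for k using that by simp
  have "{t. straight_spine L t \<and> branches_at t n u}
      = {t. \<forall>w\<in>straight_words L \<union> P. t w \<in> B w \<inter> straight_marks L w}"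
  proof (intro set_eqI, unfold mem_Collect_eq)
    fix t :: marks
    have "branches_at t n u \<longleftrightarrow> (\<forall>w\<in>P. t w \<in> B w)"
      by (simp add: branches_at_def P_def B_def) blast
    moreover have "straight_spine L t \<longleftrightarrow> (\<forall>w\<in>straight_words L. t w \<in> straight_marks L w)"
      by (simp add: straight_spine_def straight_marks_def)
    moreover have "t w \<in> B w" if "w \<notin> P" for w using that by (simp add: B_def)
    moreover have "t w \<in> straight_marks L w" if "w \<notin> straight_words L" for w
      using that by (simp add: straight_marks_def)
    ultimately show "straight_spine L t \<and> branches_at t n u \<longleftrightarrow>
      (\<forall>w\<in>straight_words L \<union> P. t w \<in> B w \<inter> straight_marks L w)"
      by blast
  qed
  then have "measure (tree_measure \<mu>) {t. straight_spine L t \<and> branches_at t n u}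
      = (\<Prod>w\<in>straight_words L \<union> P. ?p (B w \<inter> straight_marks L w))"
    using finP by (simp only: prob_tree_cylinder finite_Un finite_straight_words)
  also have "\<dots> = (\<Prod>w\<in>straight_words L \<union> P. ?p (straight_marks L w) * straight_prob \<mu> L w (B w))"
    using prob_straight_marks_pos by (intro prod.cong) (auto simp: straight_prob_def less_le)
  also have "\<dots> = (\<Prod>w\<in>straight_words L \<union> P. ?p (straight_marks L w)) * (\<Prod>w\<in>straight_words L \<union> P. straight_prob \<mu> L w (B w))"
    by (rule prod.distrib)
  also have "(\<Prod>w\<in>straight_words L \<union> P. ?p (straight_marks L w)) = (\<Prod>w\<in>straight_words L. ?p (straight_marks L w))"
    using finP by (intro prod.mono_neutral_right) (auto simp: straight_marks_def)
  also have "(\<Prod>w\<in>straight_words L \<union> P. straight_prob \<mu> L w (B w)) = (\<Prod>w\<in>P. straight_prob \<mu> L w (B w))"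
    using finP prob_straight_marks_pos
    by (intro prod.mono_neutral_right) (auto simp: straight_prob_def B_def less_le)
  also have "\<dots> = (\<Prod>k<length u. straight_prob \<mu> L (take k u) (B (take k u)))"
    unfolding P_def by (subst prod.reindex[OF inj]) simp
  also have "\<dots> = (\<Prod>k<length u. straight_prob \<mu> L (take k u) {m. level_rule n k m (u ! k)})"
    by (intro prod.cong) (auto simp: B_def P_def)
  finally show ?thesis by (simp add: prob_straight_spine)
qed

end

lemma nn_integral_lists_Suc:
  fixes f :: "nat list \<Rightarrow> ennreal"
  shows "(\<integral>\<^sup>+u. f u \<partial>count_space {u. length u = Suc l})
    = (\<integral>\<^sup>+v. (\<integral>\<^sup>+i. f (v @ [i]) \<partial>count_space UNIV) \<partial>count_space {v. length v = l})"
proof -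
  have "bij_betw (\<lambda>(v, i). v @ [i]) ({v::nat list. length v = l} \<times> (UNIV::nat set)) {u. length u = Suc l}"
  proof (rule bij_betwI[where g = "\<lambda>u. (butlast u, last u)"])
    fix u :: "nat list" assume "u \<in> {u. length u = Suc l}"
    then have "u \<noteq> []" by auto
    then show "(case (butlast u, last u) of (v, i) \<Rightarrow> v @ [i]) = u" by simp
  qed auto
  then have "(\<integral>\<^sup>+u. f u \<partial>count_space {u. length u = Suc l})
      = (\<integral>\<^sup>+(v, i). f (v @ [i]) \<partial>count_space ({v. length v = l} \<times> UNIV))"
    by (subst nn_integral_bij_count_space[symmetric]) (simp_all only: case_prod_unfold)
  also have "\<dots> = (\<integral>\<^sup>+(v, i). f (v @ [i]) \<partial>(count_space {v. length v = l} \<Otimes>\<^sub>M count_space UNIV))"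
    by (subst pair_measure_countable) auto
  also have "\<dots> = (\<integral>\<^sup>+v. (\<integral>\<^sup>+i. f (v @ [i]) \<partial>count_space UNIV) \<partial>count_space {v. length v = l})"
    by (subst sigma_finite_measure.nn_integral_fst[symmetric])
      (auto intro!: sigma_finite_measure_count_space simp: pair_measure_countable)
  finally show ?thesis .
qed

text \<open>The mean size of a generation, in the form used for trees: the last letter is summed first, at
a cost \<open>C l\<close> that does not depend on the earlier letters.\<close>

lemma nn_integral_lists_prod_le:
  fixes a :: "nat \<Rightarrow> nat list \<Rightarrow> nat \<Rightarrow> ennreal"
  assumes "\<And>k w. k < l \<Longrightarrow> (\<integral>\<^sup>+i. a k w i \<partial>count_space UNIV) \<le> C k"
  shows "(\<integral>\<^sup>+u. (\<Prod>k<l. a k (take k u) (u ! k)) \<partial>count_space {u. length u = l}) \<le> (\<Prod>k<l. C k)"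
  using assms
proof (induction l)
  case 0
  then show ?case by (simp add: nn_integral_count_space_finite)
next
  case (Suc l)
  have "(\<integral>\<^sup>+u. (\<Prod>k<Suc l. a k (take k u) (u ! k)) \<partial>count_space {u. length u = Suc l})
    = (\<integral>\<^sup>+v. (\<integral>\<^sup>+i. (\<Prod>k<l. a k (take k v) (v ! k)) * a l v i \<partial>count_space UNIV) \<partial>count_space {v. length v = l})"
    unfolding nn_integral_lists_Suc
    by (intro nn_integral_cong) (auto simp: nth_append intro!: prod.cong arg_cong2[where f = "(*)"])
  also have "\<dots> = (\<integral>\<^sup>+v. (\<Prod>k<l. a k (take k v) (v ! k)) * (\<integral>\<^sup>+i. a l v i \<partial>count_space UNIV) \<partial>count_space {v. length v = l})"
    by (intro nn_integral_cong nn_integral_cmult) auto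
  also have "\<dots> \<le> (\<integral>\<^sup>+v. (\<Prod>k<l. a k (take k v) (v ! k)) * C l \<partial>count_space {v. length v = l})"
    by (intro nn_integral_mono mult_left_mono Suc.prems) auto
  also have "\<dots> = (\<integral>\<^sup>+v. (\<Prod>k<l. a k (take k v) (v ! k)) \<partial>count_space {v. length v = l}) * C l"
    by (intro nn_integral_multc) auto
  also have "\<dots> \<le> (\<Prod>k<l. C k) * C l"
    by (intro mult_right_mono Suc.IH Suc.prems) auto
  finally show ?case by simp
qed

section \<open>Size of the generations of the past\<close>

lemma suminf_indicator_singleton: "(\<Sum>i. indicator {j} i :: ennreal) = 1" for j :: nat
  using suminf_finite[of "{j}" "indicator {j} :: nat \<Rightarrow> ennreal"] by simp

lemma suminf_indicator_lessThan: "(\<Sum>i. indicator {..<j} i :: ennreal) = of_nat j" for j :: nat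
proof -
  have "(\<Sum>i. indicator {..<j} i :: ennreal) = (\<Sum>i\<in>{..<j}. indicator {..<j} i)"
    by (rule suminf_finite) auto
  also have "\<dots> = (\<Sum>i\<in>{..<j}. 1)" by (rule sum.cong) auto
  finally show ?thesis by simp
qed

text \<open>The number of letters that \<open>level_rule\<close> admits; see \<open>suminf_level_rule\<close>.\<close>

definition level_mass :: "nat \<Rightarrow> nat \<Rightarrow> nat \<times> nat \<times> nat \<Rightarrow> nat" where
  "level_mass n k m = (if k = 0 \<or> k < n then 1 else if k = n then special_rank m else fst m)"

lemma suminf_level_rule:
  "(\<Sum>i. indicator {m. level_rule n k m i} m :: ennreal) = of_nat (level_mass n k m)"
proof -
  have "(\<lambda>i. indicator {m. level_rule n k m i} m :: ennreal) = (\<lambda>i. indicator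
      (if k = 0 then {0} else if k < n then {special_rank m} else if k = n then {..<special_rank m} else {..<fst m}) i)"
    by (auto simp: level_rule_def indicator_def fun_eq_iff)
  then show ?thesis
    by (auto simp: level_mass_def suminf_indicator_singleton suminf_indicator_lessThan)
qed

abbreviation mean_special_rank :: "nat pmf \<Rightarrow> ennreal" where
  "mean_special_rank \<mu> \<equiv> \<integral>\<^sup>+m. of_nat (snd m) \<partial>measure_pmf (special_mark_pmf \<mu>)"

context
  fixes \<mu> :: "nat pmf"
  assumes crit: "critical_offspring_law \<mu>"
begin

lemma nn_integral_offspring: "(\<integral>\<^sup>+i. of_nat i \<partial>measure_pmf \<mu>) = 1"
proof -
  have s: "(\<lambda>i. real i * pmf \<mu> i) sums 1"
    using crit by (simp add: critical_offspring_law_def)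
  have "(\<integral>\<^sup>+i. of_nat i \<partial>measure_pmf \<mu>) = (\<integral>\<^sup>+ i. ennreal (real i * pmf \<mu> i) \<partial>count_space UNIV)"
    by (subst nn_integral_measure_pmf)
      (auto intro!: nn_integral_cong simp: ennreal_mult'' mult.commute ennreal_of_nat_eq_real_of_nat)
  also have "\<dots> = (\<Sum>i. ennreal (real i * pmf \<mu> i))"
    by (simp add: nn_integral_count_space_nat)
  also have "\<dots> = ennreal (\<Sum>i. real i * pmf \<mu> i)"
    using s by (intro suminf_ennreal2) (auto simp: sums_iff)
  finally show ?thesis using s by (simp add: sums_iff)
qed

text \<open>This is where the finite variance of the offspring law enters: the rank of the special child is
below the size-biased number of offspring, whose mean is the second moment of \<open>\<mu>\<close>.\<close>

lemma nn_integral_special_rank_finite: "mean_special_rank \<mu> < \<infinity>"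
proof -
  have "mean_special_rank \<mu>
      = (\<integral>\<^sup>+k. (\<integral>\<^sup>+j. of_nat j \<partial>measure_pmf (pmf_of_set {..<k})) \<partial>measure_pmf (size_biased \<mu>))"
    unfolding special_mark_pmf_def by simp
  also have "\<dots> \<le> (\<integral>\<^sup>+k. of_nat k \<partial>measure_pmf (size_biased \<mu>))"
  proof (rule nn_integral_mono_AE, rule AE_pmfI)
    fix k assume "k \<in> set_pmf (size_biased \<mu>)"
    then have k: "k > 0" by (rule set_size_biased[OF crit])
    have "(\<integral>\<^sup>+j. of_nat j \<partial>measure_pmf (pmf_of_set {..<k})) \<le> (\<integral>\<^sup>+j. of_nat k \<partial>measure_pmf (pmf_of_set {..<k}))"
      using k by (intro nn_integral_mono_AE AE_pmfI) (auto simp: set_pmf_of_set lessThan_empty_iff)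
    then show "(\<integral>\<^sup>+j. of_nat j \<partial>measure_pmf (pmf_of_set {..<k})) \<le> (of_nat k :: ennreal)"
      by (simp add: measure_pmf.emeasure_space_1)
  qed
  also have "\<dots> = (\<integral>\<^sup>+k. ennreal (real k * pmf \<mu> k) * of_nat k \<partial>count_space UNIV)"
    by (subst nn_integral_measure_pmf) (simp add: pmf_size_biased[OF crit])
  also have "\<dots> = (\<integral>\<^sup>+k. ennreal (pmf \<mu> k) * ennreal ((real k)\<^sup>2) \<partial>count_space UNIV)"
    by (intro nn_integral_cong)
      (simp add: ennreal_of_nat_eq_real_of_nat ennreal_mult''[symmetric] power2_eq_square mult_ac)
  also have "\<dots> = (\<integral>\<^sup>+k. ennreal ((real k)\<^sup>2) \<partial>measure_pmf \<mu>)"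
    by (rule nn_integral_measure_pmf[symmetric])
  also have "\<dots> < \<infinity>"
    using crit by (auto simp: critical_offspring_law_def integrable_iff_bounded)
  finally show ?thesis .
qed

text \<open>Conditioning on the rank of the special child leaves the number of offspring of a normal vertex
untouched, so that criticality keeps the mean at \<open>1\<close> there. At the level of the left turn the
condition can only remove children.\<close>

lemma nn_integral_level_mass:
  assumes C: "mean_special_rank \<mu> = ennreal C" and n: "n \<ge> 1"
  shows "(\<integral>\<^sup>+m. of_nat (level_mass n k m) * indicator (straight_marks L w) m \<partial>measure_pmf (mark_pmf \<mu>))
    \<le> (if k = n then ennreal C else 1) * emeasure (measure_pmf (mark_pmf \<mu>)) (straight_marks L w)"
proof -
  let ?p = "measure_pmf (mark_pmf \<mu>)" and ?S = "straight_marks L w"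
  consider "k = 0 \<or> k < n" | "k = n" | "k > n" by linarith
  then show ?thesis
  proof cases
    case 1
    then have "(\<integral>\<^sup>+m. of_nat (level_mass n k m) * indicator ?S m \<partial>?p) = (\<integral>\<^sup>+m. indicator ?S m \<partial>?p)"
      by (simp add: level_mass_def)
    moreover have "k \<noteq> n" using 1 n by auto
    ultimately show ?thesis by simp
  next
    case 2
    show ?thesis
    proof (cases "w \<in> straight_words L")
      case True
      then have "of_nat (level_mass n k m) * indicator ?S m = (0 :: ennreal)" for m
        using 2 n by (auto simp: level_mass_def straight_marks_def indicator_def)
      then show ?thesis by (simp only: nn_integral_const mult_zero_left zero_le)
    next
      case False
      have "(\<integral>\<^sup>+m. of_nat (special_rank m) \<partial>?p) = ennreal C"
        using C by (subst nn_integral_pair_pmf') (simp add: measure_pmf.emeasure_space_1)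
      then show ?thesis using 2 n False
        by (simp add: level_mass_def straight_marks_def measure_pmf.emeasure_space_1)
    qed
  next
    case 3
    define Q where "Q = {p :: nat \<times> nat. w \<in> straight_words L \<longrightarrow> snd p = 0}"
    have S: "indicator ?S m = (indicator Q (snd m) :: ennreal)" for m
      by (auto simp: Q_def straight_marks_def indicator_def)
    have "(\<integral>\<^sup>+m. of_nat (level_mass n k m) * indicator ?S m \<partial>?p)
       = (\<integral>\<^sup>+a. (\<integral>\<^sup>+b. of_nat a * indicator Q b \<partial>measure_pmf (special_mark_pmf \<mu>)) \<partial>measure_pmf \<mu>)"
      using 3 by (subst nn_integral_pair_pmf') (simp add: S level_mass_def)
    also have "\<dots> = (\<integral>\<^sup>+a. of_nat a * emeasure (measure_pmf (special_mark_pmf \<mu>)) Q \<partial>measure_pmf \<mu>)"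
      by (intro nn_integral_cong) (simp add: nn_integral_cmult)
    also have "\<dots> = emeasure (measure_pmf (special_mark_pmf \<mu>)) Q"
      by (subst nn_integral_multc) (simp_all add: nn_integral_offspring)
    also have "\<dots> = (\<integral>\<^sup>+m. indicator Q (snd m) \<partial>?p)"
      by (subst nn_integral_pair_pmf') (simp add: measure_pmf.emeasure_space_1)
    also have "\<dots> = emeasure ?p ?S"
      by (subst S[symmetric]) simp
    finally show ?thesis using 3 by simp
  qed
qed

lemma nn_integral_straight_prob_le:
  assumes C: "mean_special_rank \<mu> = ennreal C" and n: "n \<ge> 1"
  shows "(\<integral>\<^sup>+i. ennreal (straight_prob \<mu> L w {m. level_rule n k m i}) \<partial>count_space UNIV)
    \<le> (if k = n then ennreal C else 1)"
proof -
  let ?p = "measure_pmf (mark_pmf \<mu>)" and ?S = "straight_marks L w"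
  let ?s = "mark_prob \<mu> ?S"
  have s: "?s > 0" by (rule prob_straight_marks_pos[OF crit])
  have "ennreal (straight_prob \<mu> L w {m. level_rule n k m i})
      = (\<integral>\<^sup>+m. indicator {m. level_rule n k m i} m * indicator ?S m \<partial>?p) / ennreal ?s" for i
  proof -
    have "ennreal (straight_prob \<mu> L w {m. level_rule n k m i})
        = emeasure ?p ({m. level_rule n k m i} \<inter> ?S) / ennreal ?s"
      using s by (simp add: straight_prob_def measure_pmf.emeasure_eq_measure divide_ennreal)
    also have "emeasure ?p ({m. level_rule n k m i} \<inter> ?S)
        = (\<integral>\<^sup>+m. indicator ({m. level_rule n k m i} \<inter> ?S) m \<partial>?p)" by simp
    finally show ?thesis by (simp only: indicator_inter_arith)
  qed
  then have "(\<integral>\<^sup>+i. ennreal (straight_prob \<mu> L w {m. level_rule n k m i}) \<partial>count_space UNIV)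
      = (\<Sum>i. (\<integral>\<^sup>+m. indicator {m. level_rule n k m i} m * indicator ?S m \<partial>?p) / ennreal ?s)"
    by (simp add: nn_integral_count_space_nat)
  also have "\<dots> = (\<Sum>i. (\<integral>\<^sup>+m. indicator {m. level_rule n k m i} m * indicator ?S m \<partial>?p)) / ennreal ?s"
    by (rule ennreal_suminf_divide)
  also have "(\<Sum>i. (\<integral>\<^sup>+m. indicator {m. level_rule n k m i} m * indicator ?S m \<partial>?p))
      = (\<integral>\<^sup>+m. (\<Sum>i. indicator {m. level_rule n k m i} m * indicator ?S m) \<partial>?p)"
    by (rule nn_integral_suminf[symmetric]) simp
  also have "\<dots> = (\<integral>\<^sup>+m. of_nat (level_mass n k m) * indicator ?S m \<partial>?p)"
    by (simp only: ennreal_suminf_multc suminf_level_rule)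
  also have "\<dots> / ennreal ?s \<le> (if k = n then ennreal C else 1) * ennreal ?s / ennreal ?s"
    using nn_integral_level_mass[OF C n, of k L w]
    by (intro divide_right_mono_ennreal) (simp add: measure_pmf.emeasure_eq_measure)
  also have "\<dots> = (if k = n then ennreal C else 1)"
    using s by (simp add: ennreal_mult_divide_eq)
  finally show ?thesis .
qed

text \<open>Fix the level at which the path leaves the spine. In the mean number of paths, this level
contributes at most the mean number \<open>C\<close> of left children, and every other level at most the factor \<open>1\<close>.
There are \<open>l\<close> choices of the level. The bound is uniform in \<open>L\<close>, relative to the probability of a
straight spine.\<close>

lemma past_generation_le:
  assumes C: "mean_special_rank \<mu> = ennreal C" "C \<ge> 0"
  shows "(\<integral>\<^sup>+u. ennreal (straight_past_prob \<mu> L u)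
        \<partial>count_space {u. length u = l})
    \<le> ennreal (straight_spine_prob \<mu> L * ((1 + C) * (real l + 1)))"
proof -
  interpret T: prob_space "tree_measure \<mu>" by (rule prob_space_tree_measure)
  let ?P = "straight_spine_prob \<mu> L"
  show ?thesis
  proof (cases "l = 0")
    case True
    have "?P * 1 \<le> ?P * (1 + C)" using C by (intro mult_left_mono) auto
    then show ?thesis using True by (simp add: nn_integral_count_space_finite) (auto intro!: ennreal_leI)
  next
    case False
    let ?a = "\<lambda>n k w i. ennreal (straight_prob \<mu> L w {m. level_rule n k m i})"
    have meas: "{t. straight_spine L t \<and> branches_at t n u} \<in> T.events" for n u
    proof -
      have "Measurable.pred (tree_measure \<mu>) (\<lambda>t. level_rule n k (t (take k u)) (u ! k))" for k
        by (rule measurable_compose[OF measurable_mark]) simp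
      then have [measurable]: "Measurable.pred (tree_measure \<mu>) (\<lambda>t. branches_at t n u)"
        unfolding branches_at_def by (intro pred_intros_countable pred_intros_logic) simp
      have "{t \<in> space (tree_measure \<mu>). straight_spine L t \<and> branches_at t n u} \<in> T.events" by measurable
      then show ?thesis by simp
    qed
    have "ennreal (straight_past_prob \<mu> L u)
        \<le> (\<Sum>n\<in>{1..l}. ennreal ?P * (\<Prod>k<l. ?a n k (take k u) (u ! k)))" if u: "length u = l" for u
    proof -
      have "straight_past_prob \<mu> L u
          \<le> measure (tree_measure \<mu>) (\<Union>n\<in>{1..l}. {t. straight_spine L t \<and> branches_at t n u})"
      proof (rule T.finite_measure_mono)
        show "{t. straight_spine L t \<and> u \<in> insert [] (past t)} \<subseteq> (\<Union>n\<in>{1..l}. {t. straight_spine L t \<and> branches_at t n u})"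
        proof
          fix t assume "t \<in> {t. straight_spine L t \<and> u \<in> insert [] (past t)}"
          then have "straight_spine L t" "u \<in> past t" using u False by auto
          then show "t \<in> (\<Union>n\<in>{1..l}. {t. straight_spine L t \<and> branches_at t n u})"
            using past_branches[of u t] u by auto
        qed
      qed (use meas in auto)
      also have "\<dots> \<le> (\<Sum>n\<in>{1..l}. measure (tree_measure \<mu>) {t. straight_spine L t \<and> branches_at t n u})"
        using meas by (intro T.finite_measure_subadditive_finite) auto
      finally have "ennreal (straight_past_prob \<mu> L u)
          \<le> (\<Sum>n\<in>{1..l}. ennreal (measure (tree_measure \<mu>) {t. straight_spine L t \<and> branches_at t n u}))"
        by (subst sum_ennreal) (auto intro: ennreal_leI)
      also have "\<dots> = (\<Sum>n\<in>{1..l}. ennreal ?P * (\<Prod>k<l. ?a n k (take k u) (u ! k)))"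
        by (intro sum.cong refl)
          (simp add: prob_straight_branches[OF crit] u ennreal_mult' prod_ennreal straight_prob_def)
      finally show ?thesis .
    qed
    then have "(\<integral>\<^sup>+u. ennreal (straight_past_prob \<mu> L u)
          \<partial>count_space {u. length u = l})
      \<le> (\<integral>\<^sup>+u. (\<Sum>n\<in>{1..l}. ennreal ?P * (\<Prod>k<l. ?a n k (take k u) (u ! k))) \<partial>count_space {u. length u = l})"
      by (intro nn_integral_mono) auto
    also have "\<dots> = (\<Sum>n\<in>{1..l}. ennreal ?P * (\<integral>\<^sup>+u. (\<Prod>k<l. ?a n k (take k u) (u ! k)) \<partial>count_space {u. length u = l}))"
      by (subst nn_integral_sum) (auto simp: nn_integral_cmult)
    also have "\<dots> \<le> (\<Sum>n\<in>{1..l}. ennreal ?P * ennreal (1 + C))"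
    proof (intro sum_mono mult_left_mono)
      fix n assume n: "n \<in> {1..l}"
      have "(\<integral>\<^sup>+u. (\<Prod>k<l. ?a n k (take k u) (u ! k)) \<partial>count_space {u. length u = l})
          \<le> (\<Prod>k<l. if k = n then ennreal C else 1)"
        using n C by (intro nn_integral_lists_prod_le nn_integral_straight_prob_le) auto
      also have "\<dots> \<le> ennreal (1 + C)"
        using C by (auto simp: prod.delta' intro!: ennreal_leI simp flip: ennreal_1)
      finally show "(\<integral>\<^sup>+u. (\<Prod>k<l. ?a n k (take k u) (u ! k)) \<partial>count_space {u. length u = l}) \<le> ennreal (1 + C)" .
    qed auto
    also have "\<dots> = ennreal (?P * ((1 + C) * real l))"
    proof -
      have "(\<Sum>n\<in>{1..l}. ennreal ?P * ennreal (1 + C)) = (\<Sum>n\<in>{1..l}. ennreal (?P * (1 + C)))"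
        using C by (intro sum.cong refl) (simp add: ennreal_mult')
      also have "\<dots> = ennreal (\<Sum>n\<in>{1..l}. ?P * (1 + C))"
        using C by (intro sum_ennreal) simp
      finally show ?thesis by (simp add: mult_ac)
    qed
    also have "\<dots> \<le> ennreal (?P * ((1 + C) * (real l + 1)))"
      using C by (intro ennreal_leI mult_left_mono) auto
    finally show ?thesis .
  qed
qed

end

lemma nn_integral_by_length:
  fixes f :: "nat list \<Rightarrow> ennreal"
  shows "(\<integral>\<^sup>+u. f u \<partial>count_space UNIV) = (\<Sum>l. \<integral>\<^sup>+u. f u \<partial>count_space {u. length u = l})"
proof -
  have "f u = (\<Sum>l. f u * indicator {u. length u = l} u)" for u
  proof -
    have "(\<lambda>l. indicator {u. length u = l} u :: ennreal) = indicator {length u}"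
      by (auto simp: indicator_def fun_eq_iff)
    then show ?thesis by (simp add: ennreal_suminf_cmult suminf_indicator_singleton)
  qed
  then have "(\<integral>\<^sup>+u. f u \<partial>count_space UNIV) = (\<integral>\<^sup>+u. (\<Sum>l. f u * indicator {u. length u = l} u) \<partial>count_space UNIV)"
    by simp
  also have "\<dots> = (\<Sum>l. \<integral>\<^sup>+u. f u * indicator {u. length u = l} u \<partial>count_space UNIV)"
    by (rule nn_integral_suminf) simp
  also have "\<dots> = (\<Sum>l. \<integral>\<^sup>+u. f u \<partial>count_space {u. length u = l})"
    by (subst (2) nn_integral_count_space_indicator) auto
  finally show ?thesis .
qed

text \<open>The exponent \<open>17/8\<close> is above \<open>2\<close>, so that the weights beat the linear growth of the generations;
it is below \<open>7/2 - 1\<close>, so that a summable power of the time distance and a small power of the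
cutoff remain.\<close>

lemma past_weight_bound:
  assumes crit: "critical_offspring_law \<mu>"
  obtains \<Gamma> :: real where "\<Gamma> > 0"
    "\<And>L. (\<integral>\<^sup>+u. ennreal (straight_past_prob \<mu> L u
          * (real (length u) + 1) powr (- (17/8))) \<partial>count_space UNIV)
      \<le> ennreal (straight_spine_prob \<mu> L * \<Gamma>)"
proof -
  have "mean_special_rank \<mu> \<noteq> \<infinity>"
    using nn_integral_special_rank_finite[OF crit] by auto
  then obtain C where C: "mean_special_rank \<mu> = ennreal C" "C \<ge> 0"
    by (cases "mean_special_rank \<mu>") auto
  define w where "w = (\<lambda>l. (real l + 1) powr (- (9/8)))"
  have "summable (\<lambda>l. real l powr (- (9/8)))" by (subst summable_real_powr_iff) simp
  then have "summable (\<lambda>l. real (Suc l) powr (- (9/8)))" by (subst summable_Suc_iff)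
  then have w: "summable w" by (simp add: w_def add.commute)
  have w0: "w l \<ge> 0" for l by (simp add: w_def)
  show ?thesis
  proof (rule that[of "(1 + C) * suminf w"])
    have "suminf w > 0" using w by (rule suminf_pos) (simp add: w_def)
    then show "(1 + C) * suminf w > 0" using C by simp
    fix L
    let ?P = "straight_spine_prob \<mu> L"
    let ?q = "\<lambda>u. straight_past_prob \<mu> L u"
    have "(\<integral>\<^sup>+u. ennreal (?q u * (real (length u) + 1) powr (- (17/8))) \<partial>count_space UNIV)
        = (\<Sum>l. \<integral>\<^sup>+u. ennreal (?q u * (real (length u) + 1) powr (- (17/8))) \<partial>count_space {u. length u = l})"
      by (rule nn_integral_by_length)
    also have "\<dots> = (\<Sum>l. \<integral>\<^sup>+u. ennreal (?q u) * ennreal ((real l + 1) powr (- (17/8))) \<partial>count_space {u. length u = l})"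
      by (intro suminf_cong nn_integral_cong) (simp add: ennreal_mult)
    also have "\<dots> = (\<Sum>l. (\<integral>\<^sup>+u. ennreal (?q u) \<partial>count_space {u. length u = l}) * ennreal ((real l + 1) powr (- (17/8))))"
      by (simp add: nn_integral_multc)
    also have "\<dots> \<le> (\<Sum>l. ennreal (?P * ((1 + C) * (real l + 1))) * ennreal ((real l + 1) powr (- (17/8))))"
      by (intro suminf_le mult_right_mono past_generation_le crit C) auto
    also have "\<dots> = (\<Sum>l. ennreal (?P * (1 + C) * w l))"
    proof (rule suminf_cong)
      fix l
      have "(real l + 1) * (real l + 1) powr (- (17/8)) = (real l + 1) powr (1 + - (17/8))"
        by (subst powr_add) simp
      then show "ennreal (?P * ((1 + C) * (real l + 1))) * ennreal ((real l + 1) powr (- (17/8))) = ennreal (?P * (1 + C) * w l)"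
        by (subst ennreal_mult''[symmetric]) (simp_all add: w_def mult.assoc)
    qed
    also have "\<dots> = ennreal (\<Sum>l. ?P * (1 + C) * w l)"
      using w w0 C by (intro suminf_ennreal2 summable_mult) auto
    also have "(\<Sum>l. ?P * (1 + C) * w l) = ?P * ((1 + C) * suminf w)"
      using w by (subst suminf_mult) (auto simp: mult.assoc)
    finally show "(\<integral>\<^sup>+u. ennreal (?q u * (real (length u) + 1) powr (- (17/8))) \<partial>count_space UNIV)
        \<le> ennreal (?P * ((1 + C) * suminf w))" .
  qed
qed

section \<open>Escape probabilities in a time window\<close>

lemma measurable_sum_count_space:
  fixes f :: "'i \<Rightarrow> 'b \<Rightarrow> 'c::{countable, comm_monoid_add}"
  assumes f: "\<And>i. i \<in> D \<Longrightarrow> f i \<in> measurable M (count_space UNIV)"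
  shows "(\<lambda>x. \<Sum>i\<in>D. f i x) \<in> measurable M (count_space UNIV)"
  using f
proof (induction D rule: infinite_finite_induct)
  case (insert d D)
  have [measurable]: "(\<lambda>x. \<Sum>i\<in>D. f i x) \<in> measurable M (count_space UNIV)" "f d \<in> measurable M (count_space UNIV)"
    using insert by auto
  have "(\<lambda>x. f d x + (\<Sum>i\<in>D. f i x)) \<in> measurable M (count_space UNIV)" by measurable
  then show ?case using insert by simp
qed auto

lemma space_increment_measure [simp]: "space increment_measure = UNIV"
  by (simp add: increment_measure_def space_PiM)

lemma iid_steps_increment_measure: "iid_steps increment_measure (\<lambda>w y. y w)"
  unfolding increment_measure_def by (rule iid_steps_PiM)

lemma prob_space_increment_measure: "prob_space increment_measure"
  using iid_steps_increment_measure by (rule iid_steps.axioms(1))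

lemma measurable_increment [measurable]: "(\<lambda>y. y w) \<in> measurable increment_measure (count_space UNIV)"
  using iid_steps_increment_measure by (rule iid_steps.measurable_step)

lemma measurable_tree_walk [measurable]:
  "(\<lambda>y. tree_walk x y u) \<in> measurable increment_measure (count_space UNIV)"
proof -
  have [measurable]: "(\<lambda>y. \<Sum>k = 1..length u. y (take k u)) \<in> measurable increment_measure (count_space UNIV)"
    by (rule measurable_sum_count_space) measurable
  show ?thesis unfolding tree_walk_def by measurable
qed

lemma past_range_disjoint_iff:
  "past_range x t y \<inter> A = {} \<longleftrightarrow> (\<forall>u. u \<in> past t \<longrightarrow> tree_walk x y u \<notin> A)"
  by (auto simp: past_range_def)

abbreviation "tree_walk_measure \<mu> \<equiv> tree_measure \<mu> \<Otimes>\<^sub>M increment_measure"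

lemma prob_space_tree_walk_measure: "prob_space (tree_walk_measure \<mu>)"
proof -
  interpret T: prob_space "tree_measure \<mu>" by (rule prob_space_tree_measure)
  interpret Y: prob_space "increment_measure" by (rule prob_space_increment_measure)
  interpret P: pair_prob_space "tree_measure \<mu>" "increment_measure" ..
  show ?thesis by unfold_locales
qed

lemma sets_past_avoids:
  "{x \<in> space (tree_walk_measure \<mu>). case x of (t, y) \<Rightarrow> past_range z t y \<inter> A = {}} \<in> sets (tree_walk_measure \<mu>)"
proof -
  have "Measurable.pred (tree_walk_measure \<mu>) (\<lambda>x. u \<in> past (fst x) \<longrightarrow> tree_walk z (snd x) u \<notin> A)" for u
    by measurable
  then have "Measurable.pred (tree_walk_measure \<mu>) (\<lambda>x. \<forall>u. u \<in> past (fst x) \<longrightarrow> tree_walk z (snd x) u \<notin> A)"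
    by (intro pred_intros_countable)
  then have "{x \<in> space (tree_walk_measure \<mu>). \<forall>u. u \<in> past (fst x) \<longrightarrow> tree_walk z (snd x) u \<notin> A} \<in> sets (tree_walk_measure \<mu>)"
    by measurable
  then show ?thesis by (simp add: past_range_disjoint_iff case_prod_beta)
qed

definition escape_prob :: "nat pmf \<Rightarrow> (int ^ 'n) set \<Rightarrow> real" where
  "escape_prob \<mu> A = \<P>((t, y) in tree_walk_measure \<mu>. past_range 0 t y \<inter> A = {})"

lemma escape_prob_translate:
  fixes x :: "int ^ 'n"
  shows "\<P>((t, y) in tree_walk_measure \<mu>. past_range x t y \<inter> A = {}) = escape_prob \<mu> ((\<lambda>z. z - x) ` A)"
proof -
  have "tree_walk x y u = x + tree_walk 0 y u" for y :: "nat list \<Rightarrow> int ^ 'n" and u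
    by (simp add: tree_walk_def)
  then have "past_range x t y \<inter> A = {} \<longleftrightarrow> past_range 0 t y \<inter> (\<lambda>z. z - x) ` A = {}"
    for t and y :: "nat list \<Rightarrow> int ^ 'n"
    by (auto simp: past_range_disjoint_iff image_iff algebra_simps)
  then show ?thesis by (simp add: escape_prob_def)
qed

lemma escape_prob_nonneg: "0 \<le> escape_prob \<mu> A"
  by (simp add: escape_prob_def)

lemma escape_prob_le_1: "escape_prob \<mu> A \<le> 1"
  unfolding escape_prob_def by (rule prob_space.prob_le_1[OF prob_space_tree_walk_measure])

lemma escape_prob_antimono:
  assumes "A \<subseteq> B" shows "escape_prob \<mu> B \<le> escape_prob \<mu> A"
proof -
  interpret prob_space "tree_walk_measure \<mu>" by (rule prob_space_tree_walk_measure)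
  show ?thesis unfolding escape_prob_def
  proof (rule finite_measure_mono)
    have "{(t, y). (t, y) \<in> space (tree_walk_measure \<mu>) \<and> past_range 0 t y \<inter> A = {}}
      = {x \<in> space (tree_walk_measure \<mu>). case x of (t, y) \<Rightarrow> past_range 0 t y \<inter> A = {}}"
      by auto
    then show "{(t, y). (t, y) \<in> space (tree_walk_measure \<mu>) \<and> past_range 0 t y \<inter> A = {}} \<in> events"
      by (simp only: sets_past_avoids)
  qed (use assms in auto)
qed

definition displacement :: "(nat \<Rightarrow> int ^ 'n) \<Rightarrow> nat \<Rightarrow> nat \<Rightarrow> int ^ 'n" where
  "displacement \<zeta> k i = (if k \<le> i then sum \<zeta> {k..<i} else - sum \<zeta> {i..<k})"

text \<open>The term of time \<open>k\<close> in the capacity of the positions at the times in \<open>I\<close>, when a point of the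
range is represented by the last time in \<open>I\<close> at which it is visited.\<close>

definition window_escape :: "nat pmf \<Rightarrow> nat \<Rightarrow> nat set \<Rightarrow> (nat \<Rightarrow> int ^ 'n) \<Rightarrow> real" where
  "window_escape \<mu> k I \<zeta> =
     (if \<forall>i\<in>I. k < i \<longrightarrow> displacement \<zeta> k i \<noteq> 0 then escape_prob \<mu> (displacement \<zeta> k ` I) else 0)"

lemma window_escape_nonneg: "0 \<le> window_escape \<mu> k I \<zeta>"
  by (simp add: window_escape_def escape_prob_nonneg)

lemma window_escape_le_1: "window_escape \<mu> k I \<zeta> \<le> 1"
  by (simp add: window_escape_def escape_prob_le_1)

lemma window_escape_antimono:
  assumes "I \<subseteq> J" shows "window_escape \<mu> k J \<zeta> \<le> window_escape \<mu> k I \<zeta>"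
  using assms escape_prob_antimono[of "displacement \<zeta> k ` I" "displacement \<zeta> k ` J" \<mu>]
  by (auto simp: window_escape_def escape_prob_nonneg intro: image_mono)

definition walk_measure :: "(nat \<Rightarrow> int ^ 'n) measure" where
  "walk_measure = (\<Pi>\<^sub>M i\<in>UNIV. measure_pmf step_pmf)"

lemma space_walk_measure [simp]: "space walk_measure = UNIV"
  by (simp add: walk_measure_def space_PiM)

lemma iid_steps_walk_measure: "iid_steps walk_measure (\<lambda>i \<zeta>. \<zeta> i)"
  unfolding walk_measure_def by (rule iid_steps_PiM)

lemma prob_space_walk_measure: "prob_space walk_measure"
  using iid_steps_walk_measure by (rule iid_steps.axioms(1))

lemma measurable_walk_step [measurable]: "(\<lambda>\<zeta>. \<zeta> i) \<in> measurable walk_measure (count_space UNIV)"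
  using iid_steps_walk_measure by (rule iid_steps.measurable_step)

lemma measurable_displacement [measurable]:
  "(\<lambda>\<zeta>. displacement \<zeta> k i) \<in> measurable walk_measure (count_space UNIV)"
proof -
  have [measurable]: "(\<lambda>\<zeta>. sum \<zeta> D) \<in> measurable walk_measure (count_space UNIV)" for D
    by (rule measurable_sum_count_space) measurable
  show ?thesis by (cases "k \<le> i") (simp_all add: displacement_def)
qed

type_synonym 'n config = "(nat \<Rightarrow> int ^ 'n) \<times> marks \<times> (nat list \<Rightarrow> int ^ 'n)"

abbreviation joint_measure :: "nat pmf \<Rightarrow> 'n::finite config measure" where
  "joint_measure \<mu> \<equiv> walk_measure \<Otimes>\<^sub>M tree_walk_measure \<mu>"

definition no_collision :: "nat \<Rightarrow> nat set \<Rightarrow> 'n::finite config \<Rightarrow> bool" where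
  "no_collision k I x \<longleftrightarrow> (\<forall>i\<in>I. k < i \<longrightarrow> displacement (fst x) k i \<noteq> 0) \<and>
     (\<forall>u. u \<in> past (fst (snd x)) \<longrightarrow>
       (\<forall>i\<in>I. tree_walk 0 (snd (snd x)) u \<noteq> displacement (fst x) k i))"

lemma pred_no_collision [measurable]:
  assumes "finite I"
  shows "Measurable.pred (joint_measure \<mu>) (\<lambda>x. no_collision k I x)"
proof -
  have steps: "Measurable.pred (joint_measure \<mu>) (\<lambda>x. \<forall>i\<in>I. k < i \<longrightarrow> displacement (fst x) k i \<noteq> 0)"
    using assms by (intro pred_intros_finite) measurable
  have coll: "Measurable.pred (joint_measure \<mu>) (\<lambda>x. u \<in> past (fst (snd x)) \<longrightarrow>
      (\<forall>i\<in>I. tree_walk 0 (snd (snd x)) u \<noteq> displacement (fst x) k i))" for u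
    using assms by (intro pred_intros_logic pred_intros_finite) measurable
  have "Measurable.pred (joint_measure \<mu>) (\<lambda>x. \<forall>u. u \<in> past (fst (snd x)) \<longrightarrow>
      (\<forall>i\<in>I. tree_walk 0 (snd (snd x)) u \<noteq> displacement (fst x) k i))"
    using coll by (rule pred_intros_countable)
  from pred_intros_logic(3)[OF steps this] show ?thesis unfolding no_collision_def .
qed


lemma nn_integral_window_escape:
  assumes "finite I"
  shows "(\<integral>\<^sup>+\<zeta>. ennreal (window_escape \<mu> k I \<zeta>) \<partial>(walk_measure :: (nat \<Rightarrow> int ^ 'n) measure))
    = emeasure (joint_measure \<mu>) {x :: 'n::finite config. no_collision k I x}"
proof -
  interpret T: prob_space "tree_walk_measure \<mu>" by (rule prob_space_tree_walk_measure)
  let ?S = "{x :: 'n::finite config. no_collision k I x}"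
  have "{x\<in>space (joint_measure \<mu> :: 'n::finite config measure). no_collision k I x} \<in> sets (joint_measure \<mu>)"
    using pred_no_collision[OF assms] by measurable
  then have S: "?S \<in> sets (joint_measure \<mu>)" by (simp add: space_pair_measure)
  have slice: "ennreal (window_escape \<mu> k I \<zeta>) = emeasure (tree_walk_measure \<mu>) (Pair \<zeta> -` ?S)" for \<zeta> :: "nat \<Rightarrow> int ^ 'n"
  proof -
    have "Pair \<zeta> -` ?S = (if \<forall>i\<in>I. k < i \<longrightarrow> displacement \<zeta> k i \<noteq> 0
      then {x. case x of (t, y) \<Rightarrow> past_range 0 t y \<inter> displacement \<zeta> k ` I = {}} else {})"
      by (auto simp: no_collision_def past_range_disjoint_iff)
    then show ?thesis
      by (auto simp: window_escape_def escape_prob_def space_pair_measure T.emeasure_eq_measure)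
  qed
  show ?thesis unfolding T.emeasure_pair_measure_alt[OF S] by (intro nn_integral_cong slice)
qed

text \<open>The shape of the tree is independent of all steps, but it sits between the two families of
steps in the product space.\<close>

lemma emeasure_joint_product:
  assumes A: "Measurable.pred (tree_measure \<mu>) A"
    and B: "Measurable.pred (walk_measure \<Otimes>\<^sub>M increment_measure) (\<lambda>x. B (fst x) (snd x))"
  shows "emeasure (joint_measure \<mu>) {x. A (fst (snd x)) \<and> B (fst x) (snd (snd x))}
    = emeasure (tree_measure \<mu>) {t. A t}
      * emeasure (walk_measure \<Otimes>\<^sub>M increment_measure) {x. B (fst x) (snd x)}"
proof -
  interpret TY: prob_space "tree_walk_measure \<mu>" by (rule prob_space_tree_walk_measure)
  interpret Y: prob_space increment_measure by (rule prob_space_increment_measure)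
  have mA: "{t. A t} \<in> sets (tree_measure \<mu>)"
    using measurable_sets_Collect[OF A, of "\<lambda>x. x"] by simp
  have mB: "{x. B (fst x) (snd x)} \<in> sets (walk_measure \<Otimes>\<^sub>M increment_measure)"
    using measurable_sets_Collect[OF B, of "\<lambda>x. x"] by (simp add: space_pair_measure)
  have "Measurable.pred (joint_measure \<mu>) (\<lambda>x. A (fst (snd x)))"
    by (rule measurable_compose[OF _ A]) measurable
  moreover have "(\<lambda>x. (fst x, snd (snd x))) \<in> measurable (joint_measure \<mu>) (walk_measure \<Otimes>\<^sub>M increment_measure)"
    by measurable
  from measurable_compose[OF this B]
  have "Measurable.pred (joint_measure \<mu>) (\<lambda>x. B (fst x) (snd (snd x)))" by simp
  ultimately have "Measurable.pred (joint_measure \<mu>) (\<lambda>x. A (fst (snd x)) \<and> B (fst x) (snd (snd x)))"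
    by (intro pred_intros_logic)
  from measurable_sets_Collect[OF this, of "\<lambda>x. x"]
  have S: "{x. A (fst (snd x)) \<and> B (fst x) (snd (snd x))} \<in> sets (joint_measure \<mu>)"
    by (simp add: space_pair_measure)
  have slice: "{y. B \<zeta> y} \<in> sets increment_measure" for \<zeta>
    using sets_Pair1[OF mB, of \<zeta>] by (simp add: vimage_def)
  have "emeasure (joint_measure \<mu>) {x. A (fst (snd x)) \<and> B (fst x) (snd (snd x))}
      = (\<integral>\<^sup>+\<zeta>. emeasure (tree_walk_measure \<mu>) ({t. A t} \<times> {y. B \<zeta> y}) \<partial>walk_measure)"
    unfolding TY.emeasure_pair_measure_alt[OF S]
    by (intro nn_integral_cong arg_cong2[where f = emeasure]) auto
  also have "\<dots> = (\<integral>\<^sup>+\<zeta>. emeasure (tree_measure \<mu>) {t. A t}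
      * emeasure increment_measure (Pair \<zeta> -` {x. B (fst x) (snd x)}) \<partial>walk_measure)"
    by (intro nn_integral_cong) (simp only: Y.emeasure_pair_measure_Times[OF mA slice], simp add: vimage_def)
  also have "\<dots> = emeasure (tree_measure \<mu>) {t. A t}
      * (\<integral>\<^sup>+\<zeta>. emeasure increment_measure (Pair \<zeta> -` {x. B (fst x) (snd x)}) \<partial>walk_measure)"
    by (rule nn_integral_cmult) (rule Y.measurable_emeasure_Pair[OF mB])
  finally show ?thesis by (simp only: Y.emeasure_pair_measure_alt[OF mB])
qed

section \<open>The law of a single collision\<close>

text \<open>The distance \<open>\<bar>i - k\<bar>\<close>: one of the two truncated differences is \<open>0\<close>.\<close>

abbreviation gap :: "nat \<Rightarrow> nat \<Rightarrow> nat" where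
  "gap k i \<equiv> (i - k) + (k - i)"

definition straight_walk :: "'n \<Rightarrow> nat \<Rightarrow> nat \<Rightarrow> (nat \<Rightarrow> int ^ 'n) \<Rightarrow> bool" where
  "straight_walk a k L \<zeta> \<longleftrightarrow> (\<forall>i\<in>{k - L..<k + L}. \<zeta> i = (if i < k then axis a 1 else axis a (- 1)))"

definition straight_increments :: "'n \<Rightarrow> nat \<Rightarrow> (nat list \<Rightarrow> int ^ 'n) \<Rightarrow> bool" where
  "straight_increments a L y \<longleftrightarrow> (\<forall>n\<in>{1..L}. y (replicate n 0) = axis a 1)"

lemma axis_add: "axis a (b + c) = (axis a b + axis a c :: int ^ 'n)"
  by (simp add: vec_eq_iff axis_def)

lemma sum_const_axis: "(\<Sum>i\<in>A. axis a c) = (axis a (int (card A) * c) :: int ^ 'n)"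
proof (induction A rule: infinite_finite_induct)
  case (insert x A)
  then show ?case by (simp add: distrib_right axis_add del: sum_constant)
qed (simp_all add: vec_eq_iff axis_def)

lemma axis_in_lattice_neighbors: "axis a 1 \<in> lattice_neighbors" "axis a (- 1) \<in> lattice_neighbors"
  unfolding lattice_neighbors_def by blast+

lemma axis_minus: "axis a (- b) = (- axis a b :: int ^ 'n)"
  by (simp add: vec_eq_iff axis_def)

lemma tree_walk_straight:
  fixes y :: "nat list \<Rightarrow> int ^ 'n"
  assumes y: "straight_increments a L y"
    and u: "take (min L (length u)) u = replicate (min L (length u)) 0"
  shows "tree_walk 0 y u = axis a (int (min (length u) L)) + (\<Sum>n\<in>{L<..length u}. y (take n u))"
proof -
  have "{1..length u} = {1..min (length u) L} \<union> {L<..length u}" by auto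
  then have "tree_walk 0 y u = (\<Sum>n\<in>{1..min (length u) L}. y (take n u)) + (\<Sum>n\<in>{L<..length u}. y (take n u))"
    unfolding tree_walk_def by (simp del: One_nat_def) (rule sum.union_disjoint, auto)
  also have "(\<Sum>n\<in>{1..min (length u) L}. y (take n u)) = (\<Sum>n\<in>{1..min (length u) L}. axis a 1)"
  proof (rule sum.cong[OF refl])
    fix n assume n: "n \<in> {1..min (length u) L}"
    have m: "min n (min L (length u)) = n" using n by auto
    then have "take n u = take n (take (min L (length u)) u)" by (simp only: take_take)
    also have "\<dots> = replicate n 0" unfolding u take_replicate m ..
    finally show "y (take n u) = axis a 1" using y n by (auto simp: straight_increments_def)
  qed
  finally show ?thesis by (simp add: sum_const_axis del: sum_constant)
qed

text \<open>The steps between the times \<open>k\<close> and \<open>i\<close> that remain random when the \<open>L\<close> steps next to \<open>k\<close> on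
either side are prescribed.\<close>

definition free_steps :: "nat \<Rightarrow> nat \<Rightarrow> nat \<Rightarrow> nat set" where
  "free_steps k L i = (if k \<le> i then {k + L..<i} else {i..<k - L})"

lemma card_free_steps: "card (free_steps k L i) = gap k i - L"
  by (auto simp: free_steps_def)

lemma displacement_straight:
  fixes \<zeta> :: "nat \<Rightarrow> int ^ 'n"
  assumes \<zeta>: "straight_walk a k L \<zeta>" and L: "L \<le> k"
  shows "displacement \<zeta> k i = axis a (- int (min (gap k i) L))
    - (\<Sum>j\<in>free_steps k L i. if j < k then \<zeta> j else - \<zeta> j)"
proof (cases "k \<le> i")
  case True
  have "{k..<i} = {k..<k + min (i - k) L} \<union> {k + L..<i}" using True by auto
  then have "sum \<zeta> {k..<i} = sum \<zeta> {k..<k + min (i - k) L} + sum \<zeta> {k + L..<i}"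
    by simp (rule sum.union_disjoint, auto)
  also have "sum \<zeta> {k..<k + min (i - k) L} = (\<Sum>j\<in>{k..<k + min (i - k) L}. axis a (- 1))"
  proof (rule sum.cong[OF refl])
    fix j assume "j \<in> {k..<k + min (i - k) L}"
    then have "j \<in> {k - L..<k + L}" "\<not> j < k" by auto
    then show "\<zeta> j = axis a (- 1)" using \<zeta> by (simp add: straight_walk_def)
  qed
  also have "sum \<zeta> {k + L..<i} = - (\<Sum>j\<in>{k + L..<i}. if j < k then \<zeta> j else - \<zeta> j)"
    by (simp add: sum_negf[symmetric])
  finally show ?thesis using True
    by (simp add: displacement_def free_steps_def sum_const_axis del: sum_constant)
next
  case False
  have "{i..<k} = {k - min (k - i) L..<k} \<union> {i..<k - L}" using False L by auto
  then have "sum \<zeta> {i..<k} = sum \<zeta> {k - min (k - i) L..<k} + sum \<zeta> {i..<k - L}"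
    by simp (rule sum.union_disjoint, auto)
  also have "sum \<zeta> {k - min (k - i) L..<k} = (\<Sum>j\<in>{k - min (k - i) L..<k}. axis a 1)"
  proof (rule sum.cong[OF refl])
    fix j assume "j \<in> {k - min (k - i) L..<k}"
    then have "j \<in> {k - L..<k + L}" "j < k" by auto
    then show "\<zeta> j = axis a 1" using \<zeta> by (simp add: straight_walk_def)
  qed
  also have "sum \<zeta> {i..<k - L} = (\<Sum>j\<in>{i..<k - L}. if j < k then \<zeta> j else - \<zeta> j)"
    by (rule sum.cong) auto
  finally show ?thesis using False L
    by (simp add: displacement_def free_steps_def sum_const_axis axis_minus del: sum_constant)
qed

type_synonym 'n steps = "(nat \<Rightarrow> int ^ 'n) \<times> (nat list \<Rightarrow> int ^ 'n)"

lemma prob_space_steps: "prob_space (walk_measure \<Otimes>\<^sub>M increment_measure :: 'n::finite steps measure)"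
  by (rule iid_steps.axioms(1)[OF iid_steps_pair[OF iid_steps_walk_measure iid_steps_increment_measure]])

text \<open>After straight starts of length \<open>L\<close> in opposite directions, the tree-indexed walk at \<open>u\<close> and the
walk at time \<open>i\<close> coincide exactly if the remaining independent steps of both add up to the
displacement that the starts have put between them.\<close>

lemma prob_straight_collision:
  fixes a :: "'n::finite"
  assumes L: "L \<le> k"
    and u: "take (min L (length u)) u = replicate (min L (length u)) 0"
  shows "measure (walk_measure \<Otimes>\<^sub>M increment_measure) {x :: 'n steps.
      straight_walk a k L (fst x) \<and> straight_increments a L (snd x) \<and>
      tree_walk 0 (snd x) u = displacement (fst x) k i}
    = (1 / (2 * real CARD('n))) ^ (3 * L)
      * walk_kernel ((length u - L) + (gap k i - L))
          (axis a (- int (min (length u) L + min (gap k i) L)) :: int ^ 'n)"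
proof -
  define Z :: "nat + nat list \<Rightarrow> (nat \<Rightarrow> int ^ 'n) \<times> (nat list \<Rightarrow> int ^ 'n) \<Rightarrow> int ^ 'n"
    where "Z = (\<lambda>j (\<omega>, \<xi>). case j of Inl i \<Rightarrow> \<omega> i | Inr w \<Rightarrow> \<xi> w)"
  interpret iid_steps "walk_measure \<Otimes>\<^sub>M increment_measure" Z
    unfolding Z_def by (rule iid_steps_pair[OF iid_steps_walk_measure iid_steps_increment_measure])
  define W where "W = (\<lambda>n. replicate n (0::nat)) ` {1..L}"
  define E :: "(nat + nat list) set" where "E = Inl ` {k - L..<k + L} \<union> Inr ` W"
  define e :: "nat + nat list \<Rightarrow> int ^ 'n" where
    "e = case_sum (\<lambda>i. if i < k then axis a 1 else axis a (- 1)) (\<lambda>_. axis a 1)"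
  define U where "U = (\<lambda>n. take n u) ` {L<..length u}"
  define D :: "(nat + nat list) set" where "D = Inl ` free_steps k L i \<union> Inr ` U"
  define P :: "(nat + nat list) set" where "P = Inl ` {..<k} \<union> range Inr"
  have injW: "inj_on (\<lambda>n. replicate n (0::nat)) {1..L}" by (auto simp: inj_on_def)
  have injU: "inj_on (\<lambda>n. take n u) {L<..length u}"
    by (rule inj_onI) (metis greaterThanAtMost_iff length_take min.absorb2)
  have fin: "finite W" "finite U" "finite (free_steps k L i)"
    by (auto simp: W_def U_def free_steps_def)
  have cardE: "card E = 3 * L"
  proof -
    have "card E = card {k - L..<k + L} + card W"
      unfolding E_def using fin by (subst card_Un_disjoint) (auto simp: card_image)
    then show ?thesis using L card_image[OF injW] by (simp add: W_def)
  qed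
  have cardD: "card D = (length u - L) + (gap k i - L)"
  proof -
    have "card D = card (free_steps k L i) + card U"
      unfolding D_def using fin by (subst card_Un_disjoint) (auto simp: card_image)
    then show ?thesis using card_image[OF injU] by (simp add: U_def card_free_steps)
  qed
  \<comment> \<open>words in \<open>W\<close> have length at most \<open>L\<close>, those in \<open>U\<close> are longer\<close>
  have "W \<inter> U = {}"
  proof -
    have "length w \<le> L" if "w \<in> W" for w using that by (auto simp: W_def)
    moreover have "length w > L" if "w \<in> U" for w using that by (auto simp: U_def)
    ultimately show ?thesis by fastforce
  qed
  then have disj: "E \<inter> D = {}"
    using L by (auto simp: E_def D_def free_steps_def)
  have e: "e \<in> E \<rightarrow> lattice_neighbors"
    by (auto simp: E_def e_def axis_in_lattice_neighbors split: sum.split)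
  let ?s = "\<lambda>\<omega> \<xi> j. if j \<in> P then Z j (\<omega>, \<xi>) else - Z j (\<omega>, \<xi>)"
  have key: "(straight_walk a k L \<omega> \<and> straight_increments a L \<xi> \<and> tree_walk 0 \<xi> u = displacement \<omega> k i)
    \<longleftrightarrow> (\<forall>j\<in>E. Z j (\<omega>, \<xi>) = e j) \<and> (\<Sum>j\<in>D. ?s \<omega> \<xi> j)
        = axis a (- int (min (length u) L + min (gap k i) L))" for \<omega> \<xi>
  proof -
    have 1: "(\<forall>j\<in>E. Z j (\<omega>, \<xi>) = e j) \<longleftrightarrow> straight_walk a k L \<omega> \<and> straight_increments a L \<xi>"
      by (auto simp: E_def W_def Z_def e_def straight_walk_def straight_increments_def ball_Un)
    have "(\<Sum>j\<in>D. ?s \<omega> \<xi> j)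
      = (\<Sum>j\<in>free_steps k L i. if j < k then \<omega> j else - \<omega> j) + (\<Sum>w\<in>U. \<xi> w)"
    proof -
      have "(\<Sum>j\<in>D. ?s \<omega> \<xi> j)
        = (\<Sum>j\<in>Inl ` free_steps k L i. ?s \<omega> \<xi> j)
          + (\<Sum>j\<in>Inr ` U. ?s \<omega> \<xi> j)"
        unfolding D_def using fin by (intro sum.union_disjoint) auto
      also have "(\<Sum>j\<in>Inl ` free_steps k L i. ?s \<omega> \<xi> j)
        = (\<Sum>j\<in>free_steps k L i. if j < k then \<omega> j else - \<omega> j)"
        by (subst sum.reindex) (auto simp: P_def Z_def image_iff intro!: sum.cong)
      also have "(\<Sum>j\<in>Inr ` U. ?s \<omega> \<xi> j) = (\<Sum>w\<in>U. \<xi> w)"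
        by (subst sum.reindex) (auto simp: P_def Z_def)
      finally show ?thesis .
    qed
    also have "(\<Sum>w\<in>U. \<xi> w) = (\<Sum>n\<in>{L<..length u}. \<xi> (take n u))"
      unfolding U_def by (subst sum.reindex[OF injU]) simp
    finally have 2: "(\<Sum>j\<in>D. ?s \<omega> \<xi> j)
      = (\<Sum>j\<in>free_steps k L i. if j < k then \<omega> j else - \<omega> j) + (\<Sum>n\<in>{L<..length u}. \<xi> (take n u))" .
    show ?thesis
    proof (cases "straight_walk a k L \<omega> \<and> straight_increments a L \<xi>")
      case True
      then have "tree_walk 0 \<xi> u = axis a (int (min (length u) L)) + (\<Sum>n\<in>{L<..length u}. \<xi> (take n u))"
        "displacement \<omega> k i = axis a (- int (min (gap k i) L))
          - (\<Sum>j\<in>free_steps k L i. if j < k then \<omega> j else - \<omega> j)"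
        using tree_walk_straight[OF _ u] displacement_straight[OF _ L] by blast+
      moreover have "axis a (- int (min (length u) L + min (gap k i) L))
          = (- axis a (int (min (length u) L)) - axis a (int (min (gap k i) L)) :: int ^ 'n)"
        by (simp add: vec_eq_iff axis_def)
      moreover have "x + s = - y - r \<longleftrightarrow> r + s = - x - y" for x y r s :: "int ^ 'n"
        unfolding vec_eq_iff by (rule all_cong1) auto
      ultimately show ?thesis unfolding 1 2 using True by (simp only: axis_minus simp_thms)
    next
      case False
      then show ?thesis unfolding 1 by blast
    qed
  qed
  have "{x. straight_walk a k L (fst x) \<and> straight_increments a L (snd x) \<and>
      tree_walk 0 (snd x) u = displacement (fst x) k i}
    = {x\<in>space (walk_measure \<Otimes>\<^sub>M increment_measure). (\<forall>j\<in>E. Z j x = e j)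
        \<and> (\<Sum>j\<in>D. if j \<in> P then Z j x else - Z j x)
          = axis a (- int (min (length u) L + min (gap k i) L))}"
  proof (intro set_eqI, unfold mem_Collect_eq)
    fix x :: "(nat \<Rightarrow> int ^ 'n) \<times> (nat list \<Rightarrow> int ^ 'n)"
    have "x \<in> space (walk_measure \<Otimes>\<^sub>M increment_measure)" by (simp add: space_pair_measure)
    then show "(straight_walk a k L (fst x) \<and> straight_increments a L (snd x) \<and>
        tree_walk 0 (snd x) u = displacement (fst x) k i) \<longleftrightarrow>
      x \<in> space (walk_measure \<Otimes>\<^sub>M increment_measure) \<and> (\<forall>j\<in>E. Z j x = e j)
        \<and> (\<Sum>j\<in>D. if j \<in> P then Z j x else - Z j x)
          = axis a (- int (min (length u) L + min (gap k i) L))"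
      unfolding key[of "fst x" "snd x"] prod.collapse by blast
  qed
  then show ?thesis
    using prob_cylinder_signed_sum[of D E e P] fin disj e
    by (simp only: cardE[symmetric] cardD[symmetric]) (simp add: D_def E_def)
qed

lemma prob_straight_steps:
  fixes a :: "'n::finite"
  assumes L: "L \<le> k"
  shows "measure (walk_measure \<Otimes>\<^sub>M increment_measure) {x :: 'n steps.
      straight_walk a k L (fst x) \<and> straight_increments a L (snd x)}
    = (1 / (2 * real CARD('n))) ^ (3 * L)"
proof -
  have "axis a 0 = (0 :: int ^ 'n)" by (simp add: vec_eq_iff axis_def)
  moreover have "tree_walk 0 y [] = (0 :: int ^ 'n)" for y by (simp add: tree_walk_def)
  moreover have "displacement \<zeta> k k = (0 :: int ^ 'n)" for \<zeta> by (simp add: displacement_def)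
  ultimately show ?thesis
    using prob_straight_collision[OF L, where u = "[]" and i = k and a = a] by simp
qed

text \<open>There are \<open>n = (m - L) + (g - L)\<close> free steps (truncated subtraction). A collision is impossible
unless they make up for the distance created by the straight starts, and then \<open>2 n \<ge> m + g\<close> and
\<open>n \<ge> R\<close>. So \<open>n\<^bsup>-7/2\<^esup>\<close> can be split into powers of \<open>R\<close>, \<open>m\<close> and \<open>g\<close>, with exponents
\<open>1/4 + 17/8 + 9/8 = 7/2\<close>. The second alternative of the hypothesis on \<open>R\<close> serves the
unconditioned case \<open>L = 0\<close>, where \<open>R\<close> is a cutoff for the time distance.\<close>

lemma walk_kernel_collision_le:
  fixes a :: "'n::finite"
  assumes d: "CARD('n) \<ge> 7" and R: "R \<le> L \<or> (L = 0 \<and> R \<le> g)" and mg: "m + g > 0"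
  shows "walk_kernel ((m - L) + (g - L)) (axis a (- int (min m L + min g L)) :: int ^ 'n)
    \<le> (2 * real CARD('n)) powr (7/2) * 2 powr (13/4) * (real R + 1) powr (- (1/4))
      * (real m + 1) powr (- (17/8)) * (real g + 1) powr (- (9/8))"
proof (cases "(m - L) + (g - L) < min m L + min g L")
  case True
  then have "walk_kernel ((m - L) + (g - L)) (axis a (- int (min m L + min g L)) :: int ^ 'n) = 0"
    by (intro walk_kernel_eq_0[where i = a]) (simp add: axis_def)
  then show ?thesis by simp
next
  case False
  define n where "n = (m - L) + (g - L)"
  have n: "R \<le> n" "m \<le> 2 * n" "g \<le> 2 * n"
    using False R mg unfolding n_def by (auto simp: min_def split: if_splits)
  let ?x = "real n + 1"
  have "?x powr (- 7/2) = ?x powr (- (1/4)) * ?x powr (- (17/8)) * ?x powr (- (9/8))"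
    by (simp add: powr_add[symmetric])
  also have "\<dots> \<le> (real R + 1) powr (- (1/4)) * ((real m + 1) / 2) powr (- (17/8)) * ((real g + 1) / 2) powr (- (9/8))"
    using n by (intro mult_mono powr_mono2') auto
  also have "\<dots> = (real R + 1) powr (- (1/4)) * (2 powr (17/8) * (real m + 1) powr (- (17/8)))
      * (2 powr (9/8) * (real g + 1) powr (- (9/8)))"
    by (simp add: powr_divide powr_minus field_simps)
  also have "\<dots> = 2 powr (13/4) * (real R + 1) powr (- (1/4)) * (real m + 1) powr (- (17/8)) * (real g + 1) powr (- (9/8))"
  proof -
    have "(2::real) powr (13/4) = 2 powr (17/8) * 2 powr (9/8)" by (simp add: powr_add[symmetric])
    then show ?thesis by (simp only: mult_ac)
  qed
  finally have "(2 * real CARD('n)) powr (7/2) * ?x powr (- 7/2)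
    \<le> (2 * real CARD('n)) powr (7/2) * (2 powr (13/4) * (real R + 1) powr (- (1/4))
      * (real m + 1) powr (- (17/8)) * (real g + 1) powr (- (9/8)))"
    by (intro mult_left_mono) auto
  then show ?thesis
    using walk_kernel_le[OF d, of n "axis a (- int (min m L + min g L))"]
    unfolding n_def by (simp only: mult.assoc) 
qed

section \<open>Summing over collisions\<close>

lemma pred_straight_walk [measurable]:
  "Measurable.pred walk_measure (straight_walk a k L)"
  unfolding straight_walk_def by (intro pred_intros_finite) auto

lemma pred_straight_increments [measurable]:
  "Measurable.pred increment_measure (straight_increments a L)"
  unfolding straight_increments_def by (intro pred_intros_finite) auto

definition straight_start :: "'n \<Rightarrow> nat \<Rightarrow> nat \<Rightarrow> 'n::finite config \<Rightarrow> bool" where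
  "straight_start a k L x \<longleftrightarrow>
     straight_spine L (fst (snd x)) \<and> straight_walk a k L (fst x) \<and> straight_increments a L (snd (snd x))"

lemma pred_straight_start [measurable]: "Measurable.pred (joint_measure \<mu>) (straight_start a k L)"
  unfolding straight_start_def by measurable

text \<open>The root is added to the past here, so that a return of the walk to its position at time \<open>k\<close>
counts as a collision with the root.\<close>

definition collides :: "nat \<Rightarrow> nat list \<Rightarrow> nat \<Rightarrow> 'n::finite config \<Rightarrow> bool" where
  "collides k u i x \<longleftrightarrow>
     u \<in> insert [] (past (fst (snd x))) \<and> tree_walk 0 (snd (snd x)) u = displacement (fst x) k i"

lemma pred_collides [measurable]: "Measurable.pred (joint_measure \<mu>) (collides k u i)"
proof -
  have [measurable]: "Measurable.pred (tree_measure \<mu>) (\<lambda>t. u \<in> insert [] (past t))"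
    by (cases "u = []") auto
  show ?thesis unfolding collides_def by measurable
qed

definition collision_constant :: "nat \<Rightarrow> real" where
  "collision_constant d = (2 * real d) powr (7/2) * 2 powr (13/4)"

lemma collision_constant_nonneg: "0 \<le> collision_constant d"
  by (simp add: collision_constant_def)

context
  fixes \<mu> :: "nat pmf" and a :: "'n::finite"
  assumes crit: "critical_offspring_law \<mu>" and dim: "CARD('n) \<ge> 7"
begin

lemma emeasure_straight_start:
  assumes "L \<le> k"
  shows "emeasure (joint_measure \<mu>) {x. straight_start a k L x}
    = ennreal (straight_spine_prob \<mu> L * (1 / (2 * real CARD('n))) ^ (3 * L))"
proof -
  interpret T: prob_space "tree_measure \<mu>" by (rule prob_space_tree_measure)
  interpret WY: prob_space "walk_measure \<Otimes>\<^sub>M increment_measure :: 'n steps measure"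
    by (rule prob_space_steps)
  have "emeasure (joint_measure \<mu>) {x. straight_spine L (fst (snd x))
      \<and> (straight_walk a k L (fst x) \<and> straight_increments a L (snd (snd x)))}
    = emeasure (tree_measure \<mu>) {t. straight_spine L t} * emeasure (walk_measure \<Otimes>\<^sub>M increment_measure)
        {x. straight_walk a k L (fst x) \<and> straight_increments a L (snd x)}"
    by (rule emeasure_joint_product) measurable
  also have "\<dots> = ennreal (straight_spine_prob \<mu> L)
      * ennreal ((1 / (2 * real CARD('n))) ^ (3 * L))"
    unfolding T.emeasure_eq_measure WY.emeasure_eq_measure prob_straight_steps[OF assms] ..
  finally show ?thesis
    by (simp add: straight_start_def ennreal_mult)
qed

text \<open>Given a straight spine, a vertex of the past starts with letters \<open>0\<close>, so that its walk begins with
the prescribed steps; other vertices contribute a null event.\<close>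

lemma emeasure_collision_le:
  assumes L: "L \<le> k" and R: "R \<le> L \<or> (L = 0 \<and> R \<le> gap k i)" and ui: "u \<noteq> [] \<or> i \<noteq> k"
  shows "emeasure (joint_measure \<mu>) {x. straight_start a k L x \<and> collides k u i x}
    \<le> ennreal (straight_past_prob \<mu> L u
          * (real (length u) + 1) powr (- (17/8)))
      * ennreal ((1 / (2 * real CARD('n))) ^ (3 * L) * collision_constant CARD('n)
          * (real R + 1) powr (- (1/4)) * (real (gap k i) + 1) powr (- (9/8)))"
proof (cases "take (min L (length u)) u = replicate (min L (length u)) 0")
  case False
  have "\<not> (straight_spine L t \<and> u \<in> insert [] (past t))" for t
  proof
    assume t: "straight_spine L t \<and> u \<in> insert [] (past t)"
    then have "u \<in> past t" using False by auto
    then obtain n where "n \<ge> 1" "branches_at t n u" using past_branches by force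
    then have "take (min L (length u)) u = replicate (min L (length u)) 0"
      using t by (intro straight_spine_prefix[where t = t and n = n and L = L]) auto
    then show False using False by simp
  qed
  then have "{x. straight_start a k L x \<and> collides k u i x} = {}"
    by (auto simp: straight_start_def collides_def)
  then show ?thesis by (simp only: emeasure_empty zero_le)
next
  case True
  interpret T: prob_space "tree_measure \<mu>" by (rule prob_space_tree_measure)
  interpret WY: prob_space "walk_measure \<Otimes>\<^sub>M increment_measure :: 'n steps measure"
    by (rule prob_space_steps)
  let ?q = "(1 / (2 * real CARD('n))) ^ (3 * L)"
  let ?A = "\<lambda>t. straight_spine L t \<and> u \<in> insert [] (past t)"
  let ?B = "\<lambda>(\<zeta> :: nat \<Rightarrow> int ^ 'n) (y :: nat list \<Rightarrow> int ^ 'n). straight_walk a k L \<zeta> \<and> straight_increments a L y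
      \<and> tree_walk 0 y u = displacement \<zeta> k i"
  let ?w = "walk_kernel ((length u - L) + (gap k i - L)) (axis a (- int (min (length u) L + min (gap k i) L)) :: int ^ 'n)"
  have mA: "Measurable.pred (tree_measure \<mu>) ?A" by (cases "u = []") auto
  have mB: "Measurable.pred (walk_measure \<Otimes>\<^sub>M increment_measure) (\<lambda>x. ?B (fst x) (snd x))" by measurable
  have "{x. straight_start a k L x \<and> collides k u i x} = {x. ?A (fst (snd x)) \<and> ?B (fst x) (snd (snd x))}"
    by (auto simp: straight_start_def collides_def)
  then have "emeasure (joint_measure \<mu>) {x. straight_start a k L x \<and> collides k u i x}
      = emeasure (tree_measure \<mu>) {t. ?A t} * emeasure (walk_measure \<Otimes>\<^sub>M increment_measure) {x. ?B (fst x) (snd x)}"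
    by (simp only: emeasure_joint_product[OF mA mB])
  also have "\<dots> = ennreal (measure (tree_measure \<mu>) {t. ?A t}) * ennreal (?q * ?w)"
    unfolding T.emeasure_eq_measure WY.emeasure_eq_measure prob_straight_collision[OF L True] ..
  also have "\<dots> \<le> ennreal (measure (tree_measure \<mu>) {t. ?A t})
     * ennreal (?q * (collision_constant CARD('n) * (real R + 1) powr (- (1/4))
         * (real (length u) + 1) powr (- (17/8)) * (real (gap k i) + 1) powr (- (9/8))))"
    using ui by (intro mult_left_mono ennreal_leI walk_kernel_collision_le[OF dim R, folded collision_constant_def]) auto
  also have "\<dots> = ennreal (measure (tree_measure \<mu>) {t. ?A t} * (real (length u) + 1) powr (- (17/8)))
      * ennreal (?q * collision_constant CARD('n) * (real R + 1) powr (- (1/4)) * (real (gap k i) + 1) powr (- (9/8)))"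
    by (subst (1 2) ennreal_mult[symmetric]) (auto simp: mult_ac collision_constant_nonneg)
  finally show ?thesis .
qed

text \<open>Sum over the vertices. The excluded pair, the root at time \<open>k\<close> itself, always coincides.\<close>

lemma emeasure_some_collision_le:
  assumes \<Gamma>: "(\<integral>\<^sup>+u. ennreal (straight_past_prob \<mu> L u
          * (real (length u) + 1) powr (- (17/8))) \<partial>count_space UNIV)
      \<le> ennreal (straight_spine_prob \<mu> L * \<Gamma>)" "\<Gamma> \<ge> 0"
    and L: "L \<le> k" and R: "R \<le> L \<or> (L = 0 \<and> R \<le> gap k i)"
  shows "emeasure (joint_measure \<mu>) {x. \<exists>u. (u \<noteq> [] \<or> i \<noteq> k) \<and> straight_start a k L x \<and> collides k u i x}
    \<le> ennreal (straight_spine_prob \<mu> L * (1 / (2 * real CARD('n))) ^ (3 * L)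
        * (\<Gamma> * collision_constant CARD('n) * (real R + 1) powr (- (1/4))) * (real (gap k i) + 1) powr (- (9/8)))"
proof -
  let ?J = "joint_measure \<mu> :: 'n::finite config measure"
  let ?C = "\<lambda>u. {x. (u \<noteq> [] \<or> i \<noteq> k) \<and> straight_start a k L x \<and> collides k u i x}"
  let ?K = "(1 / (2 * real CARD('n))) ^ (3 * L) * collision_constant CARD('n)
          * (real R + 1) powr (- (1/4)) * (real (gap k i) + 1) powr (- (9/8))"
  let ?f = "\<lambda>u. ennreal (straight_past_prob \<mu> L u
          * (real (length u) + 1) powr (- (17/8)))"
  \<comment> \<open>an enumeration of the vertices without repetition, for countable subadditivity\<close>
  have bij: "bij_betw (list_decode :: nat \<Rightarrow> nat list) UNIV UNIV"
    by (rule bij_list_decode)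
  have meas: "?C u \<in> sets ?J" for u
  proof -
    have "{x\<in>space ?J. (u \<noteq> [] \<or> i \<noteq> k) \<and> straight_start a k L x \<and> collides k u i x} \<in> sets ?J" by measurable
    then show ?thesis by (simp add: space_pair_measure)
  qed
  have "{x. \<exists>u. (u \<noteq> [] \<or> i \<noteq> k) \<and> straight_start a k L x \<and> collides k u i x} = (\<Union>n. ?C (list_decode n))"
    by (auto; metis list_encode_inverse)
  then have "emeasure ?J {x. \<exists>u. (u \<noteq> [] \<or> i \<noteq> k) \<and> straight_start a k L x \<and> collides k u i x}
      \<le> (\<Sum>n. emeasure ?J (?C (list_decode n)))"
    using meas by (simp only:) (rule emeasure_subadditive_countably, auto)
  also have "\<dots> = (\<integral>\<^sup>+n. emeasure ?J (?C (list_decode n)) \<partial>count_space UNIV)"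
    by (rule nn_integral_count_space_nat[symmetric])
  also have "\<dots> = (\<integral>\<^sup>+u. emeasure ?J (?C u) \<partial>count_space UNIV)"
    by (rule nn_integral_bij_count_space[OF bij])
  also have "\<dots> \<le> (\<integral>\<^sup>+u. ?f u * ennreal ?K \<partial>count_space UNIV)"
  proof (rule nn_integral_mono)
    fix u :: "nat list"
    show "emeasure ?J (?C u) \<le> ?f u * ennreal ?K"
    proof (cases "u \<noteq> [] \<or> i \<noteq> k")
      case True
      then show ?thesis using emeasure_collision_le[OF L R True] by simp
    qed auto
  qed
  also have "\<dots> = (\<integral>\<^sup>+u. ?f u \<partial>count_space UNIV) * ennreal ?K"
    by (rule nn_integral_multc) simp
  also have "\<dots> \<le> ennreal (straight_spine_prob \<mu> L * \<Gamma>) * ennreal ?K"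
    by (rule mult_right_mono[OF \<Gamma>(1)]) simp
  also have "\<dots> = ennreal (straight_spine_prob \<mu> L * (1 / (2 * real CARD('n))) ^ (3 * L)
        * (\<Gamma> * collision_constant CARD('n) * (real R + 1) powr (- (1/4))) * (real (gap k i) + 1) powr (- (9/8)))"
    using \<Gamma>(2) by (subst ennreal_mult[symmetric]) (auto simp: mult_ac collision_constant_nonneg)
  finally show ?thesis .
qed

end

lemma sum_gap_powr_le:
  assumes "finite I"
  shows "(\<Sum>i\<in>I. (real (gap k i) + 1) powr (- (9/8))) \<le> 2 * (\<Sum>j. (real j + 1) powr (- (9/8)))"
proof -
  let ?w = "\<lambda>j::nat. (real j + 1) powr (- (9/8))"
  have "summable (\<lambda>l. real l powr (- (9/8)))" by (subst summable_real_powr_iff) simp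
  then have "summable (\<lambda>l. real (Suc l) powr (- (9/8)))" by (subst summable_Suc_iff)
  then have w: "summable ?w" by (simp add: add.commute)
  have side: "(\<Sum>i\<in>D. ?w (gap k i)) \<le> (\<Sum>j. ?w j)" if "finite D" "inj_on (gap k) D" for D
  proof -
    have "(\<Sum>i\<in>D. ?w (gap k i)) = (\<Sum>j\<in>gap k ` D. ?w j)"
      using that by (subst sum.reindex) auto
    also have "\<dots> \<le> (\<Sum>j. ?w j)" using that w by (intro sum_le_suminf) auto
    finally show ?thesis .
  qed
  have "(\<Sum>i\<in>I. ?w (gap k i)) = (\<Sum>i\<in>I \<inter> {k..}. ?w (gap k i)) + (\<Sum>i\<in>I - {k..}. ?w (gap k i))"
    using assms by (rule sum.Int_Diff)
  moreover have "(\<Sum>i\<in>I \<inter> {k..}. ?w (gap k i)) \<le> (\<Sum>j. ?w j)"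
    using assms by (intro side) (auto simp: inj_on_def)
  moreover have "(\<Sum>i\<in>I - {k..}. ?w (gap k i)) \<le> (\<Sum>j. ?w j)"
    using assms by (intro side) (auto simp: inj_on_def)
  ultimately show ?thesis by simp
qed

text \<open>With \<open>L = 0\<close> nothing is conditioned, and this controls the loss from enlarging the window
from \<open>I\<close> to \<open>J\<close>. With \<open>I = {}\<close> and \<open>R = L\<close> it bounds from below the conditional probability of no
collision at all after a straight start.\<close>

lemma collision_estimate:
  fixes a :: "'n::finite"
  assumes crit: "critical_offspring_law \<mu>" and dim: "CARD('n) \<ge> 7"
  obtains B :: real where "B > 0"
    "\<And>L k R I J. finite J \<Longrightarrow> I \<subseteq> J \<Longrightarrow> L \<le> k \<Longrightarrow>
        (\<And>i. i \<in> J - I \<Longrightarrow> R \<le> L \<or> (L = 0 \<and> R \<le> gap k i)) \<Longrightarrow>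
      emeasure (joint_measure \<mu>) {x. straight_start a k L x \<and> no_collision k I x}
      \<le> emeasure (joint_measure \<mu>) {x. straight_start a k L x \<and> no_collision k J x}
        + ennreal (straight_spine_prob \<mu> L * (1 / (2 * real CARD('n))) ^ (3 * L)
            * (B * (real R + 1) powr (- (1/4))))"
proof -
  obtain \<Gamma> :: real where \<Gamma>: "\<Gamma> > 0"
    "\<And>L. (\<integral>\<^sup>+u. ennreal (straight_past_prob \<mu> L u
          * (real (length u) + 1) powr (- (17/8))) \<partial>count_space UNIV)
      \<le> ennreal (straight_spine_prob \<mu> L * \<Gamma>)"
    by (rule past_weight_bound[OF crit]) blast
  define Z where "Z = 2 * (\<Sum>j. (real j + 1) powr (- (9/8)))"
  have "1 \<le> Z" using sum_gap_powr_le[of "{0}" 0] by (simp add: Z_def)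
  define c where "c = collision_constant CARD('n)"
  have c: "c > 0" by (simp add: c_def collision_constant_def)
  show ?thesis
  proof (rule that[of "\<Gamma> * c * Z"])
    show "\<Gamma> * c * Z > 0" using \<Gamma>(1) c \<open>1 \<le> Z\<close> by simp
    fix L k R :: nat and I J :: "nat set"
    assume J: "finite J" "I \<subseteq> J" and L: "L \<le> k"
      and R: "\<And>i. i \<in> J - I \<Longrightarrow> R \<le> L \<or> (L = 0 \<and> R \<le> gap k i)"
    let ?J = "joint_measure \<mu> :: 'n::finite config measure"
    let ?N = "\<lambda>I. {x. straight_start a k L x \<and> no_collision k I x}"
    let ?P = "straight_spine_prob \<mu> L * (1 / (2 * real CARD('n))) ^ (3 * L)"
    let ?C = "\<lambda>i. {x. \<exists>u. (u \<noteq> [] \<or> i \<noteq> k) \<and> straight_start a k L x \<and> collides k u i x}"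
    have sub: "?N I \<subseteq> ?N J \<union> (\<Union>i\<in>J - I. ?C i)"
    proof
      fix x assume x: "x \<in> ?N I"
      show "x \<in> ?N J \<union> (\<Union>i\<in>J - I. ?C i)"
      proof (cases "no_collision k J x")
        case False
        then consider i where "i \<in> J" "k < i" "displacement (fst x) k i = 0"
          | u i where "u \<in> past (fst (snd x))" "i \<in> J" "tree_walk 0 (snd (snd x)) u = displacement (fst x) k i"
          unfolding no_collision_def by blast
        then show ?thesis
        proof cases
          case 1
          then have "i \<in> J - I" using x by (auto simp: no_collision_def)
          moreover have "x \<in> ?C i" using x 1
            by (auto simp: collides_def tree_walk_def intro!: exI[of _ "[]"])
          ultimately show ?thesis by blast
        next
          case 2
          then have "i \<in> J - I" using x by (auto simp: no_collision_def)
          moreover have "u \<noteq> []" using past_branches[OF 2(1)] by auto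
          then have "x \<in> ?C i" using x 2 by (auto simp: collides_def)
          ultimately show ?thesis by blast
        qed
      qed (use x in auto)
    qed
    have mC: "?C i \<in> sets ?J" for i
    proof -
      have "{x\<in>space ?J. \<exists>u. (u \<noteq> [] \<or> i \<noteq> k) \<and> straight_start a k L x \<and> collides k u i x} \<in> sets ?J" by measurable
      then show ?thesis by (simp add: space_pair_measure)
    qed
    have mN: "?N J \<in> sets ?J"
    proof -
      have [measurable]: "Measurable.pred ?J (\<lambda>x. no_collision k J x)"
        by (rule pred_no_collision[OF J(1)])
      have "{x\<in>space ?J. straight_start a k L x \<and> no_collision k J x} \<in> sets ?J" by measurable
      then show ?thesis by (simp add: space_pair_measure)
    qed
    have fin: "finite (J - I)" using J by auto
    have "emeasure ?J (?N I) \<le> emeasure ?J (?N J \<union> (\<Union>i\<in>J - I. ?C i))"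
      using sub mN mC fin by (intro emeasure_mono) auto
    also have "\<dots> \<le> emeasure ?J (?N J) + emeasure ?J (\<Union>i\<in>J - I. ?C i)"
      using mN mC fin by (intro emeasure_subadditive) auto
    also have "emeasure ?J (\<Union>i\<in>J - I. ?C i) \<le> (\<Sum>i\<in>J - I. emeasure ?J (?C i))"
      using mC fin by (intro emeasure_subadditive_finite) auto
    also have "\<dots> \<le> (\<Sum>i\<in>J - I. ennreal (?P * (\<Gamma> * c * (real R + 1) powr (- (1/4))) * (real (gap k i) + 1) powr (- (9/8))))"
      unfolding c_def using \<Gamma>(1)
      by (intro sum_mono emeasure_some_collision_le[OF crit dim \<Gamma>(2) _ L R]) auto
    also have "\<dots> = ennreal (\<Sum>i\<in>J - I. ?P * (\<Gamma> * c * (real R + 1) powr (- (1/4))) * (real (gap k i) + 1) powr (- (9/8)))"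
      using \<Gamma>(1) c by (intro sum_ennreal) auto
    also have "\<dots> \<le> ennreal (?P * (\<Gamma> * c * (real R + 1) powr (- (1/4))) * Z)"
      unfolding sum_distrib_left[symmetric] Z_def using \<Gamma>(1) c
      by (intro ennreal_leI mult_left_mono sum_gap_powr_le fin) auto
    also have "?P * (\<Gamma> * c * (real R + 1) powr (- (1/4))) * Z = ?P * (\<Gamma> * c * Z * (real R + 1) powr (- (1/4)))"
      by (simp only: mult_ac)
    finally show "emeasure ?J (?N I) \<le> emeasure ?J (?N J) + ennreal (?P * (\<Gamma> * c * Z * (real R + 1) powr (- (1/4))))"
      by (simp add: add_left_mono)
  qed
qed

section \<open>Mean escape probabilities and their limit\<close>

lemma iid_steps_shift:
  fixes Y :: "nat \<Rightarrow> 'b \<Rightarrow> int ^ 'n"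
  assumes "iid_steps N Y"
  shows "iid_steps N (\<lambda>i. Y (i + p))"
proof -
  interpret iid_steps N Y by fact
  show ?thesis
  proof
    show "Y (i + p) \<in> measurable N (count_space UNIV)" for i by measurable
    fix E and e :: "nat \<Rightarrow> int ^ 'n" assume E: "finite E" "e \<in> E \<rightarrow> lattice_neighbors"
    have "prob {\<omega>\<in>space N. \<forall>i\<in>(\<lambda>i. i + p) ` E. Y i \<omega> = e (i - p)} = (1 / (2 * real CARD('n))) ^ card ((\<lambda>i. i + p) ` E)"
      using E by (intro prob_cylinder) auto
    then show "prob {\<omega>\<in>space N. \<forall>i\<in>E. Y (i + p) \<omega> = e i} = (1 / (2 * real CARD('n))) ^ card E"
      by (simp add: card_image)
  qed
qed

lemma displacement_cong:
  assumes "\<And>j. j \<in> {p..<q} \<Longrightarrow> \<zeta> j = \<xi> j" "i \<in> {p..q}" "k \<in> {p..q}"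
  shows "displacement \<zeta> k i = displacement \<xi> k i"
  using assms unfolding displacement_def by (auto intro!: sum.cong)

lemma window_escape_cong:
  assumes \<zeta>: "\<And>j. j \<in> {p..<q} \<Longrightarrow> \<zeta> j = \<xi> j" and k: "k \<in> {p..q}"
  shows "window_escape \<mu> k {p..q} \<zeta> = window_escape \<mu> k {p..q} \<xi>"
proof -
  have D: "displacement \<zeta> k i = displacement \<xi> k i" if "i \<in> {p..q}" for i
    using \<zeta> that k by (rule displacement_cong)
  then have "displacement \<zeta> k ` {p..q} = displacement \<xi> k ` {p..q}" by (intro image_cong refl)
  then show ?thesis unfolding window_escape_def using D by (metis (mono_tags, lifting))
qed

lemma displacement_shift:
  "displacement \<zeta> (k + p) (i + p) = displacement (\<lambda>j. \<zeta> (j + p)) k i"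
  by (simp add: displacement_def sum.shift_bounds_nat_ivl)

lemma window_escape_shift:
  assumes "p \<le> k" "k \<le> q"
  shows "window_escape \<mu> k {p..q} \<zeta> = window_escape \<mu> (k - p) {0..q - p} (\<lambda>i. \<zeta> (i + p))"
proof -
  have I: "{p..q} = (\<lambda>i. i + p) ` {0..q - p}" using assms by simp
  have D: "displacement \<zeta> k (i + p) = displacement (\<lambda>i. \<zeta> (i + p)) (k - p) i" for i
    using displacement_shift[of \<zeta> "k - p" p i] assms by simp
  have "displacement \<zeta> k ` {p..q} = displacement (\<lambda>i. \<zeta> (i + p)) (k - p) ` {0..q - p}"
    unfolding I image_image D ..
  moreover have "(\<forall>i\<in>{p..q}. k < i \<longrightarrow> displacement \<zeta> k i \<noteq> 0)
      \<longleftrightarrow> (\<forall>i\<in>{0..q - p}. k - p < i \<longrightarrow> displacement (\<lambda>i. \<zeta> (i + p)) (k - p) i \<noteq> 0)"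
  proof -
    have "k < i + p \<longleftrightarrow> k - p < i" for i using assms by arith
    moreover have "(\<forall>i\<in>{p..q}. Q i) \<longleftrightarrow> (\<forall>i\<in>{0..q - p}. Q (i + p))" for Q
      unfolding I by blast
    ultimately show ?thesis by (simp only: D)
  qed
  ultimately show ?thesis unfolding window_escape_def by (simp only:)
qed

definition escape_mean :: "'n::finite itself \<Rightarrow> nat pmf \<Rightarrow> nat \<Rightarrow> nat \<Rightarrow> real" where
  "escape_mean _ \<mu> a b =
     (\<integral>\<zeta>. window_escape \<mu> a {0..a + b} \<zeta> \<partial>(walk_measure :: (nat \<Rightarrow> int ^ 'n) measure))"

lemma measurable_window_escape:
  fixes Y :: "nat \<Rightarrow> 'b \<Rightarrow> int ^ 'n"
  assumes Y: "iid_steps N Y" and k: "k \<in> {p..q}"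
  shows "(\<lambda>\<omega>. window_escape \<mu> k {p..q} (\<lambda>i. Y i \<omega>)) \<in> borel_measurable N"
proof -
  interpret iid_steps N Y by fact
  show ?thesis
    by (rule measurable_finitely_determined[of "{p..<q}"]) (auto intro!: window_escape_cong k)
qed

text \<open>Stationarity: only the extent of the window to the left and to the right of \<open>k\<close> matters.
Because a window involves finitely many steps, this holds on every probability space that
carries the walk.\<close>

lemma expectation_window_escape:
  fixes Y :: "nat \<Rightarrow> 'b \<Rightarrow> int ^ 'n"
  assumes Y: "iid_steps N Y" and k: "p \<le> k" "k \<le> q"
  shows "(\<integral>\<omega>. window_escape \<mu> k {p..q} (\<lambda>i. Y i \<omega>) \<partial>N) = escape_mean TYPE('n) \<mu> (k - p) (q - k)"
proof -
  have one: "(\<integral>\<omega>. window_escape \<mu> (k - p) {0..q - p} (\<lambda>i. Z i \<omega>) \<partial>K)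
      = (1 / (2 * real CARD('n))) ^ card {0..<q - p}
        * (\<Sum>g\<in>PiE {0..<q - p} (\<lambda>_. lattice_neighbors :: (int ^ 'n) set). window_escape \<mu> (k - p) {0..q - p} g)"
    if Z: "iid_steps K Z" for K and Z :: "nat \<Rightarrow> 'c \<Rightarrow> int ^ 'n"
  proof -
    interpret Z: iid_steps K Z by (rule Z)
    show ?thesis
      using k by (intro Z.expectation_finitely_determined window_escape_cong) auto
  qed
  have "(\<integral>\<omega>. window_escape \<mu> k {p..q} (\<lambda>i. Y i \<omega>) \<partial>N)
      = (\<integral>\<omega>. window_escape \<mu> (k - p) {0..q - p} (\<lambda>i. Y (i + p) \<omega>) \<partial>N)"
    unfolding window_escape_shift[OF k] ..
  also have "\<dots> = (\<integral>\<zeta>. window_escape \<mu> (k - p) {0..q - p} \<zeta> \<partial>(walk_measure :: (nat \<Rightarrow> int ^ 'n) measure))"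
    using one[OF iid_steps_shift[OF Y]] one[OF iid_steps_walk_measure] by simp
  finally show ?thesis using k by (simp add: escape_mean_def)
qed

lemma integrable_window_escape:
  fixes Y :: "nat \<Rightarrow> 'b \<Rightarrow> int ^ 'n"
  assumes Y: "iid_steps N Y" and k: "k \<in> {p..q}"
  shows "integrable N (\<lambda>\<omega>. window_escape \<mu> k {p..q} (\<lambda>i. Y i \<omega>))"
proof -
  interpret iid_steps N Y by fact
  show ?thesis
    using measurable_window_escape[OF Y k]
    by (intro integrable_const_bound[where B = 1])
      (auto simp: window_escape_nonneg window_escape_le_1)
qed

lemma escape_mean_antimono:
  assumes "a \<le> a'" "b \<le> b'"
  shows "escape_mean TYPE('n::finite) \<mu> a' b' \<le> escape_mean TYPE('n) \<mu> a b"
proof -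
  let ?W = "walk_measure :: (nat \<Rightarrow> int ^ 'n) measure"
  have "escape_mean TYPE('n) \<mu> a' b' = (\<integral>\<zeta>. window_escape \<mu> a' {0..a' + b'} (\<lambda>i. \<zeta> i) \<partial>?W)"
    by (simp add: escape_mean_def)
  also have "\<dots> \<le> (\<integral>\<zeta>. window_escape \<mu> a' {a' - a..a' + b} (\<lambda>i. \<zeta> i) \<partial>?W)"
    using assms
    by (intro integral_mono integrable_window_escape[OF iid_steps_walk_measure] window_escape_antimono) auto
  also have "\<dots> = escape_mean TYPE('n) \<mu> (a' - (a' - a)) (a' + b - a')"
    by (rule expectation_window_escape[OF iid_steps_walk_measure]) auto
  finally show ?thesis using assms by simp
qed

lemma escape_mean_nonneg: "0 \<le> escape_mean TYPE('n::finite) \<mu> a b"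
  unfolding escape_mean_def by (intro integral_nonneg_AE) (simp add: window_escape_nonneg)

lemma ennreal_escape_mean:
  fixes \<mu> :: "nat pmf"
  assumes k: "p \<le> k" "k \<le> q"
  shows "emeasure (joint_measure \<mu>)
      {x :: 'n::finite config. no_collision k {p..q} x}
    = ennreal (escape_mean TYPE('n) \<mu> (k - p) (q - k))"
proof -
  have "emeasure (joint_measure \<mu>)
      {x :: 'n::finite config. no_collision k {p..q} x}
    = (\<integral>\<^sup>+\<zeta>. ennreal (window_escape \<mu> k {p..q} \<zeta>) \<partial>(walk_measure :: (nat \<Rightarrow> int ^ 'n) measure))"
    by (rule nn_integral_window_escape[symmetric]) simp
  also have "\<dots> = ennreal (\<integral>\<zeta>. window_escape \<mu> k {p..q} (\<lambda>i. \<zeta> i) \<partial>(walk_measure :: (nat \<Rightarrow> int ^ 'n) measure))"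
    using integrable_window_escape[OF iid_steps_walk_measure, of k p q \<mu>] k
    by (intro nn_integral_eq_integral) (auto simp: window_escape_nonneg)
  also have "(\<integral>\<zeta>. window_escape \<mu> k {p..q} (\<lambda>i. \<zeta> i) \<partial>(walk_measure :: (nat \<Rightarrow> int ^ 'n) measure))
      = escape_mean TYPE('n) \<mu> (k - p) (q - k)"
    by (rule expectation_window_escape[OF iid_steps_walk_measure k])
  finally show ?thesis .
qed

text \<open>The limit of the decreasing sequence of mean escape probabilities in the windows
\<open>[k - m, k + m]\<close> is approached at the rate at which distant collisions disappear, and it is positive
because a straight start leaves less than half a collision in the mean.\<close>

lemma escape_mean_limit:
  assumes crit: "critical_offspring_law \<mu>" and dim: "CARD('n::finite) \<ge> 7"
  obtains c B :: real where "c > 0" "B > 0"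
    "\<And>m. c \<le> escape_mean TYPE('n) \<mu> m m"
    "\<And>m. escape_mean TYPE('n) \<mu> m m \<le> c + B * (real m + 1) powr (- (1/4))"
    "\<And>a b m. escape_mean TYPE('n) \<mu> (min a m) (min b m)
        \<le> escape_mean TYPE('n) \<mu> a b + B * (real m + 1) powr (- (1/4))"
proof -
  let ?e = "escape_mean TYPE('n) \<mu>"
  let ?J = "joint_measure \<mu> :: 'n::finite config measure"
  let ?N = "\<lambda>k I. {x :: 'n::finite config. no_collision k I x}"
  \<comment> \<open>the direction of the straight starts; all directions are equivalent\<close>
  obtain dir :: 'n where True by simp
  obtain B :: real where B: "B > 0"
    and est: "\<And>L k R I J. finite J \<Longrightarrow> I \<subseteq> J \<Longrightarrow> L \<le> k \<Longrightarrow>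
        (\<And>i. i \<in> J - I \<Longrightarrow> R \<le> L \<or> (L = 0 \<and> R \<le> gap k i)) \<Longrightarrow>
      emeasure ?J {x. straight_start dir k L x \<and> no_collision k I x}
      \<le> emeasure ?J {x. straight_start dir k L x \<and> no_collision k J x}
        + ennreal (straight_spine_prob \<mu> L * (1 / (2 * real CARD('n))) ^ (3 * L)
            * (B * (real R + 1) powr (- (1/4))))"
    by (rule collision_estimate[OF crit dim, where a = dir]) blast
  have trunc: "?e (min a m) (min b m) \<le> ?e a b + B * (real m + 1) powr (- (1/4))" for a b m
  proof -
    interpret T: prob_space "tree_measure \<mu>" by (rule prob_space_tree_measure)
    \<comment> \<open>for \<open>L = 0\<close> the straight start is no condition\<close>
    have S: "straight_start dir a 0 x" for x
      by (simp add: straight_start_def straight_spine_def straight_words_def straight_walk_def straight_increments_def)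
    have P: "measure (tree_measure \<mu>) {t. straight_spine 0 t} = 1"
      using T.prob_space by (simp add: straight_spine_def straight_words_def)
    have "m \<le> 0 \<or> (0 = (0::nat) \<and> m \<le> gap a i)" if "i \<in> {0..a + b} - {a - m..min (a + b) (a + m)}" for i
      using that by auto
    from est[of "{0..a + b}" "{a - m..min (a + b) (a + m)}" 0 a m, OF _ _ _ this]
    have "emeasure ?J (?N a {a - m..min (a + b) (a + m)})
      \<le> emeasure ?J (?N a {0..a + b}) + ennreal (B * (real m + 1) powr (- (1/4)))"
      by (simp add: S P)
    then have "ennreal (?e (a - (a - m)) (min (a + b) (a + m) - a))
        \<le> ennreal (?e (a - 0) (a + b - a)) + ennreal (B * (real m + 1) powr (- (1/4)))"
      by (subst (asm) (1 2) ennreal_escape_mean) auto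
    moreover have "a - (a - m) = min a m" "min (a + b) (a + m) - a = min b m" by auto
    ultimately show ?thesis
      using B by (simp add: escape_mean_nonneg flip: ennreal_plus)
  qed
  obtain L \<delta> where \<delta>: "\<delta> > 0" and pos: "\<And>a b. L \<le> a \<Longrightarrow> \<delta> \<le> ?e a b"
  proof -
    have "((\<lambda>L. B * (real L + 1) powr (- (1/4))) \<longlongrightarrow> B * 0) at_top"
      by (intro tendsto_mult tendsto_const tendsto_neg_powr
          filterlim_at_top_mono[OF filterlim_real_sequentially]) auto
    then have "\<forall>\<^sub>F L in sequentially. B * (real L + 1) powr (- (1/4)) < 1 / 2"
      by (intro order_tendstoD) auto
    then obtain L where L: "B * (real L + 1) powr (- (1/4)) < 1 / 2"
      by (meson eventually_happens trivial_limit_sequentially)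
    let ?P = "straight_spine_prob \<mu> L * (1 / (2 * real CARD('n))) ^ (3 * L)"
    have P: "?P > 0" using prob_straight_spine_pos[OF crit, of L] by simp
    have "?P / 2 \<le> ?e a b" if a: "L \<le> a" for a b
    proof -
      have "ennreal ?P = emeasure ?J {x. straight_start dir a L x \<and> no_collision a {} x}"
        by (subst emeasure_straight_start[OF crit dim a, symmetric]) (simp add: no_collision_def)
      also have "\<dots> \<le> emeasure ?J {x. straight_start dir a L x \<and> no_collision a {0..a + b} x}
          + ennreal (?P * (B * (real L + 1) powr (- (1/4))))"
        using a by (intro est) auto
      also have "\<dots> \<le> emeasure ?J (?N a {0..a + b}) + ennreal (?P * (1 / 2))"
      proof (intro add_mono emeasure_mono ennreal_leI mult_left_mono)
        have [measurable]: "Measurable.pred ?J (\<lambda>x. no_collision a {0..a + b} x)"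
          by (rule pred_no_collision) simp
        have "{x\<in>space ?J. no_collision a {0..a + b} x} \<in> sets ?J"
          by measurable
        then show "?N a {0..a + b} \<in> sets ?J" by (simp add: space_pair_measure)
      qed (use L P in auto)
      also have "emeasure ?J (?N a {0..a + b}) = ennreal (?e a b)"
        by (subst ennreal_escape_mean) auto
      finally have "?P \<le> ?e a b + ?P * (1 / 2)"
        using P by (simp add: escape_mean_nonneg flip: ennreal_plus)
      then show ?thesis by simp
    qed
    then show ?thesis using P by (intro that[of "?P / 2" L]) auto
  qed
  define c where "c = (INF m. ?e m m)"
  have bdd: "bdd_below (range (\<lambda>m. ?e m m))"
    by (rule bdd_belowI[of _ 0]) (auto simp: escape_mean_nonneg)
  have lower: "?e m m - B * (real m + 1) powr (- (1/4)) \<le> ?e m' m'" for m m'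
  proof (cases "m \<le> m'")
    case True
    then show ?thesis using trunc[of m' m m'] by simp
  next
    case False
    then have "?e m m \<le> ?e m' m'" by (intro escape_mean_antimono) auto
    moreover have "0 \<le> B * (real m + 1) powr (- (1/4))" using B by simp
    ultimately show ?thesis by linarith
  qed
  have "\<delta> \<le> ?e m m" for m
  proof -
    have "\<delta> \<le> ?e (max m L) (max m L)" by (rule pos) simp
    also have "\<dots> \<le> ?e m m" by (intro escape_mean_antimono) auto
    finally show ?thesis .
  qed
  then have "\<delta> \<le> c" unfolding c_def by (intro cINF_greatest) auto
  show ?thesis
  proof (rule that[of c B])
    show "c > 0" using \<open>\<delta> \<le> c\<close> \<delta> by simp
    show "B > 0" by fact
    show "c \<le> ?e m m" for m unfolding c_def by (rule cINF_lower[OF bdd]) simp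
    show "?e m m \<le> c + B * (real m + 1) powr (- (1/4))" for m
    proof -
      have "?e m m - B * (real m + 1) powr (- (1/4)) \<le> c"
        unfolding c_def by (rule cINF_greatest) (auto intro: lower)
      then show ?thesis by simp
    qed
    show "?e (min a m) (min b m) \<le> ?e a b + B * (real m + 1) powr (- (1/4))" for a b m by (rule trunc)
  qed
qed

section \<open>Mean square estimates for the capacity\<close>

definition capacity_sum :: "nat pmf \<Rightarrow> nat \<Rightarrow> (nat \<Rightarrow> int ^ 'n) \<Rightarrow> real" where
  "capacity_sum \<mu> n \<zeta> = (\<Sum>k\<le>n. window_escape \<mu> k {0..n} \<zeta>)"

lemma escape_mean_le_1: "escape_mean TYPE('n::finite) \<mu> a b \<le> 1"
proof -
  let ?W = "walk_measure :: (nat \<Rightarrow> int ^ 'n) measure"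
  interpret prob_space ?W by (rule prob_space_walk_measure)
  have "integrable ?W (\<lambda>\<zeta>. window_escape \<mu> a {0..a + b} (\<lambda>i. \<zeta> i))"
    by (rule integrable_window_escape[OF iid_steps_walk_measure]) simp
  then show ?thesis unfolding escape_mean_def
    by (intro integral_le_const) (auto simp: window_escape_le_1)
qed

lemma sum_indicator_real: "finite A \<Longrightarrow> (\<Sum>i\<in>A. indicator B i) = real (card (A \<inter> B))"
  by (simp add: indicator_def sum.If_cases Int_def)

text \<open>Only the pairs at distance less than \<open>r\<close> contribute, at most \<open>2 r + 1\<close> for each \<open>k\<close>.\<close>

lemma second_moment_sum_le:
  fixes g :: "nat \<Rightarrow> 'b \<Rightarrow> real"
  assumes "prob_space N"
    and meas: "\<And>k. k \<le> n \<Longrightarrow> g k \<in> borel_measurable N"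
    and bounded: "\<And>k \<omega>. k \<le> n \<Longrightarrow> \<bar>g k \<omega>\<bar> \<le> 1"
    and uncorrelated: "\<And>k l. k \<le> n \<Longrightarrow> l \<le> n \<Longrightarrow> k + r \<le> l \<Longrightarrow> (\<integral>\<omega>. g k \<omega> * g l \<omega> \<partial>N) = 0"
  shows "integrable N (\<lambda>\<omega>. (\<Sum>k\<le>n. g k \<omega>)\<^sup>2)"
    and "(\<integral>\<omega>. (\<Sum>k\<le>n. g k \<omega>)\<^sup>2 \<partial>N) \<le> (real n + 1) * (2 * real r + 1)"
proof -
  interpret prob_space N by fact
  have prod_le: "\<bar>g k \<omega> * g l \<omega>\<bar> \<le> 1" if "k \<le> n" "l \<le> n" for k l \<omega>
    using mult_mono[OF bounded[OF that(1)] bounded[OF that(2)]] by (simp add: abs_mult)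
  have int: "integrable N (\<lambda>\<omega>. g k \<omega> * g l \<omega>)" if "k \<le> n" "l \<le> n" for k l
    using that prod_le meas by (intro integrable_const_bound[where B = 1]) auto
  have sq: "(\<Sum>k\<le>n. g k \<omega>)\<^sup>2 = (\<Sum>k\<le>n. \<Sum>l\<le>n. g k \<omega> * g l \<omega>)" for \<omega>
    by (simp add: power2_eq_square sum_product)
  show "integrable N (\<lambda>\<omega>. (\<Sum>k\<le>n. g k \<omega>)\<^sup>2)"
    unfolding sq by (intro Bochner_Integration.integrable_sum int) auto
  have "(\<integral>\<omega>. (\<Sum>k\<le>n. g k \<omega>)\<^sup>2 \<partial>N) = (\<Sum>k\<le>n. \<Sum>l\<le>n. \<integral>\<omega>. g k \<omega> * g l \<omega> \<partial>N)"
  proof -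
    have "integrable N (\<lambda>\<omega>. \<Sum>l\<le>n. g k \<omega> * g l \<omega>)" if "k \<le> n" for k
      using int that by (intro Bochner_Integration.integrable_sum) auto
    then have "(\<integral>\<omega>. (\<Sum>k\<le>n. \<Sum>l\<le>n. g k \<omega> * g l \<omega>) \<partial>N) = (\<Sum>k\<le>n. \<integral>\<omega>. (\<Sum>l\<le>n. g k \<omega> * g l \<omega>) \<partial>N)"
      by (intro Bochner_Integration.integral_sum) auto
    also have "\<dots> = (\<Sum>k\<le>n. \<Sum>l\<le>n. \<integral>\<omega>. g k \<omega> * g l \<omega> \<partial>N)"
      using int by (intro sum.cong refl Bochner_Integration.integral_sum) auto
    finally show ?thesis unfolding sq .
  qed
  also have "\<dots> \<le> (\<Sum>k\<le>n. \<Sum>l\<le>n. indicator {k - r..k + r} l)"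
  proof (intro sum_mono)
    fix k l assume kl: "k \<in> {..n}" "l \<in> {..n}"
    show "(\<integral>\<omega>. g k \<omega> * g l \<omega> \<partial>N) \<le> indicator {k - r..k + r} l"
    proof (cases "l \<in> {k - r..k + r}")
      case True
      have "(\<integral>\<omega>. g k \<omega> * g l \<omega> \<partial>N) \<le> 1"
        using int prod_le kl by (intro integral_le_const) (auto simp: abs_le_iff)
      then show ?thesis using True by simp
    next
      case False
      then consider "k + r \<le> l" | "l + r \<le> k" by fastforce
      then have "(\<integral>\<omega>. g k \<omega> * g l \<omega> \<partial>N) = 0"
      proof cases
        case 1
        then show ?thesis using kl by (intro uncorrelated) auto
      next
        case 2
        then have "(\<integral>\<omega>. g l \<omega> * g k \<omega> \<partial>N) = 0" using kl by (intro uncorrelated) auto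
        then show ?thesis by (simp add: mult.commute)
      qed
      then show ?thesis by simp
    qed
  qed
  also have "\<dots> \<le> (\<Sum>k\<le>n. 2 * real r + 1)"
  proof (intro sum_mono)
    fix k
    have "(\<Sum>l\<le>n. indicator {k - r..k + r} l) = real (card ({..n} \<inter> {k - r..k + r}))"
      by (rule sum_indicator_real) simp
    also have "\<dots> \<le> real (card {k - r..k + r})" by (intro of_nat_mono card_mono) auto
    also have "\<dots> \<le> 2 * real r + 1" by simp
    finally show "(\<Sum>l\<le>n. indicator {k - r..k + r} l) \<le> 2 * real r + 1" .
  qed
  finally show "(\<integral>\<omega>. (\<Sum>k\<le>n. g k \<omega>)\<^sup>2 \<partial>N) \<le> (real n + 1) * (2 * real r + 1)" by (simp add: add.commute)
qed

lemma card_boundary_indices: "card {k. k \<le> n \<and> (k < m \<or> n < k + m)} \<le> 2 * m"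
proof -
  have "{k. k \<le> n \<and> (k < m \<or> n < k + m)} \<subseteq> {..<m} \<union> (\<lambda>j. n - j) ` {..<m}"
  proof
    fix k assume k: "k \<in> {k. k \<le> n \<and> (k < m \<or> n < k + m)}"
    show "k \<in> {..<m} \<union> (\<lambda>j. n - j) ` {..<m}"
    proof (cases "k < m")
      case False
      then have "n - k < m" "k = n - (n - k)" using k by auto
      then show ?thesis by blast
    qed simp
  qed
  then have "card {k. k \<le> n \<and> (k < m \<or> n < k + m)} \<le> card ({..<m} \<union> (\<lambda>j. n - j) ` {..<m})"
    by (intro card_mono) auto
  also have "\<dots> \<le> card {..<m} + card ((\<lambda>j. n - j) ` {..<m})" by (rule card_Un_le)
  also have "\<dots> \<le> m + m" using card_image_le[of "{..<m}" "\<lambda>j. n - j"] by simp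
  finally show ?thesis by simp
qed

text \<open>Each term is compared with its truncation to the window of radius \<open>m\<close>, clipped to \<open>{0..n}\<close>. The
three summands account for the truncation (in the random sum and in its mean), for the at most
\<open>2 m\<close> clipped windows, and for the fluctuations of the truncated sum, where
\<open>\<bar>x\<bar> \<le> (x\<^sup>2 / s + s) / 2\<close> turns a second moment into a first moment.\<close>

lemma capacity_sum_L1_estimate:
  fixes Y :: "nat \<Rightarrow> 'b \<Rightarrow> int ^ 'n" and c B s :: real
  assumes Y: "iid_steps N Y" and c: "c > 0" and B: "B > 0" and s: "s > 0"
    and c_le: "\<And>m. c \<le> escape_mean TYPE('n) \<mu> m m"
    and le_c: "\<And>m. escape_mean TYPE('n) \<mu> m m \<le> c + B * (real m + 1) powr (- (1/4))"
    and trunc: "\<And>a b m. escape_mean TYPE('n) \<mu> (min a m) (min b m)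
        \<le> escape_mean TYPE('n) \<mu> a b + B * (real m + 1) powr (- (1/4))"
  shows "integrable N (\<lambda>\<omega>. capacity_sum \<mu> n (\<lambda>i. Y i \<omega>))"
    and "(\<integral>\<omega>. \<bar>capacity_sum \<mu> n (\<lambda>i. Y i \<omega>) - real n * c\<bar> \<partial>N)
      \<le> 2 * (real n + 1) * (B * (real m + 1) powr (- (1/4))) + (2 * real m + 1)
        + ((real n + 1) * (4 * real m + 1) / s + s) / 2"
proof -
  interpret iid_steps N Y by fact
  let ?e = "escape_mean TYPE('n) \<mu>"
  define \<epsilon> where "\<epsilon> = B * (real m + 1) powr (- (1/4))"
  have \<epsilon>: "\<epsilon> \<ge> 0" using B by (simp add: \<epsilon>_def)
  define I where "I = (\<lambda>k. {k - m..min n (k + m)})"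
  define f where "f = (\<lambda>k \<omega>. window_escape \<mu> k {0..n} (\<lambda>i. Y i \<omega>))"
  define h where "h = (\<lambda>k \<omega>. window_escape \<mu> k (I k) (\<lambda>i. Y i \<omega>))"
  \<comment> \<open>the mean of \<open>h k\<close>\<close>
  define \<eta> where "\<eta> = (\<lambda>k. ?e (min k m) (min (n - k) m))"
  have int_f: "integrable N (f k)" and Ef: "expectation (f k) = ?e k (n - k)" if "k \<le> n" for k
    unfolding f_def using integrable_window_escape[OF Y, of k 0 n \<mu>]
      expectation_window_escape[OF Y, of 0 k n \<mu>] that by auto
  have int_h: "integrable N (h k)" and Eh: "expectation (h k) = \<eta> k" if "k \<le> n" for k
  proof -
    show "integrable N (h k)"
      unfolding h_def I_def by (rule integrable_window_escape[OF Y]) (use that in auto)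
    have "k - (k - m) = min k m" "min n (k + m) - k = min (n - k) m" by auto
    then show "expectation (h k) = \<eta> k"
      unfolding h_def I_def \<eta>_def
      using expectation_window_escape[OF Y, of "k - m" k "min n (k + m)" \<mu>] that by simp
  qed
  have f_le_h: "f k \<omega> \<le> h k \<omega>" for k \<omega>
    unfolding f_def h_def I_def by (rule window_escape_antimono) auto
  have \<eta>01: "0 \<le> \<eta> k" "\<eta> k \<le> 1" for k
    by (simp_all add: \<eta>_def escape_mean_nonneg escape_mean_le_1)
  have h01: "0 \<le> h k \<omega>" "h k \<omega> \<le> 1" for k \<omega>
    by (simp_all add: h_def window_escape_nonneg window_escape_le_1)
  show int_cap: "integrable N (\<lambda>\<omega>. capacity_sum \<mu> n (\<lambda>i. Y i \<omega>))"
  proof -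
    have "capacity_sum \<mu> n (\<lambda>i. Y i \<omega>) = (\<Sum>k\<le>n. f k \<omega>)" for \<omega>
      by (simp add: capacity_sum_def f_def)
    moreover have "integrable N (\<lambda>\<omega>. \<Sum>k\<le>n. f k \<omega>)"
      by (rule Bochner_Integration.integrable_sum) (use int_f in auto)
    ultimately show ?thesis by simp
  qed
  define g where "g = (\<lambda>k \<omega>. h k \<omega> - \<eta> k)"
  have g: "integrable N (\<lambda>\<omega>. (\<Sum>k\<le>n. g k \<omega>)\<^sup>2)"
    "(\<integral>\<omega>. (\<Sum>k\<le>n. g k \<omega>)\<^sup>2 \<partial>N) \<le> (real n + 1) * (2 * real (2 * m) + 1)"
  proof -
    have meas: "g k \<in> borel_measurable N" if "k \<le> n" for k
      unfolding g_def using int_h[OF that] by measurable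
    have bnd: "\<bar>g k \<omega>\<bar> \<le> 1" for k \<omega>
      using h01[of k \<omega>] \<eta>01[of k] by (simp add: g_def abs_le_iff)
    have unc: "(\<integral>\<omega>. g k \<omega> * g l \<omega> \<partial>N) = 0" if kl: "k \<le> n" "l \<le> n" "k + 2 * m \<le> l" for k l
    proof -
      have "(\<integral>\<omega>. g k \<omega> * g l \<omega> \<partial>N) = (\<integral>\<omega>. g k \<omega> \<partial>N) * (\<integral>\<omega>. g l \<omega> \<partial>N)"
        unfolding g_def h_def
      proof (rule expectation_mult_disjoint[of "{k - m..<min n (k + m)}" "{l - m..<min n (l + m)}"
            "\<lambda>\<zeta>. window_escape \<mu> k (I k) \<zeta> - \<eta> k" "\<lambda>\<zeta>. window_escape \<mu> l (I l) \<zeta> - \<eta> l"])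
        show "{k - m..<min n (k + m)} \<inter> {l - m..<min n (l + m)} = {}" using kl by auto
        show "window_escape \<mu> k (I k) \<zeta> - \<eta> k = window_escape \<mu> k (I k) \<xi> - \<eta> k"
          if "\<And>i. i \<in> {k - m..<min n (k + m)} \<Longrightarrow> \<zeta> i = \<xi> i" for \<zeta> \<xi>
          unfolding I_def using that kl by (intro arg_cong2[where f = "(-)"] window_escape_cong) auto
        show "window_escape \<mu> l (I l) \<zeta> - \<eta> l = window_escape \<mu> l (I l) \<xi> - \<eta> l"
          if "\<And>i. i \<in> {l - m..<min n (l + m)} \<Longrightarrow> \<zeta> i = \<xi> i" for \<zeta> \<xi>
          unfolding I_def using that kl by (intro arg_cong2[where f = "(-)"] window_escape_cong) auto
      qed auto
      also have "(\<integral>\<omega>. g k \<omega> \<partial>N) = 0"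
        unfolding g_def using int_h Eh kl by (simp add: prob_space)
      finally show ?thesis by simp
    qed
    show "integrable N (\<lambda>\<omega>. (\<Sum>k\<le>n. g k \<omega>)\<^sup>2)"
      "(\<integral>\<omega>. (\<Sum>k\<le>n. g k \<omega>)\<^sup>2 \<partial>N) \<le> (real n + 1) * (2 * real (2 * m) + 1)"
      by (rule second_moment_sum_le[OF prob_space_axioms meas bnd unc]; assumption)+
  qed
  have c1: "c \<le> 1" using c_le[of 0] escape_mean_le_1[where 'n = 'n and \<mu> = \<mu> and a = 0 and b = 0] by simp
  have \<eta>_ge: "c \<le> \<eta> k" for k
  proof -
    have "c \<le> ?e m m" by (rule c_le)
    also have "\<dots> \<le> \<eta> k" unfolding \<eta>_def by (rule escape_mean_antimono) auto
    finally show ?thesis .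
  qed
  have mean: "\<bar>(\<Sum>k\<le>n. \<eta> k) - real n * c\<bar> \<le> (real n + 1) * \<epsilon> + (2 * real m + 1)"
  proof -
    have "(\<Sum>k\<le>n. \<eta> k - c) \<le> (\<Sum>k\<le>n. \<epsilon> + indicator {k. k \<le> n \<and> (k < m \<or> n < k + m)} k)"
    proof (rule sum_mono)
      fix k assume k: "k \<in> {..n}"
      show "\<eta> k - c \<le> \<epsilon> + indicator {k. k \<le> n \<and> (k < m \<or> n < k + m)} k"
      proof (cases "k < m \<or> n < k + m")
        case True
        have "\<eta> k - c \<le> 1" using \<eta>01(2)[of k] c by linarith
        then show ?thesis using True k \<epsilon> by simp
      next
        case False
        then have "min k m = m" "min (n - k) m = m" using k by auto
        then show ?thesis using le_c[of m] False by (simp add: \<eta>_def \<epsilon>_def)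
      qed
    qed
    also have "\<dots> = (real n + 1) * \<epsilon> + real (card {k. k \<le> n \<and> (k < m \<or> n < k + m)})"
    proof -
      have "(\<Sum>k\<le>n. indicator {k. k \<le> n \<and> (k < m \<or> n < k + m)} k) = real (card {k. k \<le> n \<and> (k < m \<or> n < k + m)})"
        by (subst sum_indicator_real) (auto intro!: arg_cong[where f = card])
      then show ?thesis by (simp add: sum.distrib add.commute)
    qed
    also have "\<dots> \<le> (real n + 1) * \<epsilon> + 2 * real m"
      using card_boundary_indices[of n m] by simp
    finally have "(\<Sum>k\<le>n. \<eta> k - c) \<le> (real n + 1) * \<epsilon> + 2 * real m" .
    moreover have "0 \<le> (\<Sum>k\<le>n. \<eta> k - c)" using \<eta>_ge by (intro sum_nonneg) simp
    moreover have "(\<Sum>k\<le>n. \<eta> k) - real n * c = (\<Sum>k\<le>n. \<eta> k - c) + c"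
      by (simp add: sum_subtractf algebra_simps)
    ultimately show ?thesis using c c1 by linarith
  qed
  let ?U = "\<lambda>\<omega>. \<Sum>k\<le>n. h k \<omega> - f k \<omega>"
  have int_U: "integrable N ?U"
    using int_h int_f by (intro Bochner_Integration.integrable_sum Bochner_Integration.integrable_diff) auto
  have EU: "expectation ?U \<le> (real n + 1) * \<epsilon>"
  proof -
    have "expectation ?U = (\<Sum>k\<le>n. \<eta> k - ?e k (n - k))"
      using int_h int_f by (subst Bochner_Integration.integral_sum) (auto simp: Eh Ef)
    also have "\<dots> \<le> (\<Sum>k\<le>n. \<epsilon>)"
    proof (rule sum_mono)
      fix k assume "k \<in> {..n}"
      show "\<eta> k - ?e k (n - k) \<le> \<epsilon>"
        using trunc[of k m "n - k"] unfolding \<eta>_def \<epsilon>_def by linarith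
    qed
    finally show ?thesis by (simp add: add.commute)
  qed
  let ?V = "\<lambda>\<omega>. (\<Sum>k\<le>n. g k \<omega>)\<^sup>2"
  have young: "\<bar>x\<bar> \<le> (x\<^sup>2 / s + s) / 2" for x :: real
  proof -
    have "0 \<le> (\<bar>x\<bar> - s)\<^sup>2" by simp
    then have "2 * s * \<bar>x\<bar> \<le> x\<^sup>2 + s\<^sup>2" by (simp add: power2_diff mult_ac)
    then have "2 * s * \<bar>x\<bar> / s \<le> (x\<^sup>2 + s\<^sup>2) / s" using s by (intro divide_right_mono) auto
    then show ?thesis using s by (simp add: add_divide_distrib power2_eq_square)
  qed
  have "(\<integral>\<omega>. \<bar>capacity_sum \<mu> n (\<lambda>i. Y i \<omega>) - real n * c\<bar> \<partial>N)
      \<le> (\<integral>\<omega>. ?U \<omega> + (?V \<omega> / s + s) / 2 + \<bar>(\<Sum>k\<le>n. \<eta> k) - real n * c\<bar> \<partial>N)"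
  proof (rule integral_mono)
    show "integrable N (\<lambda>\<omega>. \<bar>capacity_sum \<mu> n (\<lambda>i. Y i \<omega>) - real n * c\<bar>)"
      using int_cap by auto
    show "integrable N (\<lambda>\<omega>. ?U \<omega> + (?V \<omega> / s + s) / 2 + \<bar>(\<Sum>k\<le>n. \<eta> k) - real n * c\<bar>)"
      using int_U g(1) by auto
    fix \<omega>
    have "capacity_sum \<mu> n (\<lambda>i. Y i \<omega>) - real n * c
        = - ?U \<omega> + (\<Sum>k\<le>n. g k \<omega>) + ((\<Sum>k\<le>n. \<eta> k) - real n * c)"
      by (simp add: capacity_sum_def f_def g_def sum_subtractf)
    moreover have "0 \<le> ?U \<omega>" using f_le_h by (intro sum_nonneg) simp
    ultimately show "\<bar>capacity_sum \<mu> n (\<lambda>i. Y i \<omega>) - real n * c\<bar>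
        \<le> ?U \<omega> + (?V \<omega> / s + s) / 2 + \<bar>(\<Sum>k\<le>n. \<eta> k) - real n * c\<bar>"
      using young[of "\<Sum>k\<le>n. g k \<omega>"] by linarith
  qed
  also have "\<dots> = expectation ?U + (expectation ?V / s + s) / 2 + \<bar>(\<Sum>k\<le>n. \<eta> k) - real n * c\<bar>"
    using int_U g(1) by (simp add: prob_space)
  also have "\<dots> \<le> (real n + 1) * \<epsilon> + ((real n + 1) * (4 * real m + 1) / s + s) / 2
      + ((real n + 1) * \<epsilon> + (2 * real m + 1))"
    using EU g(2) mean s by (intro add_mono divide_right_mono) auto
  finally show "(\<integral>\<omega>. \<bar>capacity_sum \<mu> n (\<lambda>i. Y i \<omega>) - real n * c\<bar> \<partial>N)
      \<le> 2 * (real n + 1) * (B * (real m + 1) powr (- (1/4))) + (2 * real m + 1)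
        + ((real n + 1) * (4 * real m + 1) / s + s) / 2"
    unfolding \<epsilon>_def[symmetric] mult.assoc by linarith
qed

section \<open>Almost sure convergence\<close>

lemma sum_image_last_visit:
  fixes x :: "nat \<Rightarrow> 'b" and g :: "'b \<Rightarrow> 'c::comm_monoid_add"
  shows "(\<Sum>v\<in>x ` {0..n}. g v) = (\<Sum>k\<le>n. if \<forall>i\<in>{0..n}. k < i \<longrightarrow> x i \<noteq> x k then g (x k) else 0)"
proof -
  define L where "L = {k\<in>{..n}. \<forall>i\<in>{0..n}. k < i \<longrightarrow> x i \<noteq> x k}"
  have "inj_on x L"
  proof (rule inj_onI)
    fix k l assume "k \<in> L" "l \<in> L" "x k = x l"
    then have "\<not> k < l" "\<not> l < k" by (auto simp: L_def)
    then show "k = l" by simp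
  qed
  moreover have "x ` {0..n} = x ` L"
  proof
    show "x ` {0..n} \<subseteq> x ` L"
    proof
      fix v assume "v \<in> x ` {0..n}"
      then obtain k where k: "k \<le> n" "v = x k" by auto
      \<comment> \<open>\<open>v\<close> is represented by its last visit\<close>
      let ?S = "{i. i \<le> n \<and> x i = v}"
      have S: "finite ?S" "?S \<noteq> {}" using k by auto
      have "Max ?S \<in> ?S" using S by (rule Max_in)
      moreover have "i \<le> Max ?S" if "i \<in> ?S" for i using S that by (intro Max_ge) auto
      ultimately have "Max ?S \<in> L" by (fastforce simp: L_def not_le[symmetric])
      then have "x (Max ?S) \<in> x ` L" by (rule imageI)
      then show "v \<in> x ` L" using \<open>Max ?S \<in> ?S\<close> by simp
    qed
  qed (auto simp: L_def)
  ultimately have "(\<Sum>v\<in>x ` {0..n}. g v) = (\<Sum>k\<in>L. g (x k))"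
    by (simp add: sum.reindex)
  also have "\<dots> = (\<Sum>k\<le>n. if \<forall>i\<in>{0..n}. k < i \<longrightarrow> x i \<noteq> x k then g (x k) else 0)"
    unfolding L_def by (rule sum.inter_filter) simp
  finally show ?thesis .
qed

lemma displacement_increments: "displacement (\<lambda>j. x (Suc j) - x j) k i = x i - x k"
  by (simp add: displacement_def sum_Suc_diff')

lemma BCap_walk_range:
  "BCap \<mu> (walk_range X n \<omega>) = capacity_sum \<mu> n (\<lambda>i. X (Suc i) \<omega> - X i \<omega>)"
proof -
  let ?A = "(\<lambda>k. X k \<omega>) ` {0..n}"
  have "BCap \<mu> (walk_range X n \<omega>) = (\<Sum>v\<in>?A. escape_prob \<mu> ((\<lambda>z. z - v) ` ?A))"
    by (simp add: BCap_def walk_range_def escape_prob_translate)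
  also have "\<dots> = (\<Sum>k\<le>n. if \<forall>i\<in>{0..n}. k < i \<longrightarrow> X i \<omega> \<noteq> X k \<omega>
      then escape_prob \<mu> ((\<lambda>z. z - X k \<omega>) ` ?A) else 0)"
    by (rule sum_image_last_visit)
  also have "\<dots> = capacity_sum \<mu> n (\<lambda>i. X (Suc i) \<omega> - X i \<omega>)"
  proof -
    have "displacement (\<lambda>i. X (Suc i) \<omega> - X i \<omega>) k ` {0..n} = (\<lambda>z. z - X k \<omega>) ` ?A" for k
      unfolding image_image by (intro image_cong refl) (rule displacement_increments)
    moreover have "displacement (\<lambda>i. X (Suc i) \<omega> - X i \<omega>) k i = X i \<omega> - X k \<omega>" for k i
      by (rule displacement_increments)
    ultimately show ?thesis
      unfolding capacity_sum_def window_escape_def by (simp only: right_minus_eq)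
  qed
  finally show ?thesis .
qed

text \<open>Subadditivity in its simplest form: enlarging the set lowers the earlier terms, and the new term
is a probability.\<close>

lemma capacity_sum_Suc_le: "capacity_sum \<mu> (Suc n) \<zeta> \<le> capacity_sum \<mu> n \<zeta> + 1"
proof -
  have "capacity_sum \<mu> (Suc n) \<zeta> = (\<Sum>k\<le>n. window_escape \<mu> k {0..Suc n} \<zeta>) + window_escape \<mu> (Suc n) {0..Suc n} \<zeta>"
    by (simp add: capacity_sum_def)
  also have "\<dots> \<le> (\<Sum>k\<le>n. window_escape \<mu> k {0..n} \<zeta>) + 1"
    by (intro add_mono sum_mono window_escape_antimono window_escape_le_1) auto
  finally show ?thesis by (simp add: capacity_sum_def)
qed

text \<open>A sequence with increments at most \<open>1\<close> is squeezed between its values at the two neighbouring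
powers: it cannot rise by more than the gap after the first, and if it were too low it could not
climb back before the second. The gaps are negligible because consecutive powers are
asymptotically equal.\<close>

lemma tendsto_along_powers:
  fixes f :: "nat \<Rightarrow> real"
  assumes step: "\<And>n. f (Suc n) \<le> f n + 1" and p: "p > 0"
    and conv: "(\<lambda>j. f (j ^ p) / real (j ^ p)) \<longlonglongrightarrow> c"
  shows "(\<lambda>n. f n / real n) \<longlonglongrightarrow> c"
proof -
  have steps: "f (n + r) \<le> f n + real r" for n r
  proof (induction r)
    case (Suc r)
    then show ?case using step[of "n + r"] by simp
  qed simp
  define a where "a = (\<lambda>j. \<bar>f (j ^ p) / real (j ^ p) - c\<bar>)"
  define \<rho> where "\<rho> = (\<lambda>j. real (Suc j ^ p) / real (j ^ p))"
  have a: "a \<longlonglongrightarrow> 0"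
    using conv unfolding a_def by (auto intro!: tendsto_rabs_zero simp: LIM_zero_iff)
  have \<rho>: "\<rho> \<longlonglongrightarrow> 1"
  proof -
    have "(\<lambda>j. (1 + 1 / real j) ^ p) \<longlonglongrightarrow> (1 + 0) ^ p"
      by (intro tendsto_intros lim_1_over_n)
    moreover have "\<forall>\<^sub>F j in sequentially. (1 + 1 / real j) ^ p = \<rho> j"
      using eventually_gt_at_top[of 0]
    proof eventually_elim
      case (elim j)
      then have "1 + 1 / real j = real (Suc j) / real j" by (simp add: add_divide_distrib)
      then show ?case by (simp only: \<rho>_def power_divide of_nat_power)
    qed
    ultimately have "\<rho> \<longlonglongrightarrow> (1 + 0) ^ p" by (rule Lim_transform_eventually)
    then show ?thesis by simp
  qed
  have "(\<lambda>j. a j + a (Suc j) * \<rho> j + (1 + \<bar>c\<bar>) * (\<rho> j - 1)) \<longlonglongrightarrow> 0 + 0 * 1 + (1 + \<bar>c\<bar>) * (1 - 1)"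
    by (intro tendsto_intros a \<rho> LIMSEQ_Suc)
  then have b: "(\<lambda>j. a j + a (Suc j) * \<rho> j + (1 + \<bar>c\<bar>) * (\<rho> j - 1)) \<longlonglongrightarrow> 0" by simp
  let ?b = "\<lambda>j. a j + a (Suc j) * \<rho> j + (1 + \<bar>c\<bar>) * (\<rho> j - 1)"
  have bound: "\<bar>f n / real n - c\<bar> \<le> ?b j"
    if j: "0 < j" "j ^ p \<le> n" "n < Suc j ^ p" for n j
  proof -
    let ?M = "real (j ^ p)" and ?M' = "real (Suc j ^ p)"
    have M: "?M > 0" using j by simp
    have n: "?M \<le> real n" "real n \<le> ?M'" using j(2,3) by (simp_all only: of_nat_le_iff less_imp_le)
    have up: "f n \<le> f (j ^ p) + (real n - ?M)"
      using steps[of "j ^ p" "n - j ^ p"] j by (simp add: of_nat_diff del: of_nat_power)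
    have lo: "f (Suc j ^ p) \<le> f n + (?M' - real n)"
      using steps[of n "Suc j ^ p - n"] j by (simp add: of_nat_diff del: of_nat_power power_Suc)
    have A: "\<bar>f (j ^ p) - c * ?M\<bar> = a j * ?M"
    proof -
      have "f (j ^ p) - c * ?M = (f (j ^ p) / ?M - c) * ?M"
        using M by (simp add: left_diff_distrib del: of_nat_power)
      then show ?thesis using M by (simp add: a_def abs_mult del: of_nat_power)
    qed
    have A': "\<bar>f (Suc j ^ p) - c * ?M'\<bar> = a (Suc j) * ?M'"
    proof -
      have "?M' > 0" by simp
      then have "f (Suc j ^ p) - c * ?M' = (f (Suc j ^ p) / ?M' - c) * ?M'"
        by (simp add: left_diff_distrib del: of_nat_power)
      then show ?thesis using \<open>?M' > 0\<close> by (simp add: a_def abs_mult del: of_nat_power)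
    qed
    have h: "\<bar>c * real n - c * ?M\<bar> \<le> \<bar>c\<bar> * (?M' - ?M)" "\<bar>c * ?M' - c * real n\<bar> \<le> \<bar>c\<bar> * (?M' - ?M)"
      unfolding right_diff_distrib[symmetric] abs_mult using n by (intro mult_left_mono; simp)+
    have a0: "0 \<le> a j * ?M" "0 \<le> a (Suc j) * ?M'" unfolding A[symmetric] A'[symmetric] by simp_all
    have "(1 + \<bar>c\<bar>) * (?M' - ?M) = (?M' - ?M) + \<bar>c\<bar> * (?M' - ?M)" by (simp only: distrib_right mult_1)
    then have "\<bar>f n - c * real n\<bar> \<le> a j * ?M + a (Suc j) * ?M' + (1 + \<bar>c\<bar>) * (?M' - ?M)"
      using up lo A A' h a0 n unfolding abs_le_iff by linarith
    also have "\<dots> = ?b j * ?M"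
      using M by (simp add: \<rho>_def field_simps del: of_nat_power)
    also have "\<dots> \<le> ?b j * real n"
    proof (rule mult_left_mono[OF n(1)])
      have "1 \<le> \<rho> j" unfolding \<rho>_def using M n by (simp add: le_divide_eq del: of_nat_power)
      moreover have "0 \<le> a i" for i by (simp add: a_def)
      ultimately show "0 \<le> ?b j" by simp
    qed
    finally have "\<bar>f n - c * real n\<bar> \<le> ?b j * real n" .
    then have "\<bar>f n - c * real n\<bar> / real n \<le> ?b j"
    proof -
      have "real n > 0" using n M by linarith
      then show ?thesis
        using \<open>\<bar>f n - c * real n\<bar> \<le> ?b j * real n\<close>
        by (simp only: pos_divide_le_eq)
    qed
    moreover have "\<bar>f n - c * real n\<bar> / real n = \<bar>f n / real n - c\<bar>"
    proof -
      have "real n > 0" using n M by linarith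
      then have "f n / real n - c = (f n - c * real n) / real n" by (simp add: diff_divide_distrib)
      then show ?thesis by (simp add: abs_divide)
    qed
    ultimately show ?thesis by simp
  qed
  show ?thesis
  proof (rule LIMSEQ_I)
    fix e :: real assume e: "0 < e"
    have "\<forall>\<^sub>F j in sequentially. ?b j < e \<and> 0 < j"
      using order_tendstoD(2)[OF b e] eventually_gt_at_top[of 0] by eventually_elim auto
    then obtain J where J: "\<And>j. j \<ge> J \<Longrightarrow> ?b j < e \<and> 0 < j"
      by (auto simp: eventually_sequentially)
    show "\<exists>n0. \<forall>n\<ge>n0. norm (f n / real n - c) < e"
    proof (intro exI allI impI)
      fix n assume n: "J ^ p \<le> n"
      \<comment> \<open>\<open>n\<close> lies between the powers of \<open>i - 1\<close> and of \<open>i\<close>\<close>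
      define i where "i = (LEAST i. n < i ^ p)"
      have "n < Suc n ^ p"
        using self_le_power[of "Suc n" p] p by linarith
      then have i: "n < i ^ p" unfolding i_def by (rule LeastI)
      then have "J < i" using n by (meson le_less_trans not_le power_mono zero_le)
      then obtain j where j: "i = Suc j" "J \<le> j" by (cases i) auto
      have "\<not> n < j ^ p" using not_less_Least[of j "\<lambda>i. n < i ^ p"] j by (simp add: i_def[symmetric])
      then have "\<bar>f n / real n - c\<bar> \<le> ?b j"
        using J[OF j(2)] i j by (intro bound) auto
      then show "norm (f n / real n - c) < e" using J[OF j(2)] by simp
    qed
  qed
qed

text \<open>The sum of the \<open>D j\<close> is integrable, hence almost surely finite.\<close>

lemma AE_tendsto_of_summable_L1:
  fixes D :: "nat \<Rightarrow> 'b \<Rightarrow> real"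
  assumes int: "\<And>j. integrable N (D j)" and nonneg: "\<And>j \<omega>. 0 \<le> D j \<omega>"
    and w: "summable w" and le: "\<And>j. (\<integral>\<omega>. D j \<omega> \<partial>N) \<le> w j"
  shows "AE \<omega> in N. (\<lambda>j. D j \<omega>) \<longlonglongrightarrow> 0"
proof -
  have w0: "0 \<le> w j" for j
  proof -
    have "0 \<le> (\<integral>\<omega>. D j \<omega> \<partial>N)" using nonneg by (intro integral_nonneg_AE) simp
    then show ?thesis using le[of j] by simp
  qed
  have "(\<integral>\<^sup>+\<omega>. (\<Sum>j. ennreal (D j \<omega>)) \<partial>N) = (\<Sum>j. \<integral>\<^sup>+\<omega>. ennreal (D j \<omega>) \<partial>N)"
    using int by (intro nn_integral_suminf) auto
  also have "\<dots> = (\<Sum>j. ennreal (\<integral>\<omega>. D j \<omega> \<partial>N))"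
    using int nonneg by (intro suminf_cong nn_integral_eq_integral) auto
  also have "\<dots> \<le> (\<Sum>j. ennreal (w j))"
    by (intro suminf_le ennreal_leI le) auto
  also have "\<dots> = ennreal (suminf w)"
    using w w0 by (intro suminf_ennreal2) auto
  finally have "(\<integral>\<^sup>+\<omega>. (\<Sum>j. ennreal (D j \<omega>)) \<partial>N) \<noteq> \<infinity>"
    by (auto simp: top_unique)
  then have "AE \<omega> in N. (\<Sum>j. ennreal (D j \<omega>)) \<noteq> \<infinity>"
    using int by (intro nn_integral_noteq_infinite) auto
  then show ?thesis
  proof eventually_elim
    case (elim \<omega>)
    then have "summable (\<lambda>j. D j \<omega>)"
      using nonneg by (intro summable_suminf_not_top) auto
    then show ?case by (rule summable_LIMSEQ_zero)
  qed
qed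

text \<open>The error bound of \<open>capacity_sum_L1_estimate\<close> for \<open>n = x\<^bsup>16\<^esup>\<close>, \<open>m = x\<^bsup>8\<^esup>\<close> and
\<open>s = x\<^bsup>12\<^esup>\<close>. The exponents are chosen so that the truncation error \<open>m\<^bsup>-1/4\<^esup>\<close> becomes
\<open>x\<^bsup>-2\<^esup>\<close>, and \<open>s\<close> so that it is the square root of the variance \<open>n m\<close>.\<close>

lemma capacity_rate_le:
  fixes x B :: real
  assumes x: "x \<ge> 1" and B: "B > 0"
  shows "(2 * (x ^ 16 + 1) * (B * (x ^ 8 + 1) powr (- (1/4))) + (2 * x ^ 8 + 1)
        + ((x ^ 16 + 1) * (4 * x ^ 8 + 1) / x ^ 12 + x ^ 12) / 2) / x ^ 16
    \<le> (4 * B + 9) / x\<^sup>2"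
proof -
  have pow: "1 \<le> x ^ k" for k using x by (rule one_le_power)
  have mono: "x ^ i \<le> x ^ k" if "i \<le> k" for i k using x that by (intro power_increasing) auto
  have "(x ^ 8 + 1) powr (- (1/4)) \<le> (x ^ 8) powr (- (1/4))"
    using x by (intro powr_mono2') auto
  also have "\<dots> = 1 / x\<^sup>2"
  proof -
    have "(x ^ 8) powr (- (1/4)) = (x powr 8) powr (- (1/4))" using x by (simp add: powr_numeral)
    also have "\<dots> = x powr (- 2)" by (simp add: powr_powr)
    finally show ?thesis using x by (simp add: powr_minus_divide powr_numeral)
  qed
  finally have "2 * (x ^ 16 + 1) * (B * (x ^ 8 + 1) powr (- (1/4))) \<le> (4 * x ^ 16) * (B * (1 / x\<^sup>2))"
    using pow[of 16] B x by (intro mult_mono[of "2 * (x ^ 16 + 1)"] mult_left_mono[of _ _ B]) auto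
  also have "\<dots> = 4 * B * x ^ 14"
  proof -
    have e: "x ^ 16 = x ^ 14 * x\<^sup>2" by (simp add: power_add[symmetric])
    have "x ^ 14 * x\<^sup>2 / x\<^sup>2 = x ^ 14"
      by (rule nonzero_mult_div_cancel_right) (use x in simp)
    then have "x ^ 16 / x\<^sup>2 = x ^ 14" by (simp only: e)
    moreover have "4 * x ^ 16 * (B * (1 / x\<^sup>2)) = 4 * B * (x ^ 16 / x\<^sup>2)" by simp
    ultimately show ?thesis by (simp only:)
  qed
  finally have 1: "2 * (x ^ 16 + 1) * (B * (x ^ 8 + 1) powr (- (1/4))) \<le> 4 * B * x ^ 14" .
  have 2: "2 * x ^ 8 + 1 \<le> 3 * x ^ 14" using mono[of 8 14] pow[of 14] by simp
  have "(x ^ 16 + 1) * (4 * x ^ 8 + 1) \<le> (2 * x ^ 16) * (5 * x ^ 8)"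
    using pow[of 16] pow[of 8] x by (intro mult_mono) auto
  also have "\<dots> = 10 * x ^ 12 * x ^ 12" by (simp add: power_add[symmetric])
  finally have "(x ^ 16 + 1) * (4 * x ^ 8 + 1) / x ^ 12 \<le> 10 * x ^ 12"
    using x by (simp add: divide_le_eq)
  then have 3: "((x ^ 16 + 1) * (4 * x ^ 8 + 1) / x ^ 12 + x ^ 12) / 2 \<le> 6 * x ^ 14"
    using mono[of 12 14] pow[of 14] by simp
  have "(2 * (x ^ 16 + 1) * (B * (x ^ 8 + 1) powr (- (1/4))) + (2 * x ^ 8 + 1)
        + ((x ^ 16 + 1) * (4 * x ^ 8 + 1) / x ^ 12 + x ^ 12) / 2) / x ^ 16
    \<le> (4 * B * x ^ 14 + 3 * x ^ 14 + 6 * x ^ 14) / x ^ 16"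
    using x by (intro divide_right_mono add_mono 1 2 3) auto
  also have "\<dots> = (4 * B + 9) / x\<^sup>2"
  proof -
    have "x ^ 16 = x ^ 14 * x\<^sup>2" by (simp add: power_add[symmetric])
    then have "(4 * B * x ^ 14 + 3 * x ^ 14 + 6 * x ^ 14) / x ^ 16 = (x ^ 14 * (4 * B + 9)) / (x ^ 14 * x\<^sup>2)"
      by (simp only:) (simp add: algebra_simps)
    also have "\<dots> = (4 * B + 9) / x\<^sup>2"
      by (rule nonzero_mult_divide_mult_cancel_left) (use x in simp)
    finally show ?thesis .
  qed
  finally show ?thesis .
qed

theorem theorem1p1:
  fixes \<mu> :: "nat pmf"
  assumes "CARD('n::finite) \<ge> 7"
    and "critical_offspring_law \<mu>"
  shows "\<exists>c>0. \<forall>(M :: 'a measure) (X :: nat \<Rightarrow> 'a \<Rightarrow> int ^ 'n).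
           simple_random_walk M X \<longrightarrow>
           (AE \<omega> in M. (\<lambda>n. BCap \<mu> (walk_range X n \<omega>) / real n) \<longlonglongrightarrow> c)"
proof -
  obtain c B :: real where c: "c > 0" and B: "B > 0"
    and c_le: "\<And>m. c \<le> escape_mean TYPE('n) \<mu> m m"
    and le_c: "\<And>m. escape_mean TYPE('n) \<mu> m m \<le> c + B * (real m + 1) powr (- (1/4))"
    and trunc: "\<And>a b m. escape_mean TYPE('n) \<mu> (min a m) (min b m)
        \<le> escape_mean TYPE('n) \<mu> a b + B * (real m + 1) powr (- (1/4))"
    by (rule escape_mean_limit[OF assms(2,1)]) blast
  show ?thesis
  proof (intro exI[of _ c] conjI allI impI c)
    fix M :: "'a measure" and X :: "nat \<Rightarrow> 'a \<Rightarrow> int ^ 'n"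
    assume "simple_random_walk M X"
    then have Y: "iid_steps M (\<lambda>n \<omega>. X (Suc n) \<omega> - X n \<omega>)" by (rule iid_steps_simple_random_walk)
    define f where "f = (\<lambda>n \<omega>. capacity_sum \<mu> n (\<lambda>i. X (Suc i) \<omega> - X i \<omega>))"
    define D where "D = (\<lambda>j \<omega>. \<bar>f (Suc j ^ 16) \<omega> / real (Suc j ^ 16) - c\<bar>)"
    interpret iid_steps M "\<lambda>n \<omega>. X (Suc n) \<omega> - X n \<omega>" by (rule Y)
    have int_f: "integrable M (f n)" for n
      unfolding f_def by (rule capacity_sum_L1_estimate(1)[OF Y c B zero_less_one c_le le_c trunc])
    have "AE \<omega> in M. (\<lambda>j. D j \<omega>) \<longlonglongrightarrow> 0"
    proof (rule AE_tendsto_of_summable_L1)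
      show "integrable M (D j)" for j unfolding D_def using int_f by auto
      show "0 \<le> D j \<omega>" for j \<omega> by (simp add: D_def)
      have "summable (\<lambda>j. 1 / (real j)\<^sup>2)" using inverse_power_summable[of 2, where 'a = real] by (simp add: field_simps)
      then have "summable (\<lambda>j. 1 / (real (Suc j))\<^sup>2)" by (subst summable_Suc_iff)
      then show "summable (\<lambda>j. (4 * B + 9) * (1 / (real (Suc j))\<^sup>2))" by (rule summable_mult)
      fix j
      let ?x = "real (Suc j)"
      have "(\<integral>\<omega>. D j \<omega> \<partial>M) = (\<integral>\<omega>. \<bar>f (Suc j ^ 16) \<omega> - real (Suc j ^ 16) * c\<bar> / real (Suc j ^ 16) \<partial>M)"
      proof (rule Bochner_Integration.integral_cong[OF refl])
        fix \<omega>
        have "real (Suc j ^ 16) > 0" by simp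
        then have "f (Suc j ^ 16) \<omega> / real (Suc j ^ 16) - c = (f (Suc j ^ 16) \<omega> - real (Suc j ^ 16) * c) / real (Suc j ^ 16)"
          by (simp add: diff_divide_distrib del: of_nat_power of_nat_Suc power_Suc)
        then show "D j \<omega> = \<bar>f (Suc j ^ 16) \<omega> - real (Suc j ^ 16) * c\<bar> / real (Suc j ^ 16)"
          by (simp add: D_def abs_divide del: of_nat_power of_nat_Suc power_Suc)
      qed
      also have "\<dots> = (\<integral>\<omega>. \<bar>f (Suc j ^ 16) \<omega> - real (Suc j ^ 16) * c\<bar> \<partial>M) / real (Suc j ^ 16)"
        by (rule integral_divide_zero)
      also have "\<dots> \<le> (2 * (real (Suc j ^ 16) + 1) * (B * (real (Suc j ^ 8) + 1) powr (- (1/4))) + (2 * real (Suc j ^ 8) + 1)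
        + ((real (Suc j ^ 16) + 1) * (4 * real (Suc j ^ 8) + 1) / ?x ^ 12 + ?x ^ 12) / 2) / real (Suc j ^ 16)"
        unfolding f_def
        by (intro divide_right_mono capacity_sum_L1_estimate(2)[OF Y c B _ c_le le_c trunc]) auto
      also have "\<dots> \<le> (4 * B + 9) / ?x\<^sup>2"
        unfolding of_nat_power by (rule capacity_rate_le) (use B in auto)
      finally show "(\<integral>\<omega>. D j \<omega> \<partial>M) \<le> (4 * B + 9) * (1 / ?x\<^sup>2)" by simp
    qed
    then show "AE \<omega> in M. (\<lambda>n. BCap \<mu> (walk_range X n \<omega>) / real n) \<longlonglongrightarrow> c"
    proof eventually_elim
      case (elim \<omega>)
      then have "(\<lambda>j. f (Suc j ^ 16) \<omega> / real (Suc j ^ 16) - c) \<longlonglongrightarrow> 0"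
        unfolding D_def by (rule tendsto_rabs_zero_cancel)
      then have "(\<lambda>j. f (Suc j ^ 16) \<omega> / real (Suc j ^ 16)) \<longlonglongrightarrow> c"
        by (simp only: LIM_zero_iff)
      then have "(\<lambda>j. f (j ^ 16) \<omega> / real (j ^ 16)) \<longlonglongrightarrow> c"
        by (rule LIMSEQ_imp_Suc)
      then have "(\<lambda>n. f n \<omega> / real n) \<longlonglongrightarrow> c"
        by (rule tendsto_along_powers[rotated 2]) (auto simp: f_def capacity_sum_Suc_le)
      then show ?case by (simp add: f_def BCap_walk_range)
    qed
  qed
qed

end
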